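(* Let $n\in\mathbb{N}$, $a<b$, $\tau>0$, $A_d\in L_\infty^{n\times3n}[a,b]$, and let $B\in\mathbb{R}^{2n\times4n}$ be such that the $2n\times2n$ matrix $BH$ is invertible. Let $\mathcal{T}_1,\mathcal{T}_2,\mathcal{A}_{22},\mathcal{A}_{11,d},\mathcal{A}_{12}$ be the operators defined in the context. For an input $\mathbf{v}(t)\in L_2^n[a,b]$, consider the PIE with output $\mathbf{p}$ $$\mathcal{T}_1\mathbf{v}_t(t)+\mathcal{T}_2\boldsymbol\psi_t(t)=\mathcal{A}_{22}\boldsymbol\psi(t),\qquad\mathbf{p}(t)=\mathcal{A}_{11,d}\mathbf{v}(t)+\mathcal{A}_{12}\boldsymbol\psi(t),\qquad\boldsymbol\psi(t)\in L_2^n[[0,1]\times[a,b]],$$ and the PDE with output $\mathbf{p}$ $$\boldsymbol\phi_t(t)=-\tfrac1\tau\boldsymbol\phi_s(t),\qquad\mathbf{p}(t)=A_d\begin{bmatrix}\boldsymbol\phi(t,1)\\ \boldsymbol\phi_x(t,1)\\ \boldsymbol\phi_{xx}(t,1)\end{bmatrix},\qquad\boldsymbol\phi(t)\in Y_{\mathcal{T}_1\mathbf{v}(t)}.$$ Then, for any given input $\mathbf{v}(t)\in L_2^n[a,b]$: (1) $(\boldsymbol\psi,\mathbf{p})$ solves the PIE with initial state $\boldsymbol\psi_0\in L_2^n[[0,1]\times[a,b]]$ if and only if $(\boldsymbol\phi,\mathbf{p})$ with $\boldsymbol\phi=\mathcal{T}_1\mathbf{v}+\mathcal{T}_2\boldsymbol\psi$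 solves the PDE with initial state $\boldsymbol\phi_0=\mathcal{T}_1\mathbf{v}(0)+\mathcal{T}_2\boldsymbol\psi_0$. (2) Conversely, $(\boldsymbol\phi,\mathbf{p})$ solves the PDE with initial state $\boldsymbol\phi_0\in Y_{\mathcal{T}_1\mathbf{v}(0)}$ if and only if $(\boldsymbol\psi,\mathbf{p})$ with $\boldsymbol\psi=\partial_s\partial_x^2\boldsymbol\phi$ solves the PIE with initial state $\boldsymbol\psi_0=\partial_s\partial_x^2\boldsymbol\phi_0$.
   Context: Spaces. $H_2^n[a,b]$ is the set of $\mathbf{u}$ with $\mathbf{u},\mathbf{u}_x,\mathbf{u}_{xx}\in L_2^n[a,b]$; $H_{(1,2)}^n$ is the set of $\boldsymbol\phi(s,x)$ on $[0,1]\times[a,b]$ with $\partial_s^\alpha\partial_x^\beta\boldsymbol\phi\in L_2^n$ for all $0\le\alpha\le1$, $0\le\beta\le2$. $X_B=\{\mathbf{u}\in H_2^n[a,b]: B\,(\mathbf{u}(a),\mathbf{u}(b),\mathbf{u}_x(a),\mathbf{u}_x(b))^T=0\}$ and $Y_{\mathbf{u}}=\{\boldsymbol\phi\in H_{(1,2)}^n:\boldsymbol\phi(0,x)=\mathbf{u}(x),\ \boldsymbol\phi(s,\cdot)\in X_B\}$. Functions of $x$ alone are viewed as functions of $(s,x)$ constant in $s$ where needed. Operators. Let $$H=\begin{bmatrix} I_n & 0\\ I_n & (b-a) I_n\\ 0 & I_n\\ 0 & I_n\end{bmatrix},\quad Q(x,\theta)=\begin{bmatrix} 0\\ (b-\theta)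 I_n\\ 0\\ I_n\end{bmatrix},\quad K(x)=\begin{bmatrix} I_n & (x-a) I_n\end{bmatrix},$$ $$T_2(x,\theta)=-K(x)(BH)^{-1}BQ(x,\theta),\qquad T_1(x,\theta)=(x-\theta)I_n+T_2(x,\theta),$$ $$(\mathcal{T}_1\mathbf{w})(x)=\int_a^xT_1(x,\theta)\mathbf{w}(\theta)d\theta+\int_x^bT_2(x,\theta)\mathbf{w}(\theta)d\theta,$$ $$(\mathcal{A}_{11,d}\mathbf{w})(x)=A_{d,0}(x)\mathbf{w}(x)+\int_a^xA_{d,1}(x,\theta)\mathbf{w}(\theta)d\theta+\int_x^bA_{d,2}(x,\theta)\mathbf{w}(\theta)d\theta,$$ where $A_{d,0}(x)=A_d(x)\begin{bmatrix} 0\\ 0\\ I_n\end{bmatrix}$, $A_{d,j}(x,\theta)=A_d(x)\begin{bmatrix}T_j(x,\theta)\\ \partial_xT_j(x,\theta)\\ 0\end{bmatrix}$ for $j=1,2$; and for $\hat{\mathbf{v}}\in L_2^n[[0,1]\times[a,b]]$, $$(\mathcal{T}_2\hat{\mathbf{v}})(s)=\int_0^s\mathcal{T}_1\hat{\mathbf{v}}(\theta)d\theta,\quad\mathcal{A}_{12}\hat{\mathbf{v}}=\int_0^1\mathcal{A}_{11,d}\hat{\mathbf{v}}(s)ds,\quad(\mathcal{A}_{22}\hat{\mathbf{v}})(s)=-\tfrac1\tau\mathcal{T}_1\hat{\mathbf{v}}(s).$$ Solutions. A pair (state, output) solves the PIE (partial integral equation), respectively the PDE, with a given initial state if the state is Fréchet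 differentiable in $t$, equals the initial state at $t=0$, and the stated equations and membership condition hold for all $t\ge0$.
   Formalization: In (2), φ(t) ∈ Y_{T1 v(t)} for all t ≥ 0 is assumed of the candidate φ, since ψ = ∂s∂x²φ alone does not determine φ and the converse fails without it; Fréchet differentiability of φ is taken in the H_(1,2) norm, as the claim fails with the L2 norm. *)

theory Defs
  imports "HOL-Analysis.Analysis"
begin

section \<open>Block vectors and matrices\<close>

text \<open>
  Index types are sums of copies of \<open>'n\<close>, where \<open>n = CARD('n)\<close>; thus a \<open>2n \<times> 4n\<close> matrix has type
  \<open>real^('n+'n+'n+'n)^('n+'n)\<close>. Since a matrix is the vector of its rows, \<open>on_top\<close> stacks both
  vectors and matrices.
\<close>

definition on_top :: "'a^'p \<Rightarrow> 'a^'q \<Rightarrow> 'a^('p + 'q)"  (infixr "on'_top" 60)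
  where "A on_top B = (\<chi> i. case i of Inl k \<Rightarrow> A $ k | Inr k \<Rightarrow> B $ k)"

definition beside :: "'a^'p^'m \<Rightarrow> 'a^'q^'m \<Rightarrow> 'a^('p + 'q)^'m"  (infixr "beside" 61)
  where "A beside B = (\<chi> i. A $ i on_top B $ i)"


section \<open>Lebesgue spaces\<close>

text \<open>
  Elements of \<open>L\<^sub>2\<close> and \<open>L\<^sub>\<infinity>\<close> are represented by functions; equality in these spaces is
  equality almost everywhere.
\<close>

definition L2 :: "'a::euclidean_space set \<Rightarrow> ('a \<Rightarrow> 'v::euclidean_space) set"
  where "L2 S = {f. f \<in> borel_measurable (lebesgue_on S) \<and>
                    integrable (lebesgue_on S) (\<lambda>z. (norm (f z))\<^sup>2)}"

definition L2_norm :: "'a::euclidean_space set \<Rightarrow> ('a \<Rightarrow> 'v::euclidean_space) \<Rightarrow> real"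
  where "L2_norm S f = sqrt (LINT z|lebesgue_on S. (norm (f z))\<^sup>2)"

definition Linf :: "'a::euclidean_space set \<Rightarrow> ('a \<Rightarrow> 'v::euclidean_space) set"
  where "Linf S = {f. f \<in> borel_measurable (lebesgue_on S) \<and>
                      (\<exists>C. AE z in lebesgue_on S. norm (f z) \<le> C)}"


section \<open>Weak derivatives\<close>

definition pd :: "'a::euclidean_space \<Rightarrow> ('a \<Rightarrow> real) \<Rightarrow> 'a \<Rightarrow> real"
  where "pd d f z = frechet_derivative f (at z) d"

primrec Ck :: "nat \<Rightarrow> ('a::euclidean_space \<Rightarrow> real) \<Rightarrow> bool"
  where
    "Ck 0 f = continuous_on UNIV f"
  | "Ck (Suc k) f = ((\<forall>z. f differentiable (at z)) \<and> (\<forall>d\<in>Basis. Ck k (pd d f)))"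

text \<open>The space \<open>C\<^sub>c\<^sup>\<infinity>(U)\<close>, for open \<open>U\<close>.\<close>

definition test_fun :: "'a::euclidean_space set \<Rightarrow> ('a \<Rightarrow> real) set"
  where "test_fun U = {\<eta>. (\<forall>k. Ck k \<eta>) \<and> (\<exists>C. compact C \<and> C \<subseteq> U \<and> (\<forall>z. z \<notin> C \<longrightarrow> \<eta> z = 0))}"

text \<open>
  \<open>weak_deriv S ds f g\<close>: the function \<open>g\<close> is a representative of the weak (distributional)
  derivative of \<open>f\<close> on the interior of \<open>S\<close>, taken successively in the directions listed in
  \<open>ds\<close>, and both functions lie in \<open>L\<^sub>2\<close>.
\<close>

definition weak_deriv ::
    "'a::euclidean_space set \<Rightarrow> 'a list \<Rightarrow> ('a \<Rightarrow> 'v::euclidean_space) \<Rightarrow> ('a \<Rightarrow> 'v) \<Rightarrow> bool"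
  where "weak_deriv S ds f g \<longleftrightarrow> f \<in> L2 S \<and> g \<in> L2 S \<and>
     (\<forall>\<eta>\<in>test_fun (interior S).
        (LINT z|lebesgue_on S. (foldr pd ds \<eta>) z *\<^sub>R f z)
          = (-1) ^ length ds *\<^sub>R (LINT z|lebesgue_on S. \<eta> z *\<^sub>R g z))"

text \<open>\<open>\<partial>\<^sub>x\<^sup>\<beta>\<close> on \<open>[a,b]\<close>, and \<open>\<partial>\<^sub>s\<^sup>\<alpha> \<partial>\<^sub>x\<^sup>\<beta>\<close> on \<open>[0,1] \<times> [a,b]\<close>; points of the rectangle are pairs \<open>(s, x)\<close>.\<close>

abbreviation wd1 :: "real \<Rightarrow> real \<Rightarrow> nat \<Rightarrow> (real \<Rightarrow> 'v::euclidean_space) \<Rightarrow> (real \<Rightarrow> 'v) \<Rightarrow> bool"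
  where "wd1 a b \<beta> \<equiv> weak_deriv {a..b} (replicate \<beta> 1)"

abbreviation rect :: "real \<Rightarrow> real \<Rightarrow> (real \<times> real) set"
  where "rect a b \<equiv> {0..1} \<times> {a..b}"

abbreviation wd2 :: "real \<Rightarrow> real \<Rightarrow> nat \<Rightarrow> nat \<Rightarrow>
    (real \<times> real \<Rightarrow> 'v::euclidean_space) \<Rightarrow> (real \<times> real \<Rightarrow> 'v) \<Rightarrow> bool"
  where "wd2 a b \<alpha> \<beta> \<equiv> weak_deriv (rect a b) (replicate \<alpha> (1, 0) @ replicate \<beta> (0, 1))"


section \<open>Sobolev spaces and boundary conditions\<close>

text \<open>
  The elements of \<open>H\<^sub>2\<close> and \<open>H\<^bsub>(1,2)\<^esub>\<close> have unique continuous representatives (Sobolev embedding).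
  These are the representatives used here, so that the point values \<open>u(a)\<close>, \<open>u(b)\<close> and the
  restrictions \<open>\<phi>(s,\<cdot>)\<close> make sense.
\<close>

definition H2 :: "real \<Rightarrow> real \<Rightarrow> (real \<Rightarrow> 'v::euclidean_space) set"
  where "H2 a b = {u. continuous_on {a..b} u \<and> (\<forall>\<beta>\<le>2. \<exists>g. wd1 a b \<beta> u g)}"

definition H12 :: "real \<Rightarrow> real \<Rightarrow> (real \<times> real \<Rightarrow> 'v::euclidean_space) set"
  where "H12 a b = {\<phi>. continuous_on (rect a b) \<phi> \<and> (\<forall>\<alpha>\<le>1. \<forall>\<beta>\<le>2. \<exists>g. wd2 a b \<alpha> \<beta> \<phi> g)}"

text \<open>
  Weak derivatives are unique up to null sets, so the choice of the representative does not
  affect the norm.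
\<close>

definition H12_norm :: "real \<Rightarrow> real \<Rightarrow> (real \<times> real \<Rightarrow> 'v::euclidean_space) \<Rightarrow> real"
  where "H12_norm a b \<phi> =
    sqrt (\<Sum>\<alpha>\<le>1. \<Sum>\<beta>\<le>2. (L2_norm (rect a b) (SOME g. wd2 a b \<alpha> \<beta> \<phi> g))\<^sup>2)"

text \<open>The boundary values of \<open>u\<^sub>x\<close> are those of its continuous representative \<open>ux\<close>.\<close>

definition X_B :: "real \<Rightarrow> real \<Rightarrow> real^('n::finite + 'n + 'n + 'n)^('n + 'n) \<Rightarrow> (real \<Rightarrow> real^'n) set"
  where "X_B a b B = {u \<in> H2 a b.
     \<exists>ux. continuous_on {a..b} ux \<and> wd1 a b 1 u ux \<and>
          B *v (u a on_top u b on_top ux a on_top ux b) = 0}"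

definition Y_space :: "real \<Rightarrow> real \<Rightarrow> real^('n::finite + 'n + 'n + 'n)^('n + 'n) \<Rightarrow>
    (real \<Rightarrow> real^'n) \<Rightarrow> (real \<times> real \<Rightarrow> real^'n) set"
  where "Y_space a b B u = {\<phi> \<in> H12 a b.
     (\<forall>x\<in>{a..b}. \<phi> (0, x) = u x) \<and> (\<forall>s\<in>{0..1}. (\<lambda>x. \<phi> (s, x)) \<in> X_B a b B)}"


section \<open>Operators\<close>

definition H_mat :: "real \<Rightarrow> real \<Rightarrow> real^('n::finite + 'n)^('n + 'n + 'n + 'n)"
  where "H_mat a b =
     (mat 1 beside 0) on_top
     (mat 1 beside mat (b - a)) on_top
     (0 beside mat 1) on_top
     (0 beside mat 1)"

definition Q_mat :: "real \<Rightarrow> real \<Rightarrow> real^'n::finite^('n + 'n + 'n + 'n)"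
  where "Q_mat b \<theta> = 0 on_top mat (b - \<theta>) on_top 0 on_top mat 1"

definition K_mat :: "real \<Rightarrow> real \<Rightarrow> real^('n::finite + 'n)^'n"
  where "K_mat a x = mat 1 beside mat (x - a)"

definition T2_ker :: "real \<Rightarrow> real \<Rightarrow> real^('n::finite + 'n + 'n + 'n)^('n + 'n) \<Rightarrow>
    real \<Rightarrow> real \<Rightarrow> real^'n^'n"
  where "T2_ker a b B x \<theta> = - (K_mat a x ** matrix_inv (B ** H_mat a b) ** B ** Q_mat b \<theta>)"

definition T1_ker :: "real \<Rightarrow> real \<Rightarrow> real^('n::finite + 'n + 'n + 'n)^('n + 'n) \<Rightarrow>
    real \<Rightarrow> real \<Rightarrow> real^'n^'n"
  where "T1_ker a b B x \<theta> = mat (x - \<theta>) + T2_ker a b B x \<theta>"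

definition T1_op :: "real \<Rightarrow> real \<Rightarrow> real^('n::finite + 'n + 'n + 'n)^('n + 'n) \<Rightarrow>
    (real \<Rightarrow> real^'n) \<Rightarrow> real \<Rightarrow> real^'n"
  where "T1_op a b B w x =
     (LINT \<theta>:{a..x}|lebesgue. T1_ker a b B x \<theta> *v w \<theta>) +
     (LINT \<theta>:{x..b}|lebesgue. T2_ker a b B x \<theta> *v w \<theta>)"

definition Ad0 :: "(real \<Rightarrow> real^('n::finite + 'n + 'n)^'n) \<Rightarrow> real \<Rightarrow> real^'n^'n"
  where "Ad0 A_d x = A_d x ** (0 on_top 0 on_top mat 1)"

definition Ad_ker :: "(real \<Rightarrow> real^('n::finite + 'n + 'n)^'n) \<Rightarrow>
    (real \<Rightarrow> real \<Rightarrow> real^'n^'n) \<Rightarrow> real \<Rightarrow> real \<Rightarrow> real^'n^'n"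
  where "Ad_ker A_d T x \<theta> =
     A_d x ** (T x \<theta> on_top vector_derivative (\<lambda>y. T y \<theta>) (at x) on_top 0)"

definition A11d_op :: "real \<Rightarrow> real \<Rightarrow> real^('n::finite + 'n + 'n + 'n)^('n + 'n) \<Rightarrow>
    (real \<Rightarrow> real^('n + 'n + 'n)^'n) \<Rightarrow> (real \<Rightarrow> real^'n) \<Rightarrow> real \<Rightarrow> real^'n"
  where "A11d_op a b B A_d w x =
     Ad0 A_d x *v w x +
     (LINT \<theta>:{a..x}|lebesgue. Ad_ker A_d (T1_ker a b B) x \<theta> *v w \<theta>) +
     (LINT \<theta>:{x..b}|lebesgue. Ad_ker A_d (T2_ker a b B) x \<theta> *v w \<theta>)"

definition T2_op :: "real \<Rightarrow> real \<Rightarrow> real^('n::finite + 'n + 'n + 'n)^('n + 'n) \<Rightarrow>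
    (real \<times> real \<Rightarrow> real^'n) \<Rightarrow> real \<times> real \<Rightarrow> real^'n"
  where "T2_op a b B \<psi> = (\<lambda>(s, x). LINT \<theta>:{0..s}|lebesgue. T1_op a b B (\<lambda>y. \<psi> (\<theta>, y)) x)"

definition A12_op :: "real \<Rightarrow> real \<Rightarrow> real^('n::finite + 'n + 'n + 'n)^('n + 'n) \<Rightarrow>
    (real \<Rightarrow> real^('n + 'n + 'n)^'n) \<Rightarrow> (real \<times> real \<Rightarrow> real^'n) \<Rightarrow> real \<Rightarrow> real^'n"
  where "A12_op a b B A_d \<psi> x = (LINT s:{0..1}|lebesgue. A11d_op a b B A_d (\<lambda>y. \<psi> (s, y)) x)"

definition A22_op :: "real \<Rightarrow> real \<Rightarrow> real^('n::finite + 'n + 'n + 'n)^('n + 'n) \<Rightarrow> real \<Rightarrow>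
    (real \<times> real \<Rightarrow> real^'n) \<Rightarrow> real \<times> real \<Rightarrow> real^'n"
  where "A22_op a b B \<tau> \<psi> = (\<lambda>(s, x). - (1 / \<tau>) *\<^sub>R T1_op a b B (\<lambda>y. \<psi> (s, y)) x)"

text \<open>\<open>\<T>\<^sub>1 v + \<T>\<^sub>2 \<psi>\<close>, with \<open>\<T>\<^sub>1 v\<close> constant in \<open>s\<close>.\<close>

definition T12_op :: "real \<Rightarrow> real \<Rightarrow> real^('n::finite + 'n + 'n + 'n)^('n + 'n) \<Rightarrow>
    (real \<Rightarrow> real^'n) \<Rightarrow> (real \<times> real \<Rightarrow> real^'n) \<Rightarrow> real \<times> real \<Rightarrow> real^'n"
  where "T12_op a b B v \<psi> = (\<lambda>(s, x). T1_op a b B v x + T2_op a b B \<psi> (s, x))"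


section \<open>Solutions\<close>

text \<open>
  \<open>time_deriv N u u' t\<close>: the curve \<open>u\<close>, defined for times in \<open>[0,\<infinity>)\<close>, is Frechet differentiable
  at \<open>t\<close> with derivative \<open>h \<mapsto> h u'\<close>, with respect to the (semi)norm \<open>N\<close>; one-sided at \<open>t = 0\<close>.
\<close>

definition time_deriv ::
    "(('a \<Rightarrow> 'v::real_vector) \<Rightarrow> real) \<Rightarrow> (real \<Rightarrow> 'a \<Rightarrow> 'v) \<Rightarrow> ('a \<Rightarrow> 'v) \<Rightarrow> real \<Rightarrow> bool"
  where "time_deriv N u u' t \<longleftrightarrow>
     ((\<lambda>r. N (\<lambda>z. u r z - u t z - (r - t) *\<^sub>R u' z) / \<bar>r - t\<bar>) \<longlongrightarrow> 0) (at t within {0..})"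

text \<open>
  The state space of the PIE is \<open>L\<^sub>2\<close> of the rectangle; since \<open>v\<^sub>t\<close> occurs in the PIE, its
  existence in \<open>L\<^sub>2\<close> is part of being a solution.
\<close>

definition PIE_solution ::
    "real \<Rightarrow> real \<Rightarrow> real^('n::finite + 'n + 'n + 'n)^('n + 'n) \<Rightarrow> real \<Rightarrow>
     (real \<Rightarrow> real^('n + 'n + 'n)^'n) \<Rightarrow> (real \<Rightarrow> real \<Rightarrow> real^'n) \<Rightarrow>
     (real \<Rightarrow> real \<times> real \<Rightarrow> real^'n) \<Rightarrow> (real \<Rightarrow> real \<Rightarrow> real^'n) \<Rightarrow>
     (real \<times> real \<Rightarrow> real^'n) \<Rightarrow> bool"
  where "PIE_solution a b B \<tau> A_d v \<psi> p \<psi>0 \<longleftrightarrow>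
     (AE z in lebesgue_on (rect a b). \<psi> 0 z = \<psi>0 z) \<and>
     (\<forall>t\<ge>0.
        \<psi> t \<in> L2 (rect a b) \<and>
        (\<exists>vt \<in> L2 {a..b}. \<exists>\<psi>t \<in> L2 (rect a b).
           time_deriv (L2_norm {a..b}) v vt t \<and>
           time_deriv (L2_norm (rect a b)) \<psi> \<psi>t t \<and>
           (AE z in lebesgue_on (rect a b). T12_op a b B vt \<psi>t z = A22_op a b B \<tau> (\<psi> t) z)) \<and>
        (AE x in lebesgue_on {a..b}.
           p t x = A11d_op a b B A_d (v t) x + A12_op a b B A_d (\<psi> t) x))"

text \<open>
  The state space of the PDE is contained in \<open>H\<^bsub>(1,2)\<^esub>\<close>, and time derivatives are taken in its norm.
  In the output, \<open>\<phi>(t,1)\<close> is the restriction to \<open>s = 1\<close>, a member of \<open>H\<^sub>2\<close>, and \<open>\<phi>\<^sub>x(t,1)\<close>,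
  \<open>\<phi>\<^bsub>xx\<^esub>(t,1)\<close> are its derivatives.
\<close>

definition PDE_solution ::
    "real \<Rightarrow> real \<Rightarrow> real^('n::finite + 'n + 'n + 'n)^('n + 'n) \<Rightarrow> real \<Rightarrow>
     (real \<Rightarrow> real^('n + 'n + 'n)^'n) \<Rightarrow> (real \<Rightarrow> real \<Rightarrow> real^'n) \<Rightarrow>
     (real \<Rightarrow> real \<times> real \<Rightarrow> real^'n) \<Rightarrow> (real \<Rightarrow> real \<Rightarrow> real^'n) \<Rightarrow>
     (real \<times> real \<Rightarrow> real^'n) \<Rightarrow> bool"
  where "PDE_solution a b B \<tau> A_d v \<phi> p \<phi>0 \<longleftrightarrow>
     (\<forall>z\<in>rect a b. \<phi> 0 z = \<phi>0 z) \<and>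
     (\<forall>t\<ge>0.
        \<phi> t \<in> Y_space a b B (T1_op a b B (v t)) \<and>
        (\<exists>\<phi>t \<in> H12 a b. \<exists>\<phi>s.
           time_deriv (H12_norm a b) \<phi> \<phi>t t \<and>
           wd2 a b 1 0 (\<phi> t) \<phi>s \<and>
           (AE z in lebesgue_on (rect a b). \<phi>t z = - (1 / \<tau>) *\<^sub>R \<phi>s z)) \<and>
        (\<exists>\<phi>x \<phi>xx.
           wd1 a b 1 (\<lambda>x. \<phi> t (1, x)) \<phi>x \<and>
           wd1 a b 2 (\<lambda>x. \<phi> t (1, x)) \<phi>xx \<and>
           (AE x in lebesgue_on {a..b}.
              p t x = A_d x *v (\<phi> t (1, x) on_top \<phi>x x on_top \<phi>xx x))))"

end

theory Submission
  imports Defs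
begin

text \<open>
  The theorem holds because \<open>(v, \<psi>) \<mapsto> \<T>\<^sub>1 v + \<T>\<^sub>2 \<psi>\<close> identifies pairs of \<open>L\<^sub>2\<close> functions with the
  states that satisfy the boundary conditions, and because this identification is linear and
  respects norms in both directions. Three facts carry the proof.

  The first is that the map lands in the right space. The function \<open>\<T>\<^sub>1 w\<close> is the double primitive
  of \<open>w\<close> plus the affine function \<open>K(x) c\<close> whose coefficients \<open>c\<close> make the boundary conditions
  true (\<open>T1_op_eq_Tk\<close>, \<open>Tk_boundary_condition\<close>). As \<open>\<T>\<^sub>1\<close> commutes with integration in \<open>s\<close>
  (\<open>Tk_WW\<close>), the state is \<open>\<phi> = \<T>\<^sub>1 W\<close> with \<open>W(s,x) = v(x) + \<integral>\<^sub>0\<^sup>s \<psi>(r,x) dr\<close>. Hence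
  \<open>\<partial>\<^sub>x\<^sup>2 \<phi> = W\<close>, \<open>\<partial>\<^sub>s \<phi> = \<T>\<^sub>1 \<psi>\<close> and \<open>\<partial>\<^sub>s \<partial>\<^sub>x\<^sup>2 \<phi> = \<psi>\<close>, all in the weak sense
  (\<open>T12_weak_derivatives\<close>), and \<open>\<phi>\<close> is continuous and bounded in \<open>H\<^bsub>(1,2)\<^esub>\<close> by the norms of \<open>v\<close>
  and \<open>\<psi>\<close> (\<open>T12_in_Y\<close>, \<open>T12_bounded\<close>). Boundedness turns derivatives in time of \<open>v\<close> and \<open>\<psi>\<close>
  into one of \<open>\<phi>\<close>.

  The second is that every state is an image: if \<open>\<phi>\<close> lies in \<open>Y\<close> for \<open>\<T>\<^sub>1 v\<close>, then
  \<open>\<phi> = \<T>\<^sub>1 v + \<T>\<^sub>2 \<partial>\<^sub>s \<partial>\<^sub>x\<^sup>2 \<phi>\<close> (\<open>state_eq_T12\<close>). The difference of both sides vanishes at \<open>s = 0\<close>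
  and has mixed derivative \<open>\<partial>\<^sub>s \<partial>\<^sub>x\<^sup>2\<close> equal to 0, so every slice in \<open>x\<close> is affine; an affine function
  that satisfies the boundary conditions is 0 because \<open>B H\<close> is invertible.

  The third is that a derivative in time of \<open>\<phi>\<close> yields derivatives of \<open>\<psi>\<close> and of the input \<open>v\<close>
  (\<open>time_derivs_of_state\<close>). For \<open>\<psi> = \<partial>\<^sub>s \<partial>\<^sub>x\<^sup>2 \<phi>\<close> this is immediate from the norm, and \<open>v\<close> is
  recovered by averaging \<open>\<partial>\<^sub>x\<^sup>2 \<phi> - \<integral>\<^sub>0\<^sup>s \<psi>\<close> over \<open>s\<close>.

  With these facts the two evolution equations are the same equation, as the two sides of the PIE are
  \<open>\<phi>\<^sub>t\<close> and \<open>-\<phi>\<^sub>s / \<tau>\<close>, and the two output equations agree since \<open>A\<^sub>d(x)\<close> can be taken out of every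
  integral (\<open>output_rep\<close>). This gives the first part; the second part is the first one after
  writing \<open>\<phi>\<close> in the form above.

  Two technical devices occur throughout. Smooth bumps that approximate boxes give the uniqueness
  of weak derivatives (\<open>fundamental_lemma\<close>). And since Fubini's theorem concerns Borel functions,
  whereas the spaces consist of Lebesgue measurable ones, all computations are made with Borel
  representatives that have square integrable sections (\<open>B2\<close>, \<open>B22\<close>).
\<close>


section \<open>Smooth test functions\<close>

lemma pd_at:
  assumes "(f has_derivative f') (at z)"
  shows "pd d f z = f' d"
  using frechet_derivative_at[OF assms] by (simp add: pd_def)

lemma Ck_differentiable: "Ck (Suc k) f \<Longrightarrow> f differentiable (at z)"
  by simp

lemma Ck_Suc_imp_Ck: "Ck (Suc k) f \<Longrightarrow> Ck k f"
proof (induction k arbitrary: f)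
  case 0
  then show ?case
    by (auto simp: continuous_on_eq_continuous_at intro: differentiable_imp_continuous_within)
next
  case (Suc k)
  then show ?case by (metis Ck.simps(2))
qed

lemma Ck_mono: "Ck m f \<Longrightarrow> k \<le> m \<Longrightarrow> Ck k f"
proof (induction m)
  case (Suc m)
  then show ?case using Ck_Suc_imp_Ck[of m f] by (cases "k = Suc m") auto
qed simp

lemma Ck_continuous: "Ck k f \<Longrightarrow> continuous_on UNIV f"
  using Ck_mono[of k f 0] by simp

lemma Ck_const: "Ck k (\<lambda>z::'a::euclidean_space. c)"
proof (induction k arbitrary: c)
  case (Suc k)
  have "pd d (\<lambda>z::'a. c) = (\<lambda>z. 0)" for d
    by (rule ext, subst pd_at[where f' = "\<lambda>_. 0"]) auto
  with Suc show ?case by simp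
qed simp

lemma pd_add:
  assumes "f differentiable (at z)" "g differentiable (at z)"
  shows "pd d (\<lambda>z. f z + g z) z = pd d f z + pd d g z"
proof -
  have "((\<lambda>z. f z + g z) has_derivative
      (\<lambda>h. frechet_derivative f (at z) h + frechet_derivative g (at z) h)) (at z)"
    using assms by (intro derivative_intros) (simp_all add: frechet_derivative_works)
  then show ?thesis by (simp add: pd_at pd_def[of d f] pd_def[of d g])
qed

lemma pd_mult:
  assumes "f differentiable (at z)" "g differentiable (at z)"
  shows "pd d (\<lambda>z. f z * g z) z = f z * pd d g z + pd d f z * g z"
proof -
  have "((\<lambda>z. f z * g z) has_derivative
      (\<lambda>h. f z * frechet_derivative g (at z) h + frechet_derivative f (at z) h * g z)) (at z)"
    using assms by (intro derivative_intros) (simp_all add: frechet_derivative_works)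
  then show ?thesis by (simp add: pd_at pd_def[of d f] pd_def[of d g])
qed

lemma Ck_add: "Ck k f \<Longrightarrow> Ck k g \<Longrightarrow> Ck k (\<lambda>z. f z + g z)"
proof (induction k arbitrary: f g)
  case 0 then show ?case by (simp add: continuous_on_add)
next
  case (Suc k)
  have "pd d (\<lambda>z. f z + g z) = (\<lambda>z. pd d f z + pd d g z)" for d
    using Suc.prems by (auto intro!: ext pd_add)
  with Suc show ?case by (auto intro!: differentiable_add)
qed

lemma Ck_mult: "Ck k f \<Longrightarrow> Ck k g \<Longrightarrow> Ck k (\<lambda>z. f z * g z)"
proof (induction k arbitrary: f g)
  case 0 then show ?case by (simp add: continuous_on_mult)
next
  case (Suc k)
  have "pd d (\<lambda>z. f z * g z) = (\<lambda>z. f z * pd d g z + pd d f z * g z)" for d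
    using Suc.prems by (auto intro!: ext pd_mult)
  moreover have "Ck k (\<lambda>z. f z * pd d g z + pd d f z * g z)" if "d \<in> Basis" for d
    using Suc.prems that Ck_Suc_imp_Ck[OF Suc.prems(1)] Ck_Suc_imp_Ck[OF Suc.prems(2)]
    by (intro Ck_add Suc.IH) auto
  ultimately show ?case using Suc.prems by (auto intro!: differentiable_mult)
qed

lemma Ck_cmult: "Ck k f \<Longrightarrow> Ck k (\<lambda>z. c * f z)"
  by (intro Ck_mult Ck_const)

lemma Ck_prod:
  assumes "finite I" "\<And>i. i \<in> I \<Longrightarrow> Ck k (f i)"
  shows "Ck k (\<lambda>z. \<Prod>i\<in>I. f i z)"
  using assms
proof (induction I rule: finite_induct)
  case empty
  show ?case using Ck_const[of k 1] by simp
next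
  case (insert i I)
  then show ?case by (simp add: Ck_mult)
qed

text \<open>Functions of one variable composed with an affine function stay smooth; this lets the
  coordinates of a product be treated one at a time.\<close>

lemma has_derivative_affine_comp:
  fixes f :: "real \<Rightarrow> real"
  assumes "f differentiable (at (z \<bullet> u + c))"
  shows "((\<lambda>z. f (z \<bullet> u + c)) has_derivative (\<lambda>h. (h \<bullet> u) * pd 1 f (z \<bullet> u + c))) (at z)"
proof -
  obtain D where D: "(f has_real_derivative D) (at (z \<bullet> u + c))"
    using assms real_differentiable_def by blast
  have "pd 1 f (z \<bullet> u + c) = D"
    using D by (subst pd_at[where f' = "\<lambda>h. D * h"]) (auto simp: has_field_derivative_def)
  moreover have "((\<lambda>z. f (z \<bullet> u + c)) has_derivative (\<lambda>h. D * (h \<bullet> u))) (at z)"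
    by (rule has_derivative_compose[of "\<lambda>z. z \<bullet> u + c" "\<lambda>h. h \<bullet> u", OF _ D[unfolded has_field_derivative_def]])
       (auto intro!: derivative_eq_intros)
  ultimately show ?thesis by (simp add: mult.commute)
qed

lemma pd_affine_comp:
  assumes "f differentiable (at (z \<bullet> u + c))"
  shows "pd d (\<lambda>z. f (z \<bullet> u + c)) z = (d \<bullet> u) * pd 1 f (z \<bullet> u + c)"
  by (rule pd_at[OF has_derivative_affine_comp[OF assms]])

lemma Ck_affine_comp:
  fixes u :: "'a::euclidean_space"
  shows "Ck k f \<Longrightarrow> Ck k (\<lambda>z. f (z \<bullet> u + c))"
proof (induction k arbitrary: f)
  case 0 then show ?case
    by (auto intro!: continuous_intros continuous_on_compose2[of UNIV f])
next
  case (Suc k)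
  have "pd d (\<lambda>z. f (z \<bullet> u + c)) = (\<lambda>z. (d \<bullet> u) * pd 1 f (z \<bullet> u + c))" for d
    using Suc.prems by (auto intro!: ext pd_affine_comp)
  moreover have "(\<lambda>z. f (z \<bullet> u + c)) differentiable (at z)" for z
    using has_derivative_affine_comp[of f z u c] Suc.prems differentiableI by fastforce
  ultimately show ?case using Suc by (auto intro!: Ck_cmult)
qed

text \<open>The functions \<open>exp (-1 / x) / x ^ j\<close>, extended by 0 to \<open>x \<le> 0\<close>. The derivative of each is a
  linear combination of two others, so a single induction shows that all of them are smooth.\<close>

definition flat :: "nat \<Rightarrow> real \<Rightarrow> real"
  where "flat j x = (if x \<le> 0 then 0 else exp (- 1 / x) / x ^ j)"

lemma flat_deriv: "(flat j has_real_derivative flat (j + 2) x - j * flat (j + 1) x) (at x)"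
proof (cases x "0::real" rule: linorder_cases)
  case less
  have "eventually (\<lambda>y. y < 0) (nhds x)"
    using less by (intro eventually_nhds_in_open[of "{..<0}", simplified]) auto
  then have ev: "eventually (\<lambda>y. flat j y = 0) (nhds x)"
    by eventually_elim (simp add: flat_def)
  show ?thesis
    using less by (subst DERIV_cong_ev[OF refl ev refl]) (auto simp: flat_def)
next
  case greater
  have "eventually (\<lambda>y. 0 < y) (nhds x)"
    using greater by (intro eventually_nhds_in_open[of "{0<..}", simplified]) auto
  then have ev: "eventually (\<lambda>y. flat j y = exp (- 1 / y) / y ^ j) (nhds x)"
    by eventually_elim (simp add: flat_def)
  have eq: "(exp (- 1 / x) * (1 / (x * x)) * x ^ j - exp (- 1 / x) * (real j * x ^ (j - Suc 0))) / (x ^ j * x ^ j)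
      = flat (j + 2) x - j * flat (j + 1) x"
    using greater by (cases j) (simp_all add: flat_def field_simps power_add power2_eq_square)
  have "((\<lambda>y. exp (- 1 / y) / y ^ j) has_real_derivative
      (exp (- 1 / x) * (1 / (x * x)) * x ^ j - exp (- 1 / x) * (real j * x ^ (j - Suc 0))) / (x ^ j * x ^ j)) (at x)"
    using greater by (auto intro!: derivative_eq_intros)
  then show ?thesis
    by (subst DERIV_cong_ev[OF refl ev refl]) (simp only: eq)
next
  \<comment> \<open>At 0 the difference quotient of \<open>flat j\<close> is \<open>flat (j + 1)\<close>, which tends to 0.\<close>
  case equal
  have "((\<lambda>y::real. exp (- 1 / y) / y ^ Suc j) \<longlongrightarrow> 0) (at_right 0)"
  proof -
    have "filterlim (\<lambda>y::real. y ^ Suc j / exp y) (nhds 0) at_top"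
      by (rule tendsto_power_div_exp_0)
    then have "((\<lambda>y::real. inverse y ^ Suc j / exp (inverse y)) \<longlongrightarrow> 0) (at_right 0)"
      by (rule filterlim_compose[OF _ filterlim_inverse_at_top_right])
    then show ?thesis
      by (rule Lim_transform_eventually)
         (auto simp: eventually_at_filter exp_minus field_simps)
  qed
  then have "((\<lambda>y. flat j y / y) \<longlongrightarrow> 0) (at_right 0)"
    by (rule Lim_transform_eventually)
       (auto simp: eventually_at_filter flat_def mult.commute)
  moreover have "((\<lambda>y. flat j y / y) \<longlongrightarrow> 0) (at_left 0)"
    by (rule Lim_transform_eventually[OF tendsto_const])
       (auto simp: eventually_at_filter flat_def)
  ultimately have "((\<lambda>y. flat j y / y) \<longlongrightarrow> 0) (at 0)"
    by (simp add: filterlim_split_at)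
  then show ?thesis
    using equal by (simp add: has_field_derivative_iff) (simp add: flat_def)
qed

lemma Ck_flat: "Ck k (flat j)"
proof (induction k arbitrary: j)
  case 0
  then show ?case
    by (auto simp: continuous_on_eq_continuous_at intro: DERIV_isCont[OF flat_deriv])
next
  case (Suc k)
  have "pd 1 (flat j) = (\<lambda>x. flat (j + 2) x + (- real j) * flat (j + 1) x)"
    by (rule ext, subst pd_at[OF flat_deriv[unfolded has_field_derivative_def]]) simp
  moreover have "Ck k (\<lambda>x. flat (j + 2) x + (- real j) * flat (j + 1) x)"
    by (intro Ck_add Ck_cmult Suc.IH)
  ultimately show ?case
    using flat_deriv real_differentiable_def by auto
qed

text \<open>Subtracting 1 moves the support of each factor to distance \<open>1 / m\<close> inside the box, so that it is
  a compact subset of the open box.\<close>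

definition box_bump :: "nat \<Rightarrow> 'a::euclidean_space \<Rightarrow> 'a \<Rightarrow> 'a \<Rightarrow> real"
  where "box_bump m c d z =
    (\<Prod>i\<in>Basis. flat 0 (m * ((z - c) \<bullet> i) - 1) * flat 0 (m * ((d - z) \<bullet> i) - 1))"

lemma Ck_box_bump: "Ck k (box_bump m c d)"
proof -
  have "Ck k (\<lambda>z. flat 0 (m * ((z - c) \<bullet> i) - 1) * flat 0 (m * ((d - z) \<bullet> i) - 1))" for i
    using Ck_mult[OF Ck_affine_comp[OF Ck_flat, where u = "real m *\<^sub>R i" and c = "- real m * (c \<bullet> i) - 1"]
        Ck_affine_comp[OF Ck_flat, where u = "- real m *\<^sub>R i" and c = "real m * (d \<bullet> i) - 1"], of k 0 0]
    by (simp add: inner_diff_left right_diff_distrib diff_diff_eq2 add_diff_eq)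
  then show ?thesis
    unfolding box_bump_def[abs_def] by (intro Ck_prod) auto
qed

lemma flat_bounds: "0 \<le> flat 0 x" "flat 0 x \<le> 1"
  by (auto simp: flat_def)

lemma box_bump_bounds: "0 \<le> box_bump m c d z" "box_bump m c d z \<le> 1"
  unfolding box_bump_def
  by (intro prod_nonneg mult_nonneg_nonneg flat_bounds)
     (intro prod_le_1 conjI mult_le_one mult_nonneg_nonneg flat_bounds)

lemma box_bump_outside:
  assumes "i \<in> Basis" "\<not> (m * ((z - c) \<bullet> i) > 1 \<and> m * ((d - z) \<bullet> i) > 1)"
  shows "box_bump m c d z = 0"
  using assms unfolding box_bump_def
  by (intro prod_zero bexI[of _ i]) (auto simp: flat_def)

lemma flat_tendsto:
  assumes "x > 0" shows "(\<lambda>m. flat 0 (real m * x - 1)) \<longlonglongrightarrow> 1"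
proof -
  have "((\<lambda>y::real. exp (- 1 * inverse y)) \<longlongrightarrow> exp (- 1 * 0)) at_top"
    by (intro tendsto_intros tendsto_inverse_0_at_top filterlim_ident)
  then have "((\<lambda>y::real. exp (- 1 * inverse y)) \<longlongrightarrow> 1) at_top" by simp
  then have "(flat 0 \<longlongrightarrow> 1) at_top"
    by (rule Lim_transform_eventually)
       (auto intro!: eventually_mono[OF eventually_gt_at_top[of 0]] simp: flat_def field_simps)
  moreover have "filterlim (\<lambda>m. real m * x - 1) at_top sequentially"
    using filterlim_tendsto_add_at_top[OF tendsto_const[of "-1"]
        filterlim_at_top_mult_tendsto_pos[OF tendsto_const assms filterlim_real_sequentially]]
    by simp
  ultimately show ?thesis by (rule filterlim_compose)
qed

text \<open>The functions \<open>exp (-1 / (m x - 1))\<close> increase to the indicator of \<open>x > 0\<close>; hence the bumps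
  approximate the indicator of an open box from below, with supports compactly inside that box.\<close>

lemma box_bump_tendsto: "(\<lambda>m. box_bump m c d z) \<longlonglongrightarrow> indicator (box c d) z"
proof (cases "z \<in> box c d")
  case True
  have "(\<lambda>m. box_bump m c d z) \<longlonglongrightarrow> (\<Prod>i\<in>(Basis :: 'a set). 1 * 1)"
    unfolding box_bump_def using True
    by (intro tendsto_prod tendsto_mult flat_tendsto) (auto simp: mem_box inner_diff)
  with True show ?thesis by simp
next
  case False
  then obtain i where i: "i \<in> Basis" "\<not> (c \<bullet> i < z \<bullet> i \<and> z \<bullet> i < d \<bullet> i)"
    by (auto simp: mem_box)
  have "real m * ((z - c) \<bullet> i) \<le> 0 \<or> real m * ((d - z) \<bullet> i) \<le> 0" for m
    using i by (auto simp: inner_diff not_less mult_le_0_iff)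
  then have "\<not> (real m * ((z - c) \<bullet> i) > 1 \<and> real m * ((d - z) \<bullet> i) > 1)" for m
    by (smt (verit))
  then have "box_bump m c d z = 0" for m
    using i(1) by (intro box_bump_outside[of i])
  with False show ?thesis by simp
qed

lemma box_bump_test_fun:
  assumes "box c d \<subseteq> U" shows "box_bump m c d \<in> test_fun U"
proof -
  define C where "C = (if m = 0 then {} else cbox (c + (1 / m) *\<^sub>R One) (d - (1 / m) *\<^sub>R One))"
  have "z \<in> box c d" if "z \<in> C" for z
  proof -
    have m: "m > 0" using that by (auto simp: C_def split: if_splits)
    have "c \<bullet> i < z \<bullet> i \<and> z \<bullet> i < d \<bullet> i" if "i \<in> Basis" for i
    proof -
      have "1 / real m > 0" using m by simp
      moreover have "c \<bullet> i + 1 / real m \<le> z \<bullet> i" "z \<bullet> i \<le> d \<bullet> i - 1 / real m"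
        using \<open>z \<in> C\<close> that m by (auto simp: C_def mem_box inner_add_left inner_diff_left)
      ultimately show ?thesis by linarith
    qed
    then show ?thesis by (auto simp: mem_box)
  qed
  moreover have "box_bump m c d z = 0" if "z \<notin> C" for z
  proof (cases "m = 0")
    case True
    obtain i :: 'a where "i \<in> Basis" using nonempty_Basis by blast
    with True show ?thesis by (intro box_bump_outside[of i]) auto
  next
    case False
    then have "\<exists>i\<in>Basis. \<not> (c \<bullet> i + 1 / m \<le> z \<bullet> i \<and> z \<bullet> i \<le> d \<bullet> i - 1 / m)"
      using that by (simp add: C_def mem_box inner_add_left inner_diff_left)
    then obtain i where i: "i \<in> Basis" "\<not> (c \<bullet> i + 1 / m \<le> z \<bullet> i \<and> z \<bullet> i \<le> d \<bullet> i - 1 / m)"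
      by blast
    with False show ?thesis
      by (intro box_bump_outside[of i]) (auto simp: field_simps inner_diff_left)
  qed
  moreover have "compact C" by (simp add: C_def)
  ultimately have "\<exists>C. compact C \<and> C \<subseteq> U \<and> (\<forall>z. z \<notin> C \<longrightarrow> box_bump m c d z = 0)"
    using assms by blast
  then show ?thesis unfolding test_fun_def using Ck_box_bump by blast
qed

section \<open>Square integrable functions\<close>

lemma AE_lebesgue_on_iff:
  fixes S :: "'a::euclidean_space set"
  assumes "S \<in> sets borel"
  shows "(AE z in lebesgue_on S. P z) \<longleftrightarrow> (AE z in lborel. z \<in> S \<longrightarrow> P z)"
  using assms by (simp add: AE_restrict_space_iff AE_completion_iff)

text \<open>Sections of a Lebesgue measurable function need not be measurable. A Borel representative makes
  all sections measurable and Fubini's theorem applicable.\<close>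

lemma ex_borel_representative:
  fixes f :: "'a::euclidean_space \<Rightarrow> 'v::euclidean_space"
  assumes f: "f \<in> borel_measurable (lebesgue_on S)" and S: "S \<in> sets borel"
  obtains f' where "f' \<in> borel_measurable borel" "\<And>z. z \<notin> S \<Longrightarrow> f' z = 0"
    "AE z in lborel. z \<in> S \<longrightarrow> f z = f' z"
proof -
  have "(\<lambda>z. if z \<in> S then f z else 0) \<in> borel_measurable lebesgue"
    using f S by (simp add: borel_measurable_if)
  then have "(\<lambda>z. (if z \<in> S then f z else 0) \<bullet> i) \<in> borel_measurable lebesgue" for i
    by (rule borel_measurable_inner) simp
  then have "\<exists>g\<in>borel_measurable lborel. AE z in lborel. (if z \<in> S then f z else 0) \<bullet> i = g z" for i
    by (rule completion_ex_borel_measurable_real)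
  then obtain g where g: "\<And>i. g i \<in> borel_measurable lborel"
      "\<And>i. AE z in lborel. (if z \<in> S then f z else 0) \<bullet> i = g i z"
    by metis
  define f' where "f' z = indicator S z *\<^sub>R (\<Sum>i\<in>Basis. g i z *\<^sub>R i)" for z
  have [measurable]: "g i \<in> borel_measurable borel" "S \<in> sets borel" for i
    using g(1)[of i] S by simp_all
  show thesis
  proof (rule that[of f'])
    show "f' \<in> borel_measurable borel" unfolding f'_def by measurable
    show "f' z = 0" if "z \<notin> S" for z using that by (simp add: f'_def)
    have "AE z in lborel. \<forall>i\<in>Basis. (if z \<in> S then f z else 0) \<bullet> i = g i z"
      using g(2) by (intro AE_finite_allI) auto
    then show "AE z in lborel. z \<in> S \<longrightarrow> f z = f' z"
    proof eventually_elim
      case (elim z)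
      have "f z = f' z" if "z \<in> S"
        using elim that euclidean_representation[of "f z"] by (simp add: f'_def)
      then show ?case by simp
    qed
  qed
qed

lemma
  fixes f :: "'a::euclidean_space \<Rightarrow> 'v::euclidean_space"
  assumes f: "f \<in> borel_measurable borel" and S: "S \<in> sets borel" and 0: "\<And>z. z \<notin> S \<Longrightarrow> f z = 0"
  shows integrable_lebesgue_on_iff_lborel: "integrable (lebesgue_on S) f \<longleftrightarrow> integrable lborel f"
    and integral_lebesgue_on_eq_lborel: "(LINT z|lebesgue_on S. f z) = (LINT z|lborel. f z)"
proof -
  have eq: "(\<lambda>z. indicator S z *\<^sub>R f z) = f"
    using 0 by (auto simp: indicator_def)
  show "integrable (lebesgue_on S) f \<longleftrightarrow> integrable lborel f"
    using S f by (simp add: integrable_restrict_space eq integrable_completion)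
  show "(LINT z|lebesgue_on S. f z) = (LINT z|lborel. f z)"
    using S f by (simp add: integral_restrict_space eq integral_completion)
qed

lemma L2_measurable: "f \<in> L2 S \<Longrightarrow> f \<in> borel_measurable (lebesgue_on S)"
  by (simp add: L2_def)

lemma L2_integrable_square: "f \<in> L2 S \<Longrightarrow> integrable (lebesgue_on S) (\<lambda>z. (norm (f z))\<^sup>2)"
  by (simp add: L2_def)

lemma norm_add_square_le:
  fixes x y :: "'v::real_normed_vector"
  shows "(norm (x + y))\<^sup>2 \<le> 2 * (norm x)\<^sup>2 + 2 * (norm y)\<^sup>2"
proof -
  have "(norm (x + y))\<^sup>2 \<le> (norm x + norm y)\<^sup>2"
    by (intro power_mono norm_triangle_ineq) auto
  also have "\<dots> \<le> 2 * (norm x)\<^sup>2 + 2 * (norm y)\<^sup>2"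
    using sum_squares_bound[of "norm x" "norm y"] by (simp add: power2_sum)
  finally show ?thesis .
qed

lemma L2_add: assumes "f \<in> L2 S" "g \<in> L2 S" shows "(\<lambda>z. f z + g z) \<in> L2 S"
proof -
  note [measurable] = L2_measurable[OF assms(1)] L2_measurable[OF assms(2)]
  have "integrable (lebesgue_on S) (\<lambda>z. 2 * (norm (f z))\<^sup>2 + 2 * (norm (g z))\<^sup>2)"
    using assms by (auto simp: L2_integrable_square)
  then have "integrable (lebesgue_on S) (\<lambda>z. (norm (f z + g z))\<^sup>2)"
    by (rule Bochner_Integration.integrable_bound) (auto intro: norm_add_square_le)
  then show ?thesis by (simp add: L2_def)
qed

lemma L2_scaleR: "f \<in> L2 S \<Longrightarrow> (\<lambda>z. c *\<^sub>R f z) \<in> L2 S"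
  by (auto simp: L2_def power_mult_distrib intro: borel_measurable_scaleR)

lemma L2_diff: "f \<in> L2 S \<Longrightarrow> g \<in> L2 S \<Longrightarrow> (\<lambda>z. f z - g z) \<in> L2 S"
  using L2_add[of f S "\<lambda>z. (-1) *\<^sub>R g z"] L2_scaleR[of g S "-1"] by simp

lemma L2_zero: "(\<lambda>z. 0) \<in> L2 S"
  by (simp add: L2_def)

lemma L2_cong: "(\<And>z. z \<in> S \<Longrightarrow> f z = g z) \<Longrightarrow> f \<in> L2 S \<longleftrightarrow> g \<in> L2 S"
proof -
  assume *: "\<And>z. z \<in> S \<Longrightarrow> f z = g z"
  have "f \<in> borel_measurable (lebesgue_on S) \<longleftrightarrow> g \<in> borel_measurable (lebesgue_on S)"
    using * by (intro measurable_cong) auto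
  moreover have "integrable (lebesgue_on S) (\<lambda>z. (norm (f z))\<^sup>2) \<longleftrightarrow> integrable (lebesgue_on S) (\<lambda>z. (norm (g z))\<^sup>2)"
    using * by (intro Bochner_Integration.integrable_cong) auto
  ultimately show ?thesis by (simp add: L2_def)
qed

lemma L2_integrable:
  assumes f: "f \<in> L2 S" and S: "S \<in> lmeasurable"
  shows "integrable (lebesgue_on S) f"
proof -
  interpret finite_measure "lebesgue_on S" using S by (rule finite_measure_lebesgue_on)
  have "integrable (lebesgue_on S) (\<lambda>z. 1 + (norm (f z))\<^sup>2)"
    using L2_integrable_square[OF f] by simp
  then show ?thesis
  proof (rule Bochner_Integration.integrable_bound)
    show "AE z in lebesgue_on S. norm (f z) \<le> norm (1 + (norm (f z))\<^sup>2)"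
    proof (rule AE_I2)
      fix z
      have "norm (f z) \<le> 1 + (norm (f z))\<^sup>2"
        using sum_squares_bound[of 1 "norm (f z)"] norm_ge_zero[of "f z"]
        by (simp only: power_one mult_1_right)
      then show "norm (f z) \<le> norm (1 + (norm (f z))\<^sup>2)" by simp
    qed
  qed (rule L2_measurable[OF f])
qed

lemma bounded_times_L2_integrable:
  fixes \<eta> :: "'a::euclidean_space \<Rightarrow> real"
  assumes "f \<in> L2 S" "S \<in> lmeasurable" "continuous_on UNIV \<eta>" "\<And>z. \<bar>\<eta> z\<bar> \<le> C"
  shows "integrable (lebesgue_on S) (\<lambda>z. \<eta> z *\<^sub>R f z)"
proof -
  have [measurable]: "f \<in> borel_measurable (lebesgue_on S)" by (rule L2_measurable[OF assms(1)])
  have "\<eta> \<in> borel_measurable borel" using assms(3) by (rule borel_measurable_continuous_onI)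
  then have [measurable]: "\<eta> \<in> borel_measurable (lebesgue_on S)"
    by (intro measurable_restrict_space1 measurable_completion) simp
  show ?thesis
  proof (rule Bochner_Integration.integrable_bound)
    show "integrable (lebesgue_on S) (\<lambda>z. C *\<^sub>R f z)"
      using L2_integrable[OF assms(1,2)] by simp
    show "AE z in lebesgue_on S. norm (\<eta> z *\<^sub>R f z) \<le> norm (C *\<^sub>R f z)"
      using assms(4) by (intro AE_I2) (auto intro!: mult_right_mono intro: order_trans[OF _ abs_ge_self])
  qed measurable
qed

lemma L2_norm_nonneg: "0 \<le> L2_norm S f"
  by (simp add: L2_norm_def)

lemma L2_norm_square: "(L2_norm S f)\<^sup>2 = (LINT z|lebesgue_on S. (norm (f z))\<^sup>2)"
  by (simp add: L2_norm_def)

lemma L2_norm_scaleR: "L2_norm S (\<lambda>z. c *\<^sub>R f z) = \<bar>c\<bar> * L2_norm S f"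
  by (simp add: L2_norm_def power_mult_distrib real_sqrt_mult)

text \<open>A triangle inequality up to the factor 2, which follows from the pointwise bound for squares;
  factors do not matter in the estimates below.\<close>

lemma L2_norm_add:
  assumes "f \<in> L2 S" "g \<in> L2 S"
  shows "L2_norm S (\<lambda>z. f z + g z) \<le> 2 * (L2_norm S f + L2_norm S g)"
proof (rule power2_le_imp_le)
  have "(L2_norm S (\<lambda>z. f z + g z))\<^sup>2 \<le> (LINT z|lebesgue_on S. 2 * (norm (f z))\<^sup>2 + 2 * (norm (g z))\<^sup>2)"
    unfolding L2_norm_square using assms L2_add[OF assms]
    by (intro integral_mono) (auto simp: L2_integrable_square norm_add_square_le)
  also have "\<dots> = 2 * (L2_norm S f)\<^sup>2 + 2 * (L2_norm S g)\<^sup>2"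
    unfolding L2_norm_square using assms by (simp add: L2_integrable_square)
  also have "\<dots> \<le> (2 * (L2_norm S f + L2_norm S g))\<^sup>2"
    using L2_norm_nonneg[of S f] L2_norm_nonneg[of S g]
    by (simp add: power2_eq_square algebra_simps)
  finally show "(L2_norm S (\<lambda>z. f z + g z))\<^sup>2 \<le> (2 * (L2_norm S f + L2_norm S g))\<^sup>2" .
qed (simp add: L2_norm_nonneg)

lemma L2_norm_diff:
  assumes "f \<in> L2 S" "g \<in> L2 S"
  shows "L2_norm S (\<lambda>z. f z - g z) \<le> 2 * (L2_norm S f + L2_norm S g)"
  using L2_norm_add[OF assms(1) L2_scaleR[OF assms(2), of "-1"]] L2_norm_scaleR[of S "-1" g] by simp

lemma L2_norm_cong_AE:
  assumes "f \<in> L2 S" "g \<in> L2 S" "AE z in lebesgue_on S. f z = g z"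
  shows "L2_norm S f = L2_norm S g"
proof -
  note [measurable] = L2_measurable[OF assms(1)] L2_measurable[OF assms(2)]
  have "(LINT z|lebesgue_on S. (norm (f z))\<^sup>2) = (LINT z|lebesgue_on S. (norm (g z))\<^sup>2)"
    by (intro integral_cong_AE) (use assms(3) in auto)
  then show ?thesis by (simp add: L2_norm_def)
qed

lemma L2_norm_eq_0:
  assumes "f \<in> L2 S" "L2_norm S f = 0"
  shows "AE z in lebesgue_on S. f z = 0"
  using integral_nonneg_eq_0_iff_AE[OF L2_integrable_square[OF assms(1)]] assms(2)
  by (auto simp: L2_norm_def)

section \<open>The fundamental lemma of the calculus of variations\<close>

lemma test_fun_Ck: "\<eta> \<in> test_fun U \<Longrightarrow> Ck k \<eta>"
  by (simp add: test_fun_def)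

lemma test_fun_continuous: "\<eta> \<in> test_fun U \<Longrightarrow> continuous_on UNIV \<eta>"
  using Ck_continuous[OF test_fun_Ck[of \<eta> U 0]] .

lemma test_fun_differentiable: "\<eta> \<in> test_fun U \<Longrightarrow> \<eta> differentiable (at z)"
  using Ck_differentiable[OF test_fun_Ck[of \<eta> U "Suc 0"]] .

lemma test_fun_outside: "\<eta> \<in> test_fun U \<Longrightarrow> z \<notin> U \<Longrightarrow> \<eta> z = 0"
  by (auto simp: test_fun_def)

lemma test_fun_bounded:
  assumes "\<eta> \<in> test_fun U"
  obtains K where "\<And>z. \<bar>\<eta> z\<bar> \<le> K"
proof -
  obtain C where C: "compact C" "\<And>z. z \<notin> C \<Longrightarrow> \<eta> z = 0"
    using assms by (auto simp: test_fun_def)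
  have "bounded (\<eta> ` C)"
    using C(1) test_fun_continuous[OF assms]
    by (intro compact_imp_bounded compact_continuous_image) (auto intro: continuous_on_subset)
  then obtain K where K: "\<And>z. z \<in> C \<Longrightarrow> \<bar>\<eta> z\<bar> \<le> K" by (auto simp: bounded_iff)
  show thesis
    by (rule that[of "max K 0"]) (use K C(2) in \<open>smt (verit)\<close>)
qed

lemma test_fun_times_L2_integrable:
  assumes "\<eta> \<in> test_fun U" "f \<in> L2 S" "S \<in> lmeasurable"
  shows "integrable (lebesgue_on S) (\<lambda>z. \<eta> z *\<^sub>R f z)"
proof -
  obtain K where "\<And>z. \<bar>\<eta> z\<bar> \<le> K" using test_fun_bounded[OF assms(1)] by blast
  then show ?thesis
    using bounded_times_L2_integrable[OF assms(2,3) test_fun_continuous[OF assms(1)]] by blast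
qed

lemma test_fun_pd:
  assumes \<eta>: "\<eta> \<in> test_fun U" and d: "d \<in> Basis"
  shows "pd d \<eta> \<in> test_fun U"
proof -
  obtain C where C: "compact C" "C \<subseteq> U" "\<And>z. z \<notin> C \<Longrightarrow> \<eta> z = 0"
    using \<eta> by (auto simp: test_fun_def)
  have "pd d \<eta> z = 0" if "z \<notin> C" for z
  proof (rule pd_at)
    show "(\<eta> has_derivative (\<lambda>h. 0)) (at z)"
      by (rule has_derivative_transform_within_open[OF has_derivative_const[of 0], of "- C"])
         (use C that in \<open>auto simp: compact_imp_closed open_Compl\<close>)
  qed
  moreover have "Ck k (pd d \<eta>)" for k
    using test_fun_Ck[OF \<eta>, of "Suc k"] d by simp
  ultimately show ?thesis using C(1,2) unfolding test_fun_def by blast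
qed

lemma test_fun_foldr_pd:
  "set ds \<subseteq> Basis \<Longrightarrow> \<eta> \<in> test_fun U \<Longrightarrow> foldr pd ds \<eta> \<in> test_fun U"
  by (induction ds) (auto intro: test_fun_pd)

text \<open>Testing with bumps shows that the integral of \<open>f\<close> over every box vanishes, hence over every
  Borel set, because boxes form a generator that is stable under intersections.\<close>

lemma fundamental_lemma:
  fixes f :: "'a::euclidean_space \<Rightarrow> 'v::euclidean_space"
  assumes f: "f \<in> L2 (cbox p q)"
    and test: "\<And>\<eta>. \<eta> \<in> test_fun (interior (cbox p q)) \<Longrightarrow> (LINT z|lebesgue_on (cbox p q). \<eta> z *\<^sub>R f z) = 0"
  shows "AE z in lebesgue_on (cbox p q). f z = 0"
proof -
  let ?M = "lebesgue_on (cbox p q)"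
  obtain f' where [measurable]: "f' \<in> borel_measurable borel"
      and out: "\<And>z. z \<notin> cbox p q \<Longrightarrow> f' z = 0" and eq: "AE z in lborel. z \<in> cbox p q \<longrightarrow> f z = f' z"
    using ex_borel_representative[OF L2_measurable[OF f]] by auto
  have eqM: "AE z in ?M. f z = f' z" using eq by (simp add: AE_lebesgue_on_iff)
  have mf: "f \<in> borel_measurable ?M" by (rule L2_measurable[OF f])
  have borel_M: "g \<in> borel_measurable ?M" if "g \<in> borel_measurable borel" for g :: "'a \<Rightarrow> 'w::euclidean_space"
    using that by (intro measurable_restrict_space1 measurable_completion) simp
  have "integrable ?M f'"
    using L2_integrable[OF f] integrable_cong_AE[OF mf borel_M eqM] by simp
  then have int: "integrable lborel f'"
    using integrable_lebesgue_on_iff_lborel[of f' "cbox p q"] out by simp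
  define g where "g z = indicator (box p q) z *\<^sub>R f' z" for z
  have [measurable]: "g \<in> borel_measurable borel" unfolding g_def by measurable
  have intg: "integrable lborel g"
    unfolding g_def using int by (intro integrable_mult_indicator) auto
  have box0: "(LINT z|lborel. indicator (box c d) z *\<^sub>R g z) = 0" for c d
  proof -
    obtain c' d' where cd: "box c d \<inter> box p q = box c' d'"
      unfolding box_Int_box by blast
    have "(\<lambda>m. LINT z|lborel. box_bump m c' d' z *\<^sub>R f' z) \<longlonglongrightarrow> (LINT z|lborel. indicator (box c' d') z *\<^sub>R f' z)"
    proof (rule integral_dominated_convergence[where w = "\<lambda>z. norm (f' z)"])
      show "(\<lambda>z. box_bump m c' d' z *\<^sub>R f' z) \<in> borel_measurable lborel" for m
        using borel_measurable_continuous_onI[OF Ck_continuous[OF Ck_box_bump[of 0 m c' d']]]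
        by (simp add: borel_measurable_scaleR)
      show "AE z in lborel. norm (box_bump m c' d' z *\<^sub>R f' z) \<le> norm (f' z)" for m
        by (intro AE_I2) (simp add: box_bump_bounds mult_left_le_one_le)
    qed (use int in \<open>auto intro!: tendsto_intros box_bump_tendsto\<close>)
    moreover have "(LINT z|lborel. box_bump m c' d' z *\<^sub>R f' z) = 0" for m
    proof -
      have t: "box_bump m c' d' \<in> test_fun (interior (cbox p q))"
        using cd by (intro box_bump_test_fun) (auto simp: interior_cbox)
      have [measurable]: "box_bump m c' d' \<in> borel_measurable borel"
        by (intro borel_measurable_continuous_onI test_fun_continuous[OF t])
      have "(LINT z|lborel. box_bump m c' d' z *\<^sub>R f' z) = (LINT z|?M. box_bump m c' d' z *\<^sub>R f' z)"
        using out by (intro integral_lebesgue_on_eq_lborel[symmetric]) auto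
      also have "\<dots> = (LINT z|?M. box_bump m c' d' z *\<^sub>R f z)"
      proof (rule integral_cong_AE)
        show "(\<lambda>z. box_bump m c' d' z *\<^sub>R f' z) \<in> borel_measurable ?M" by (rule borel_M) measurable
        have "box_bump m c' d' \<in> borel_measurable ?M" by (rule borel_M) measurable
        then show "(\<lambda>z. box_bump m c' d' z *\<^sub>R f z) \<in> borel_measurable ?M"
          using mf by (rule borel_measurable_scaleR)
      qed (use eqM in \<open>auto elim: eventually_mono\<close>)
      finally show ?thesis using test[OF t] by simp
    qed
    ultimately have "(LINT z|lborel. indicator (box c' d') z *\<^sub>R f' z) = 0"
      by (simp add: LIMSEQ_const_iff)
    moreover have "indicator (box c d) z *\<^sub>R g z = indicator (box c' d') z *\<^sub>R f' z" for z
      unfolding g_def cd[symmetric] by (simp add: indicator_inter_arith)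
    ultimately show ?thesis by simp
  qed
  have set0: "(LINT z|lborel. indicator A z *\<^sub>R g z) = 0" if A: "A \<in> sets borel" for A
  proof -
    have "Int_stable (range (\<lambda>(c, d). box c d :: 'a set))"
      by (auto simp: Int_stable_def box_Int_box)
    moreover have "range (\<lambda>(c, d). box c d :: 'a set) \<subseteq> Pow UNIV" by auto
    moreover have "A \<in> sigma_sets UNIV (range (\<lambda>(c, d). box c d))"
      using A unfolding borel_eq_box by simp
    ultimately show ?thesis
    proof (induction rule: sigma_sets_induct_disjoint)
      case (basic A) then show ?case using box0 by auto
    next
      case empty then show ?case by simp
    next
      case (compl A)
      then have [measurable]: "A \<in> sets borel" by (simp add: borel_eq_box)
      have UNIV0: "(LINT z|lborel. g z) = 0"
      proof -
        have "indicator (box p q) z *\<^sub>R g z = g z" for z by (simp add: g_def indicator_def)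
        then show ?thesis using box0[of p q] by simp
      qed
      have "(LINT z|lborel. indicator (UNIV - A) z *\<^sub>R g z) = (LINT z|lborel. g z - indicator A z *\<^sub>R g z)"
        by (intro Bochner_Integration.integral_cong) (auto simp: indicator_def)
      also have "\<dots> = (LINT z|lborel. g z) - (LINT z|lborel. indicator A z *\<^sub>R g z)"
        by (intro Bochner_Integration.integral_diff intg integrable_mult_indicator) auto
      finally show ?case using UNIV0 compl.IH by simp
    next
      case (union A)
      then have [measurable]: "\<And>i. A i \<in> sets borel" by (simp add: borel_eq_box image_subset_iff)
      have "set_lebesgue_integral lborel (\<Union>i. A i) g = (\<Sum>i. set_lebesgue_integral lborel (A i) g)"
      proof (rule lebesgue_integral_countable_add)
        show "set_integrable lborel (\<Union>i. A i) g"
          unfolding set_integrable_def by (intro integrable_mult_indicator intg) auto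
      qed (use union.hyps in \<open>auto simp: disjoint_family_on_def\<close>)
      then show ?case using union.IH by (simp add: set_lebesgue_integral_def)
    qed
  qed
  have "AE z in lborel. g z = 0"
    by (rule sigma_finite_measure.density_zero[OF lborel.sigma_finite_measure_axioms intg])
       (use set0 in \<open>auto simp: set_lebesgue_integral_def\<close>)
  moreover have "AE z in lborel. z \<notin> cbox p q - box p q"
  proof -
    have "cbox p q - box p q \<in> null_sets lebesgue"
      using negligible_frontier_interval[of p q] by (simp only: negligible_iff_null_sets)
    from AE_not_in[OF this] show ?thesis by (simp only: AE_completion_iff)
  qed
  ultimately have "AE z in lborel. z \<in> cbox p q \<longrightarrow> f z = 0"
    using eq by eventually_elim (auto simp: g_def)
  then show ?thesis by (simp add: AE_lebesgue_on_iff)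
qed

text \<open>A nonempty open set has positive measure, so the exceptional set does not meet the open box; the
  boundary is reached by continuity.\<close>

lemma continuous_AE_zero:
  fixes f :: "'a::euclidean_space \<Rightarrow> 'v::euclidean_space"
  assumes cont: "continuous_on (cbox p q) f" and ne: "box p q \<noteq> {}"
    and AE: "AE z in lebesgue_on (cbox p q). f z = 0" and z: "z \<in> cbox p q"
  shows "f z = 0"
proof -
  have "open ({z. f z \<noteq> 0} \<inter> box p q)"
  proof -
    have "continuous_on (box p q) f"
      using cont box_subset_cbox by (rule continuous_on_subset)
    then have "open (f -` (- {0}) \<inter> box p q)"
      by (rule continuous_on_open_vimage[THEN iffD1, rule_format, rotated]) auto
    then show ?thesis by (simp add: vimage_def)
  qed
  moreover have "negligible ({z. f z \<noteq> 0} \<inter> box p q)"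
  proof -
    have "AE z in lebesgue. z \<in> cbox p q \<longrightarrow> f z = 0"
      using AE by (simp add: AE_restrict_space_iff)
    then have "{z. \<not> (z \<in> cbox p q \<longrightarrow> f z = 0)} \<in> null_sets lebesgue"
      by (auto simp: complete_measure.AE_iff_null_sets[OF completion.complete_measure_axioms])
    then have "negligible {z. \<not> (z \<in> cbox p q \<longrightarrow> f z = 0)}"
      by (simp add: negligible_iff_null_sets)
    then show ?thesis
      by (rule negligible_subset) (use box_subset_cbox[of p q] in auto)
  qed
  ultimately have "{z. f z \<noteq> 0} \<inter> box p q = {}"
    using open_not_negligible by blast
  then have "f z = 0" if "z \<in> box p q" for z using that by auto
  then show ?thesis
    using continuous_constant_on_closure[of "box p q" f 0 z] cont z ne by (simp add: closure_box)
qed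

section \<open>Weak derivatives\<close>

lemma weak_deriv_L2: "weak_deriv S ds f g \<Longrightarrow> f \<in> L2 S" "weak_deriv S ds f g \<Longrightarrow> g \<in> L2 S"
  by (simp_all add: weak_deriv_def)

lemma weak_deriv_test:
  "weak_deriv S ds f g \<Longrightarrow> \<eta> \<in> test_fun (interior S) \<Longrightarrow>
    (LINT z|lebesgue_on S. (foldr pd ds \<eta>) z *\<^sub>R f z) = (-1) ^ length ds *\<^sub>R (LINT z|lebesgue_on S. \<eta> z *\<^sub>R g z)"
  by (simp add: weak_deriv_def)

lemma test_fun_measurable:
  assumes "\<eta> \<in> test_fun U" shows "\<eta> \<in> borel_measurable (lebesgue_on S)"
  using borel_measurable_continuous_onI[OF test_fun_continuous[OF assms]]
  by (intro measurable_restrict_space1 measurable_completion) simp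

lemma test_integral_cong_AE:
  assumes "\<eta> \<in> test_fun U" "f \<in> L2 S" "g \<in> L2 S" "AE z in lebesgue_on S. f z = g z"
  shows "(LINT z|lebesgue_on S. \<eta> z *\<^sub>R f z) = (LINT z|lebesgue_on S. \<eta> z *\<^sub>R g z)"
  using assms(4) test_fun_measurable[OF assms(1)] L2_measurable[OF assms(2)] L2_measurable[OF assms(3)]
  by (intro integral_cong_AE borel_measurable_scaleR) auto

lemma weak_deriv_Nil: "f \<in> L2 S \<Longrightarrow> weak_deriv S [] f f"
  by (simp add: weak_deriv_def)

lemma weak_deriv_add:
  assumes f: "weak_deriv S ds f f'" and g: "weak_deriv S ds g g'"
    and S: "S \<in> lmeasurable" and ds: "set ds \<subseteq> Basis"
  shows "weak_deriv S ds (\<lambda>z. f z + g z) (\<lambda>z. f' z + g' z)"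
proof -
  have "(LINT z|lebesgue_on S. \<eta> z *\<^sub>R (h z + k z)) =
      (LINT z|lebesgue_on S. \<eta> z *\<^sub>R h z) + (LINT z|lebesgue_on S. \<eta> z *\<^sub>R k z)"
    if "\<eta> \<in> test_fun (interior S)" "h \<in> L2 S" "k \<in> L2 S" for \<eta> and h k :: "'a \<Rightarrow> 'b"
    using that S by (simp add: scaleR_add_right test_fun_times_L2_integrable)
  then show ?thesis
    using assms test_fun_foldr_pd[OF ds]
    by (simp add: weak_deriv_def L2_add scaleR_add_right)
qed

lemma weak_deriv_scaleR:
  assumes f: "weak_deriv S ds f f'"
  shows "weak_deriv S ds (\<lambda>z. c *\<^sub>R f z) (\<lambda>z. c *\<^sub>R f' z)"
proof -
  have "(LINT z|lebesgue_on S. \<eta> z *\<^sub>R c *\<^sub>R h z) = c *\<^sub>R (LINT z|lebesgue_on S. \<eta> z *\<^sub>R h z)"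
    for \<eta> and h :: "'a \<Rightarrow> 'b"
  proof -
    have "(LINT z|lebesgue_on S. \<eta> z *\<^sub>R c *\<^sub>R h z) = (LINT z|lebesgue_on S. c *\<^sub>R \<eta> z *\<^sub>R h z)"
      by (simp add: mult.commute)
    then show ?thesis by (simp del: scaleR_scaleR)
  qed
  then show ?thesis using f by (simp add: weak_deriv_def L2_scaleR mult.commute)
qed

lemma weak_deriv_diff:
  assumes "weak_deriv S ds f f'" "weak_deriv S ds g g'" "S \<in> lmeasurable" "set ds \<subseteq> Basis"
  shows "weak_deriv S ds (\<lambda>z. f z - g z) (\<lambda>z. f' z - g' z)"
  using weak_deriv_add[OF assms(1) weak_deriv_scaleR[OF assms(2), of "-1"] assms(3,4)] by simp

lemma weak_deriv_cong:
  assumes "\<And>z. z \<in> S \<Longrightarrow> f z = g z"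
  shows "weak_deriv S ds f h \<longleftrightarrow> weak_deriv S ds g h"
proof -
  have "(LINT z|lebesgue_on S. \<eta> z *\<^sub>R f z) = (LINT z|lebesgue_on S. \<eta> z *\<^sub>R g z)" for \<eta> :: "'a \<Rightarrow> real"
    using assms by (intro Bochner_Integration.integral_cong) auto
  then show ?thesis using L2_cong[of S f g, OF assms] by (simp add: weak_deriv_def)
qed

lemma weak_deriv_AE_right:
  assumes "weak_deriv S ds f g" "h \<in> L2 S" "AE z in lebesgue_on S. g z = h z"
  shows "weak_deriv S ds f h"
  using assms test_integral_cong_AE[OF _ _ assms(2,3)] by (auto simp: weak_deriv_def)

text \<open>This lets mixed derivatives be computed one direction at a time.\<close>

lemma weak_deriv_append:
  assumes "weak_deriv S ds f g" "weak_deriv S ds' g h" "set ds' \<subseteq> Basis"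
  shows "weak_deriv S (ds @ ds') f h"
  using assms test_fun_foldr_pd[OF assms(3)]
  by (auto simp: weak_deriv_def power_add)

lemma weak_deriv_unique:
  assumes f: "weak_deriv (cbox p q) ds f g" and f': "weak_deriv (cbox p q) ds f' h"
    and eq: "AE z in lebesgue_on (cbox p q). f z = f' z" and ds: "set ds \<subseteq> Basis"
  shows "AE z in lebesgue_on (cbox p q). g z = h z"
proof -
  let ?M = "lebesgue_on (cbox p q)"
  have "AE z in ?M. g z - h z = 0"
  proof (rule fundamental_lemma)
    show "(\<lambda>z. g z - h z) \<in> L2 (cbox p q)"
      by (intro L2_diff weak_deriv_L2[OF f] weak_deriv_L2[OF f'])
  next
    fix \<eta> assume \<eta>: "\<eta> \<in> test_fun (interior (cbox p q))"
    have "(-1) ^ length ds *\<^sub>R (LINT z|?M. \<eta> z *\<^sub>R g z) = (-1) ^ length ds *\<^sub>R (LINT z|?M. \<eta> z *\<^sub>R h z)"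
      using test_integral_cong_AE[OF test_fun_foldr_pd[OF ds \<eta>] weak_deriv_L2(1)[OF f] weak_deriv_L2(1)[OF f'] eq]
      by (simp add: weak_deriv_test[OF f \<eta>] weak_deriv_test[OF f' \<eta>])
    then have "(LINT z|?M. \<eta> z *\<^sub>R g z) = (LINT z|?M. \<eta> z *\<^sub>R h z)" by simp
    then show "(LINT z|?M. \<eta> z *\<^sub>R (g z - h z)) = 0"
      using \<eta> weak_deriv_L2[OF f] weak_deriv_L2[OF f']
      by (simp add: scaleR_diff_right test_fun_times_L2_integrable)
  qed
  then show ?thesis by simp
qed

lemma rect_cbox: "rect a b = cbox (0, a) (1, b)"
  by (simp add: cbox_Pair_eq)

lemma rect_lmeasurable: "rect a b \<in> lmeasurable"
  unfolding rect_cbox by (rule lmeasurable_cbox)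

lemma rect_directions: "set (replicate \<alpha> (1, 0) @ replicate \<beta> (0, 1)) \<subseteq> (Basis :: (real \<times> real) set)"
  by (auto simp: Basis_prod_def)

lemma wd2_unique:
  assumes "wd2 a b \<alpha> \<beta> f g" "wd2 a b \<alpha> \<beta> f' h" "AE z in lebesgue_on (rect a b). f z = f' z"
  shows "AE z in lebesgue_on (rect a b). g z = h z"
  using weak_deriv_unique[OF _ _ _ rect_directions] assms unfolding rect_cbox by blast

lemma wd1_unique:
  assumes "wd1 a b \<beta> f g" "wd1 a b \<beta> f' h" "AE z in lebesgue_on {a..b}. f z = f' z"
  shows "AE z in lebesgue_on {a..b}. g z = h z"
  using weak_deriv_unique[of a b "replicate \<beta> 1" f g f' h, unfolded box_real] assms by (simp add: set_replicate_conv_if)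

text \<open>The norm is defined with chosen representatives of the weak derivatives; by uniqueness any others
  give the same value.\<close>

lemma H12_norm_eq:
  assumes "\<And>\<alpha> \<beta>. \<alpha> \<le> 1 \<Longrightarrow> \<beta> \<le> 2 \<Longrightarrow> wd2 a b \<alpha> \<beta> \<phi> (g \<alpha> \<beta>)"
  shows "H12_norm a b \<phi> = sqrt (\<Sum>\<alpha>\<le>1. \<Sum>\<beta>\<le>2. (L2_norm (rect a b) (g \<alpha> \<beta>))\<^sup>2)"
proof -
  have "L2_norm (rect a b) (SOME g. wd2 a b \<alpha> \<beta> \<phi> g) = L2_norm (rect a b) (g \<alpha> \<beta>)"
    if "\<alpha> \<le> 1" "\<beta> \<le> 2" for \<alpha> \<beta>
  proof -
    have some: "wd2 a b \<alpha> \<beta> \<phi> (SOME g. wd2 a b \<alpha> \<beta> \<phi> g)"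
      using assms[OF that] by (rule someI[where P = "wd2 a b \<alpha> \<beta> \<phi>"])
    show ?thesis
      using wd2_unique[OF some assms[OF that]] weak_deriv_L2[OF some] weak_deriv_L2[OF assms[OF that]]
      by (intro L2_norm_cong_AE) auto
  qed
  then show ?thesis unfolding H12_norm_def by simp
qed

lemma H12_norm_cong:
  assumes "\<And>z. z \<in> rect a b \<Longrightarrow> f z = g z"
  shows "H12_norm a b f = H12_norm a b g"
proof -
  have "weak_deriv (rect a b) ds f = weak_deriv (rect a b) ds g" for ds
    using weak_deriv_cong[of "rect a b" f g, OF assms] by blast
  then show ?thesis unfolding H12_norm_def by simp
qed

lemma H12_cong:
  assumes "\<And>z. z \<in> rect a b \<Longrightarrow> f z = g z"
  shows "f \<in> H12 a b \<longleftrightarrow> g \<in> H12 a b"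
proof -
  have "weak_deriv (rect a b) ds f = weak_deriv (rect a b) ds g" for ds
    using weak_deriv_cong[of "rect a b" f g, OF assms] by blast
  moreover have "continuous_on (rect a b) f \<longleftrightarrow> continuous_on (rect a b) g"
    using assms by (intro continuous_on_cong) auto
  ultimately show ?thesis unfolding H12_def by simp
qed

lemma L2_norm_le_H12_norm:
  assumes \<phi>: "\<phi> \<in> H12 a b" and wd: "wd2 a b \<alpha> \<beta> \<phi> h" and "\<alpha> \<le> 1" "\<beta> \<le> 2"
  shows "L2_norm (rect a b) h \<le> H12_norm a b \<phi>"
proof -
  define g where "g = (\<lambda>\<alpha>' \<beta>'. if \<alpha>' = \<alpha> \<and> \<beta>' = \<beta> then h else (SOME g. wd2 a b \<alpha>' \<beta>' \<phi> g))"
  have wdg: "wd2 a b \<alpha> \<beta> \<phi> (g \<alpha> \<beta>)" if "\<alpha> \<le> 1" "\<beta> \<le> 2" for \<alpha> \<beta>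
    using \<phi> wd that unfolding g_def H12_def by (auto intro!: someI_ex[of "wd2 a b \<alpha> \<beta> \<phi>"])
  have "(L2_norm (rect a b) h)\<^sup>2 \<le> (\<Sum>\<beta>\<le>2. (L2_norm (rect a b) (g \<alpha> \<beta>))\<^sup>2)"
    using member_le_sum[of \<beta> "{..2}" "\<lambda>\<beta>. (L2_norm (rect a b) (g \<alpha> \<beta>))\<^sup>2"] assms(4) by (simp add: g_def)
  also have "\<dots> \<le> (\<Sum>\<alpha>\<le>1. \<Sum>\<beta>\<le>2. (L2_norm (rect a b) (g \<alpha> \<beta>))\<^sup>2)"
    using member_le_sum[of \<alpha> "{..1}" "\<lambda>\<alpha>. \<Sum>\<beta>\<le>2. (L2_norm (rect a b) (g \<alpha> \<beta>))\<^sup>2"] assms(3)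
    by (simp add: sum_nonneg)
  also have "\<dots> = (H12_norm a b \<phi>)\<^sup>2"
    using H12_norm_eq[of a b \<phi> g, OF wdg] by (simp add: sum_nonneg)
  finally show ?thesis
    by (rule power2_le_imp_le) (simp add: H12_norm_def sum_nonneg)
qed

section \<open>Functions with vanishing weak derivative\<close>

lemma test_fun_add: 
  assumes "\<eta> \<in> test_fun U" "\<zeta> \<in> test_fun U" shows "(\<lambda>z. \<eta> z + \<zeta> z) \<in> test_fun U"
proof -
  obtain C D where C: "compact C" "C \<subseteq> U" "\<And>z. z \<notin> C \<Longrightarrow> \<eta> z = 0"
    and D: "compact D" "D \<subseteq> U" "\<And>z. z \<notin> D \<Longrightarrow> \<zeta> z = 0"
    using assms unfolding test_fun_def by blast
  have "\<exists>C. compact C \<and> C \<subseteq> U \<and> (\<forall>z. z \<notin> C \<longrightarrow> \<eta> z + \<zeta> z = 0)"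
    using C D by (intro exI[of _ "C \<union> D"]) auto
  moreover have "Ck k (\<lambda>z. \<eta> z + \<zeta> z)" for k
    by (intro Ck_add test_fun_Ck[OF assms(1)] test_fun_Ck[OF assms(2)])
  ultimately show ?thesis unfolding test_fun_def by blast
qed

lemma test_fun_cmult: 
  assumes "\<eta> \<in> test_fun U" shows "(\<lambda>z. c * \<eta> z) \<in> test_fun U"
proof -
  obtain C where C: "compact C" "C \<subseteq> U" "\<And>z. z \<notin> C \<Longrightarrow> \<eta> z = 0"
    using assms unfolding test_fun_def by blast
  then have "\<exists>C. compact C \<and> C \<subseteq> U \<and> (\<forall>z. z \<notin> C \<longrightarrow> c * \<eta> z = 0)" by auto
  moreover have "Ck k (\<lambda>z. c * \<eta> z)" for k
    by (intro Ck_cmult test_fun_Ck[OF assms(1)])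
  ultimately show ?thesis unfolding test_fun_def by blast
qed

lemma test_fun_has_derivative:
  fixes \<eta> :: "real \<Rightarrow> real"
  assumes "\<eta> \<in> test_fun U" shows "(\<eta> has_real_derivative pd 1 \<eta> x) (at x)"
proof -
  obtain D where D: "(\<eta> has_real_derivative D) (at x)"
    using test_fun_differentiable[OF assms] real_differentiable_def by blast
  then have "pd 1 \<eta> x = D"
    by (subst pd_at[where f' = "\<lambda>h. D * h"]) (auto simp: has_field_derivative_def)
  with D show ?thesis by simp
qed

text \<open>The primitive is constant on either side of the support of \<open>\<zeta>\<close>; the constants agree because the
  integral of \<open>\<zeta>\<close> is 0.\<close>

lemma test_fun_primitive:
  fixes \<zeta> :: "real \<Rightarrow> real"
  assumes ab: "a < b" and \<zeta>: "\<zeta> \<in> test_fun {a<..<b}" and int0: "integral {a..b} \<zeta> = 0"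
  shows "\<exists>Z\<in>test_fun {a<..<b}. pd 1 Z = \<zeta>"
proof -
  have "\<exists>F. \<forall>x :: real. - \<infinity> < ereal x \<longrightarrow> ereal x < \<infinity> \<longrightarrow> (F has_vector_derivative \<zeta> x) (at x)"
    using test_fun_continuous[OF \<zeta>] by (intro einterval_antiderivative) (auto simp: continuous_on_eq_continuous_at)
  then obtain F where F: "\<And>x. (F has_real_derivative \<zeta> x) (at x)"
    by (auto simp: has_real_derivative_iff_has_vector_derivative)
  define Z where "Z x = F x - F a" for x
  have Z: "(Z has_real_derivative \<zeta> x) (at x)" for x
    unfolding Z_def[abs_def] using F[of x] by (auto intro!: derivative_eq_intros)
  have pdZ: "pd 1 Z = \<zeta>"
    by (rule ext, subst pd_at[OF Z[unfolded has_field_derivative_def]]) simp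
  obtain C where C: "compact C" "C \<subseteq> {a<..<b}" "\<And>z. z \<notin> C \<Longrightarrow> \<zeta> z = 0"
    using \<zeta> unfolding test_fun_def by blast
  define c d where "c = (if C = {} then (a + b) / 2 else Inf C)" and "d = (if C = {} then (a + b) / 2 else Sup C)"
  have cd: "a < c" "d < b" "C \<subseteq> {c..d}" "c \<le> d"
  proof -
    have bdd: "bdd_below C" "bdd_above C"
      using compact_imp_bounded[OF C(1)] by (auto simp: bounded_imp_bdd_below bounded_imp_bdd_above)
    have *: "Inf C \<in> C" "Sup C \<in> C" "C \<subseteq> {Inf C..Sup C}" if "C \<noteq> {}"
      using C(1) that closed_contains_Inf[of C] closed_contains_Sup[of C] bdd
      by (auto simp: compact_imp_closed intro: cInf_lower cSup_upper)
    show "a < c" "d < b" "C \<subseteq> {c..d}" "c \<le> d"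
      using * C(2) ab unfolding c_def d_def by (cases "C = {}"; force)+
  qed
  have left: "Z x = Z a" if "x < c" for x
  proof -
    have "Z constant_on {..<c}"
    proof (rule has_field_derivative_0_imp_constant_on)
      show "(Z has_field_derivative 0) (at y)" if "y \<in> {..<c}" for y
        using Z[of y] C(3)[of y] that cd(3) by force
    qed auto
    then show ?thesis using that cd(1) unfolding constant_on_def by auto
  qed
  have right: "Z x = Z b" if "x > d" for x
  proof -
    have "Z constant_on {d<..}"
    proof (rule has_field_derivative_0_imp_constant_on)
      show "(Z has_field_derivative 0) (at y)" if "y \<in> {d<..}" for y
        using Z[of y] C(3)[of y] that cd(3) by force
    qed auto
    then show ?thesis using that cd(2) unfolding constant_on_def by auto
  qed
  have "(\<zeta> has_integral Z b - Z a) {a..b}"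
    using ab Z by (intro fundamental_theorem_of_calculus)
      (auto simp: has_real_derivative_iff_has_vector_derivative[symmetric] intro: has_field_derivative_at_within)
  then have "Z b = Z a" using int0 by (simp add: integral_unique)
  moreover have "Z a = 0" by (simp add: Z_def)
  ultimately have "Z x = 0" if "x \<notin> {c..d}" for x
    using left[of x] right[of x] that by force
  then have "\<exists>C. compact C \<and> C \<subseteq> {a<..<b} \<and> (\<forall>z. z \<notin> C \<longrightarrow> Z z = 0)"
    using cd by (intro exI[of _ "{c..d}"]) auto
  moreover have "Ck k Z" for k
  proof -
    have "Ck (Suc k) Z"
      using Z pdZ test_fun_Ck[OF \<zeta>, of k] by (auto simp: real_differentiable_def)
    then show ?thesis by (rule Ck_Suc_imp_Ck)
  qed
  ultimately show ?thesis using pdZ unfolding test_fun_def by blast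
qed

text \<open>The lemma of du Bois-Reymond. Fix a test function \<open>\<eta>\<^sub>0\<close> of integral 1. For every test function
  \<open>\<eta>\<close>, subtracting \<open>(\<integral>\<eta>) \<eta>\<^sub>0\<close> leaves one of integral 0, which is the derivative of a test
  function. Hence \<open>\<integral> \<eta> f = (\<integral> \<eta>) C\<close> with \<open>C = \<integral> \<eta>\<^sub>0 f\<close>.\<close>

lemma weak_derivative_zero_imp_constant:
  fixes f :: "real \<Rightarrow> 'v::euclidean_space"
  assumes ab: "a < b" and wd: "wd1 a b 1 f (\<lambda>_. 0)"
  shows "\<exists>C. AE x in lebesgue_on {a..b}. f x = C"
proof -
  let ?M = "lebesgue_on {a..b}"
  have lm: "{a..b} \<in> lmeasurable" by simp
  have fL2: "f \<in> L2 {a..b}" using wd by (rule weak_deriv_L2)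
  have real_L2: "\<eta> \<in> test_fun {a<..<b} \<Longrightarrow> integrable ?M \<eta>" for \<eta>
    using test_fun_times_L2_integrable[of \<eta> "{a<..<b}" "\<lambda>_. 1::real" "{a..b}"]
    by (simp add: L2_def)
  obtain \<eta>0 where \<eta>0: "\<eta>0 \<in> test_fun {a<..<b}" "(LINT x|?M. \<eta>0 x) = 1"
  proof -
    \<comment> \<open>Otherwise the fundamental lemma would give \<open>1 = 0\<close> almost everywhere.\<close>
    have "\<exists>\<eta>\<in>test_fun {a<..<b}. (LINT x|?M. \<eta> x) \<noteq> 0"
    proof (rule ccontr)
      assume "\<not> ?thesis"
      then have "AE x in ?M. (1::real) = 0"
        using fundamental_lemma[of "\<lambda>_. 1::real" a b, unfolded box_real] by (auto simp: L2_def)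
      then have "(1::real) = 0"
        using continuous_AE_zero[of a b "\<lambda>_. 1::real" a, unfolded box_real] ab by auto
      then show False by simp
    qed
    then obtain \<eta> where "\<eta> \<in> test_fun {a<..<b}" "(LINT x|?M. \<eta> x) \<noteq> 0" by blast
    then show thesis
      using test_fun_cmult[of \<eta> "{a<..<b}" "1 / (LINT x|?M. \<eta> x)"]
      by (intro that[of "\<lambda>x. \<eta> x / (LINT x|?M. \<eta> x)"]) simp_all
  qed
  define C where "C = (LINT x|?M. \<eta>0 x *\<^sub>R f x)"
  have "AE x in ?M. f x - C = 0"
  proof (rule fundamental_lemma[of _ a b, unfolded box_real])
    show "(\<lambda>x. f x - C) \<in> L2 {a..b}"
      using fL2 by (intro L2_diff) (auto simp: L2_def)
  next
    fix \<eta> assume "\<eta> \<in> test_fun (interior {a..b})"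
    then have \<eta>: "\<eta> \<in> test_fun {a<..<b}" by simp
    define J where "J = (LINT x|?M. \<eta> x)"
    define \<zeta> where "\<zeta> x = \<eta> x + (- J) * \<eta>0 x" for x
    have \<zeta>: "\<zeta> \<in> test_fun {a<..<b}"
      unfolding \<zeta>_def[abs_def] by (intro test_fun_add test_fun_cmult \<eta> \<eta>0)
    have "(LINT x|?M. \<zeta> x) = 0"
      unfolding \<zeta>_def using real_L2[OF \<eta>] real_L2[OF \<eta>0(1)] \<eta>0(2) by (simp add: J_def)
    then have "integral {a..b} \<zeta> = 0"
      using lebesgue_integral_eq_integral[OF real_L2[OF \<zeta>]] by simp
    then obtain Z where Z: "Z \<in> test_fun {a<..<b}" "pd 1 Z = \<zeta>"
      using test_fun_primitive[OF ab \<zeta>] by blast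
    have "(LINT x|?M. \<zeta> x *\<^sub>R f x) = 0"
      using weak_deriv_test[OF wd, of Z] Z by simp
    moreover have "(LINT x|?M. \<zeta> x *\<^sub>R f x) = (LINT x|?M. \<eta> x *\<^sub>R f x) - J *\<^sub>R C"
    proof -
      have "\<zeta> x *\<^sub>R f x = \<eta> x *\<^sub>R f x - J *\<^sub>R \<eta>0 x *\<^sub>R f x" for x
        by (simp add: \<zeta>_def scaleR_diff_left)
      then show ?thesis
        using test_fun_times_L2_integrable[OF \<eta> fL2 lm] test_fun_times_L2_integrable[OF \<eta>0(1) fL2 lm]
        by (simp add: C_def del: scaleR_scaleR)
    qed
    moreover have "(LINT x|?M. \<eta> x *\<^sub>R (f x - C)) = (LINT x|?M. \<eta> x *\<^sub>R f x) - J *\<^sub>R C"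
      using test_fun_times_L2_integrable[OF \<eta> fL2 lm] real_L2[OF \<eta>]
      by (simp add: scaleR_diff_right J_def)
    ultimately show "(LINT x|?M. \<eta> x *\<^sub>R (f x - C)) = 0" by simp
  qed
  then show ?thesis by auto
qed

section \<open>Borel representatives supported in an interval\<close>

text \<open>Being 0 outside the interval, these functions can be integrated over the whole line, and no
  indicator functions of the interval have to be carried along.\<close>

definition B2 :: "real \<Rightarrow> real \<Rightarrow> (real \<Rightarrow> 'v::euclidean_space) set"
  where "B2 c d = {w \<in> borel_measurable borel. (\<forall>x. x \<notin> {c..d} \<longrightarrow> w x = 0) \<and>
                     integrable lborel (\<lambda>x. (norm (w x))\<^sup>2)}"

lemma B2D:
  assumes "w \<in> B2 c d"
  shows "w \<in> borel_measurable borel" "\<And>x. x \<notin> {c..d} \<Longrightarrow> w x = 0" "integrable lborel (\<lambda>x. (norm (w x))\<^sup>2)"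
  using assms unfolding B2_def by auto

lemma integrable_square_support:
  fixes w :: "real \<Rightarrow> 'v::euclidean_space"
  assumes [measurable]: "w \<in> borel_measurable borel" and off: "\<And>x. x \<notin> {c..d} \<Longrightarrow> w x = 0"
    and sq: "integrable lborel (\<lambda>x. (norm (w x))\<^sup>2)"
  shows "integrable lborel w"
proof -
  have "integrable lborel (\<lambda>x. indicator {c..d} x + (norm (w x))\<^sup>2)"
    using sq by (intro Bochner_Integration.integrable_add integrable_real_indicator) (auto simp: emeasure_lborel_Icc_eq)
  then show ?thesis
  proof (rule Bochner_Integration.integrable_bound)
    have "norm (w x) \<le> norm (indicator {c..d} x + (norm (w x))\<^sup>2)" for x
    proof (cases "x \<in> {c..d}")
      case True
      have "norm (w x) \<le> 1 + (norm (w x))\<^sup>2"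
        using sum_squares_bound[of 1 "norm (w x)"] norm_ge_zero[of "w x"]
        by (simp only: power_one mult_1_right)
      with True show ?thesis by simp
    qed (simp add: off)
    then show "AE x in lborel. norm (w x) \<le> norm (indicator {c..d} x + (norm (w x))\<^sup>2)"
      by (rule AE_I2)
  qed simp
qed

lemma B2_integrable: "w \<in> B2 c d \<Longrightarrow> integrable lborel w"
  using integrable_square_support[of w c d] B2D[of w c d] by blast

lemma B2_Cauchy_Schwarz:
  assumes w: "w \<in> B2 c d" and cd: "c < d"
  shows "(LINT x|lborel. norm (w x))\<^sup>2 \<le> (d - c) * (LINT x|lborel. (norm (w x))\<^sup>2)"
proof -
  note [measurable] = B2D(1)[OF w]
  define m where "m = (LINT x|lborel. norm (w x))"
  have iw: "integrable lborel (\<lambda>x. norm (w x))" using B2_integrable[OF w] by simp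
  have ic: "integrable lborel (indicator {c..d} :: real \<Rightarrow> real)" by (intro integrable_real_indicator) (auto simp: emeasure_lborel_Icc_eq)
  have quad: "0 \<le> (LINT x|lborel. (norm (w x))\<^sup>2) - 2 * t * m + t\<^sup>2 * (d - c)" for t
  proof -
    have "0 \<le> (LINT x|lborel. (norm (w x) - t * indicator {c..d} x)\<^sup>2)" by simp
    also have "\<dots> = (LINT x|lborel. (norm (w x))\<^sup>2 - 2 * t * norm (w x) + t\<^sup>2 * indicator {c..d} x)"
      using B2D(2)[OF w]
      by (intro Bochner_Integration.integral_cong) (auto simp: indicator_def power2_diff)
    also have "\<dots> = (LINT x|lborel. (norm (w x))\<^sup>2) - 2 * t * m + t\<^sup>2 * (d - c)"
      using B2D(3)[OF w] iw ic cd by (simp add: m_def)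
    finally show ?thesis .
  qed
  \<comment> \<open>The minimum of the quadratic is attained at the mean value of \<open>norm w\<close>.\<close>
  have "0 \<le> (LINT x|lborel. (norm (w x))\<^sup>2) - m\<^sup>2 / (d - c)"
    using quad[of "m / (d - c)"] cd by (simp add: power2_eq_square)
  then show ?thesis using cd by (simp add: m_def divide_le_eq mult.commute)
qed

lemma
  assumes w: "w \<in> B2 c d"
  shows B2_L2: "w \<in> L2 {c..d}"
    and B2_L2_norm: "(L2_norm {c..d} w)\<^sup>2 = (LINT x|lborel. (norm (w x))\<^sup>2)"
proof -
  note [measurable] = B2D(1)[OF w]
  have off: "\<And>x. x \<notin> {c..d} \<Longrightarrow> (norm (w x))\<^sup>2 = 0" using B2D(2)[OF w] by simp
  have "w \<in> borel_measurable (lebesgue_on {c..d})"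
    by (intro measurable_restrict_space1 measurable_completion) simp
  moreover have "integrable (lebesgue_on {c..d}) (\<lambda>x. (norm (w x))\<^sup>2)"
    using B2D(3)[OF w] by (subst integrable_lebesgue_on_iff_lborel[OF _ _ off]) auto
  ultimately show "w \<in> L2 {c..d}" by (simp add: L2_def)
  show "(L2_norm {c..d} w)\<^sup>2 = (LINT x|lborel. (norm (w x))\<^sup>2)"
    unfolding L2_norm_square by (rule integral_lebesgue_on_eq_lborel[OF _ _ off]) auto
qed

lemma ex_B2:
  assumes f: "f \<in> L2 {c..d}"
  obtains w where "w \<in> B2 c d" "AE x in lborel. x \<in> {c..d} \<longrightarrow> f x = w x"
proof -
  obtain w where w: "w \<in> borel_measurable borel" "\<And>x. x \<notin> {c..d} \<Longrightarrow> w x = 0"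
      "AE x in lborel. x \<in> {c..d} \<longrightarrow> f x = w x"
    using ex_borel_representative[OF L2_measurable[OF f] atLeastAtMost_borel] by blast
  have mw: "w \<in> borel_measurable (lebesgue_on {c..d})"
    using w(1) by (intro measurable_restrict_space1 measurable_completion) simp
  have "integrable (lebesgue_on {c..d}) (\<lambda>x. (norm (w x))\<^sup>2)"
  proof (rule integrable_cong_AE_imp[OF L2_integrable_square[OF f]])
    show "AE x in lebesgue_on {c..d}. (norm (f x))\<^sup>2 = (norm (w x))\<^sup>2"
      using w(3) by (subst AE_lebesgue_on_iff) auto
  qed (use mw in simp)
  then have "integrable lborel (\<lambda>x. (norm (w x))\<^sup>2)"
    using w by (subst (asm) integrable_lebesgue_on_iff_lborel) auto
  then show thesis using w by (intro that[of w]) (auto simp: B2_def)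
qed

lemma continuous_L2:
  fixes f :: "real \<Rightarrow> 'v::euclidean_space"
  assumes cont: "continuous_on {a..b} f"
  shows "f \<in> L2 {a..b}"
proof -
  have "continuous_on {a..b} (\<lambda>x. (norm (f x))\<^sup>2)" using cont by (intro continuous_intros)
  then show ?thesis
    using cont unfolding L2_def
    by (auto intro: continuous_imp_measurable_on_sets_lebesgue continuous_imp_integrable_real)
qed

section \<open>Integration by parts against a primitive\<close>

definition prim :: "(real \<Rightarrow> 'v::euclidean_space) \<Rightarrow> real \<Rightarrow> 'v"
  where "prim w x = (LINT y|lborel. indicator {..x} y *\<^sub>R w y)"

lemma prim_norm_le:
  assumes "integrable lborel w"
  shows "norm (prim w x) \<le> (LINT y|lborel. norm (w y))"
proof -
  have "norm (prim w x) \<le> (LINT y|lborel. norm (indicator {..x} y *\<^sub>R w y))"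
    unfolding prim_def by (rule integral_norm_bound)
  also have "\<dots> \<le> (LINT y|lborel. norm (w y))"
  proof (rule integral_mono)
    show "integrable lborel (\<lambda>y. norm (indicator {..x} y *\<^sub>R w y))"
      using assms by (intro integrable_norm integrable_mult_indicator) auto
  qed (use assms in \<open>auto simp: indicator_def\<close>)
  finally show ?thesis .
qed

lemma prim_measurable [measurable]:
  fixes w :: "'a \<Rightarrow> real \<Rightarrow> 'v::euclidean_space"
  assumes [measurable]: "case_prod w \<in> borel_measurable (M \<Otimes>\<^sub>M borel)" "f \<in> borel_measurable M"
  shows "(\<lambda>z. prim (w z) (f z)) \<in> borel_measurable M"
proof -
  have [measurable]: "case_prod w \<in> borel_measurable (M \<Otimes>\<^sub>M lborel)"
    using assms(1) by (simp cong: measurable_cong_sets)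
  have "(\<lambda>z. LINT y|lborel. (if y \<le> f z then 1 else 0) *\<^sub>R w z y) \<in> borel_measurable M"
    by measurable
  moreover have "(if y \<le> f z then 1 else 0 :: real) = indicator {..f z} y" for y z by (simp add: indicator_def)
  ultimately show ?thesis by (simp add: prim_def)
qed

lemma integrable_prod_mult:
  fixes f g :: "real \<Rightarrow> real"
  assumes "integrable lborel f" "integrable lborel g"
  shows "integrable (lborel \<Otimes>\<^sub>M lborel) (\<lambda>z. f (fst z) * g (snd z))"
proof -
  have [measurable]: "f \<in> borel_measurable borel" "g \<in> borel_measurable borel"
    using assms by (auto dest: borel_measurable_integrable)
  show ?thesis
    using assms by (intro lborel_pair.Fubini_integrable) (auto simp: abs_mult)
qed

text \<open>For merely integrable \<open>w\<close> the primitive is not differentiable, so the formula comes from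
  exchanging the order of integration: \<open>w(y)\<close> gets the weight \<open>\<integral>\<^sub>y\<^sup>b \<eta>' = - \<eta>(y)\<close>.\<close>

lemma integral_by_parts_prim:
  fixes w :: "real \<Rightarrow> 'v::euclidean_space" and \<eta> :: "real \<Rightarrow> real"
  assumes ab: "a \<le> b" and w: "integrable lborel w" and off: "\<And>x. x \<notin> {a..b} \<Longrightarrow> w x = 0"
    and \<eta>: "\<And>x. (\<eta> has_real_derivative \<eta>' x) (at x)" and cont: "continuous_on UNIV \<eta>'"
    and 0: "\<eta> b = 0"
  shows "(LINT x|lborel. (indicator {a..b} x * \<eta>' x) *\<^sub>R (k + prim w x))
    = - \<eta> a *\<^sub>R k - (LINT x|lborel. \<eta> x *\<^sub>R w x)"
proof -
  have [measurable]: "w \<in> borel_measurable borel" using w by (auto dest: borel_measurable_integrable)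
  have [measurable]: "\<eta>' \<in> borel_measurable borel" using cont by (rule borel_measurable_continuous_onI)
  have FTC: "(LINT x|lborel. indicator {c..b} x * \<eta>' x) = - \<eta> c" if "c \<le> b" for c
    using integral_FTC_Icc[of c b \<eta> \<eta>'] that \<eta> cont 0
    by (simp add: has_real_derivative_iff_has_vector_derivative[symmetric] has_field_derivative_at_within
        continuous_on_subset)
  have i\<eta>': "integrable lborel (\<lambda>x. indicator {a..b} x * \<eta>' x)"
    using borel_integrable_compact[of "{a..b}" \<eta>'] continuous_on_subset[OF cont, of "{a..b}"] 
    by (simp add: set_integrable_def)
  have prod: "integrable (lborel \<Otimes>\<^sub>M lborel) (\<lambda>(x, y). (indicator {a..b} x * \<eta>' x * indicator {..x} y) *\<^sub>R w y)"
  proof (rule Bochner_Integration.integrable_bound)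
    show "integrable (lborel \<Otimes>\<^sub>M lborel) (\<lambda>z. (indicator {a..b} (fst z) * \<eta>' (fst z)) * norm (w (snd z)))"
      using i\<eta>' w by (intro integrable_prod_mult) auto
    have "(\<lambda>(x, y). (indicator {a..b} x * \<eta>' x * (if y \<le> x then 1 else 0)) *\<^sub>R w y)
        \<in> borel_measurable (lborel \<Otimes>\<^sub>M lborel)"
      by measurable
    then show "(\<lambda>(x, y). (indicator {a..b} x * \<eta>' x * indicator {..x} y) *\<^sub>R w y)
        \<in> borel_measurable (lborel \<Otimes>\<^sub>M lborel)"
      by (simp add: indicator_def of_bool_def)
  qed (auto simp: abs_mult indicator_def)
  have i1: "integrable lborel (\<lambda>x. (indicator {a..b} x * \<eta>' x) *\<^sub>R prim w x)"
    using lborel_pair.integrable_fst[OF prod] by (simp add: prim_def flip: scaleR_scaleR)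
  have "(LINT x|lborel. (indicator {a..b} x * \<eta>' x) *\<^sub>R (k + prim w x))
      = (LINT x|lborel. (indicator {a..b} x * \<eta>' x) *\<^sub>R k) + (LINT x|lborel. (indicator {a..b} x * \<eta>' x) *\<^sub>R prim w x)"
    unfolding scaleR_add_right using i\<eta>' i1 by (intro Bochner_Integration.integral_add) auto
  also have "(LINT x|lborel. (indicator {a..b} x * \<eta>' x) *\<^sub>R k) = - \<eta> a *\<^sub>R k"
    using FTC[of a] ab i\<eta>' by simp
  also have "(LINT x|lborel. (indicator {a..b} x * \<eta>' x) *\<^sub>R prim w x)
      = (LINT x|lborel. LINT y|lborel. (indicator {a..b} x * \<eta>' x * indicator {..x} y) *\<^sub>R w y)"
    by (simp add: prim_def flip: scaleR_scaleR)
  also have "\<dots> = (LINT y|lborel. LINT x|lborel. (indicator {a..b} x * \<eta>' x * indicator {..x} y) *\<^sub>R w y)"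
    by (rule lborel_pair.Fubini_integral[OF prod, symmetric])
  also have "\<dots> = (LINT y|lborel. - (\<eta> y *\<^sub>R w y))"
  proof (rule Bochner_Integration.integral_cong)
    fix y
    show "(LINT x|lborel. (indicator {a..b} x * \<eta>' x * indicator {..x} y) *\<^sub>R w y) = - (\<eta> y *\<^sub>R w y)"
    proof (cases "y \<in> {a..b}")
      case True
      have "(LINT x|lborel. indicator {a..b} x * \<eta>' x * indicator {..x} y) = (LINT x|lborel. indicator {y..b} x * \<eta>' x)"
        using True by (intro Bochner_Integration.integral_cong) (auto simp: indicator_def)
      also have "\<dots> = - \<eta> y" using FTC[of y] True by simp
      finally have eq: "(LINT x|lborel. indicator {a..b} x * \<eta>' x * indicator {..x} y) = - \<eta> y" .
      have "integrable lborel (\<lambda>x. indicator {a..b} x * \<eta>' x * indicator {..x} y)"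
        using i\<eta>' by (rule Bochner_Integration.integrable_bound) (auto simp: indicator_def)
      then show ?thesis using eq by simp
    qed (simp add: off)
  qed simp
  finally show ?thesis by simp
qed

lemma weak_derivative_prim:
  fixes w :: "real \<Rightarrow> 'v::euclidean_space"
  assumes ab: "a < b" and w: "w \<in> B2 a b" and f: "\<And>x. x \<in> {a..b} \<Longrightarrow> f x = k + prim w x"
    and cont: "continuous_on {a..b} f"
  shows "wd1 a b 1 f w"
proof -
  have fL2: "f \<in> L2 {a..b}" using cont by (rule continuous_L2)
  have "(LINT x|lebesgue_on {a..b}. pd 1 \<eta> x *\<^sub>R f x) = - (LINT x|lebesgue_on {a..b}. \<eta> x *\<^sub>R w x)"
    if "\<eta> \<in> test_fun (interior {a..b})" for \<eta>
  proof -
    have \<eta>: "\<eta> \<in> test_fun {a<..<b}" using that by simp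
    have [measurable]: "w \<in> borel_measurable borel" "\<eta> \<in> borel_measurable borel"
      "pd 1 \<eta> \<in> borel_measurable borel"
      using B2D(1)[OF w] test_fun_continuous[OF \<eta>] test_fun_continuous[OF test_fun_pd[OF \<eta>, of 1]]
      by (auto intro: borel_measurable_continuous_onI)
    have "(LINT x|lebesgue_on {a..b}. pd 1 \<eta> x *\<^sub>R f x)
        = (LINT x|lebesgue_on {a..b}. (indicator {a..b} x * pd 1 \<eta> x) *\<^sub>R (k + prim w x))"
      using f by (intro Bochner_Integration.integral_cong) auto
    also have "\<dots> = (LINT x|lborel. (indicator {a..b} x * pd 1 \<eta> x) *\<^sub>R (k + prim w x))"
      by (rule integral_lebesgue_on_eq_lborel) auto
    also have "\<dots> = - \<eta> a *\<^sub>R k - (LINT x|lborel. \<eta> x *\<^sub>R w x)"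
      using test_fun_continuous[OF test_fun_pd[OF \<eta>, of 1]] test_fun_outside[OF \<eta>] ab
      by (intro integral_by_parts_prim B2_integrable[OF w] B2D(2)[OF w] test_fun_has_derivative[OF \<eta>]) auto
    also have "\<eta> a = 0" using test_fun_outside[OF \<eta>] by simp
    also have "(LINT x|lborel. \<eta> x *\<^sub>R w x) = (LINT x|lebesgue_on {a..b}. \<eta> x *\<^sub>R w x)"
      using B2D(2)[OF w] by (intro integral_lebesgue_on_eq_lborel[symmetric]) auto
    finally show ?thesis by simp
  qed
  then show ?thesis using fL2 B2_L2[OF w] by (simp add: weak_deriv_def)
qed

section \<open>Borel representatives supported in the rectangle\<close>

lemma AE_lborel_null_cover:
  assumes "AE z in lborel. P z"
  obtains N where "N \<in> null_sets lborel" "\<And>z. z \<notin> N \<Longrightarrow> P z"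
proof -
  obtain N where N: "{z \<in> space lborel. \<not> P z} \<subseteq> N" "emeasure lborel N = 0" "N \<in> sets lborel"
    using assms by (rule AE_E)
  then show thesis by (intro that[of N]) (auto simp: null_sets_def)
qed

lemma AE_lborel_sections:
  fixes P :: "real \<times> real \<Rightarrow> bool"
  assumes "AE z in lborel. P z"
  shows "AE s in lborel. AE x in lborel. P (s, x)" and "AE x in lborel. AE s in lborel. P (s, x)"
proof -
  obtain N where N: "N \<in> null_sets lborel" "\<And>z. z \<notin> N \<Longrightarrow> P z"
    using AE_lborel_null_cover[OF assms] by blast
  then have "N \<in> sets borel" by (simp add: null_sets_def)
  then have [measurable]: "N \<in> sets (borel \<Otimes>\<^sub>M borel)" unfolding borel_prod .
  have "AE z in lborel \<Otimes>\<^sub>M lborel. z \<notin> N"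
    using N(1) by (simp add: lborel_prod AE_not_in)
  then have s: "AE s in lborel. AE x in lborel. (s, x) \<notin> N"
    by (rule lborel_pair.AE_pair)
  moreover have "(AE s in lborel. AE x in lborel. (s, x) \<notin> N) \<longleftrightarrow> (AE x in lborel. AE s in lborel. (s, x) \<notin> N)"
    by (rule lborel_pair.AE_commute) measurable
  ultimately have x: "AE x in lborel. AE s in lborel. (s, x) \<notin> N" by simp
  show "AE s in lborel. AE x in lborel. P (s, x)"
    using s by (rule eventually_mono) (auto elim!: eventually_mono intro: N(2))
  show "AE x in lborel. AE s in lborel. P (s, x)"
    using x by (rule eventually_mono) (auto elim!: eventually_mono intro: N(2))
qed

lemma AE_lborel_fst_snd:
  assumes "AE s in lborel. P s" "AE x in lborel. Q x"
  shows "AE z in (lborel :: (real \<times> real) measure). P (fst z) \<and> Q (snd z)"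
proof -
  obtain N where N: "\<And>s. s \<notin> N \<Longrightarrow> P s" "N \<in> null_sets lborel"
    using AE_lborel_null_cover[OF assms(1)] by blast
  obtain M where M: "\<And>x. x \<notin> M \<Longrightarrow> Q x" "M \<in> null_sets lborel"
    using AE_lborel_null_cover[OF assms(2)] by blast
  have "N \<times> UNIV \<in> null_sets (lborel \<Otimes>\<^sub>M lborel)" "UNIV \<times> M \<in> null_sets (lborel \<Otimes>\<^sub>M lborel)"
    using N(2) M(2) by (auto simp: null_sets_def lborel.emeasure_pair_measure_Times)
  then have "AE z in lborel \<Otimes>\<^sub>M lborel. z \<notin> N \<times> UNIV" "AE z in lborel \<Otimes>\<^sub>M lborel. z \<notin> UNIV \<times> M"
    by (auto intro: AE_not_in)
  then have "AE z in lborel \<Otimes>\<^sub>M lborel. P (fst z) \<and> Q (snd z)"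
  proof eventually_elim
    case (elim z)
    then show ?case using N(1)[of "fst z"] M(1)[of "snd z"] by (auto simp: mem_Times_iff)
  qed
  then show ?thesis unfolding lborel_prod .
qed

text \<open>Beyond being Borel, the representatives have \<^emph>\<open>all\<close> sections square integrable. This makes
  section-wise formulas hold at every point, where an almost everywhere statement would not do for
  the boundary conditions and the initial values.\<close>

definition B22 :: "real \<Rightarrow> real \<Rightarrow> (real \<times> real \<Rightarrow> 'v::euclidean_space) set"
  where "B22 a b = {g \<in> borel_measurable borel. (\<forall>z. z \<notin> rect a b \<longrightarrow> g z = 0) \<and>
     integrable lborel (\<lambda>z. (norm (g z))\<^sup>2) \<and>
     (\<forall>s. (\<lambda>x. g (s, x)) \<in> B2 a b) \<and> (\<forall>x. (\<lambda>s. g (s, x)) \<in> B2 0 1)}"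

lemma B22D:
  assumes "g \<in> B22 a b"
  shows "g \<in> borel_measurable borel" "\<And>z. z \<notin> rect a b \<Longrightarrow> g z = 0"
    "integrable lborel (\<lambda>z. (norm (g z))\<^sup>2)" "\<And>s. (\<lambda>x. g (s, x)) \<in> B2 a b" "\<And>x. (\<lambda>s. g (s, x)) \<in> B2 0 1"
  using assms unfolding B22_def by blast+

lemma rect_borel: "rect a b \<in> sets borel"
  unfolding rect_cbox by simp

lemma
  assumes g: "g \<in> B22 a b"
  shows B22_L2: "g \<in> L2 (rect a b)"
    and B22_L2_norm: "(L2_norm (rect a b) g)\<^sup>2 = (LINT z|lborel. (norm (g z))\<^sup>2)"
    and B22_integrable: "integrable lborel g"
proof -
  note [measurable] = B22D(1)[OF g]
  have off: "\<And>z. z \<notin> rect a b \<Longrightarrow> (norm (g z))\<^sup>2 = 0" using B22D(2)[OF g] by simp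
  have "g \<in> borel_measurable (lebesgue_on (rect a b))"
    by (intro measurable_restrict_space1 measurable_completion) simp
  moreover have "integrable (lebesgue_on (rect a b)) (\<lambda>z. (norm (g z))\<^sup>2)"
    using B22D(3)[OF g] by (subst integrable_lebesgue_on_iff_lborel[OF _ rect_borel off]) auto
  ultimately show L2: "g \<in> L2 (rect a b)" by (simp add: L2_def)
  show "(L2_norm (rect a b) g)\<^sup>2 = (LINT z|lborel. (norm (g z))\<^sup>2)"
    unfolding L2_norm_square by (rule integral_lebesgue_on_eq_lborel[OF _ rect_borel off]) auto
  show "integrable lborel g"
    using L2_integrable[OF L2 rect_lmeasurable] integrable_lebesgue_on_iff_lborel[OF B22D(1)[OF g] rect_borel B22D(2)[OF g]]
    by simp
qed

text \<open>By Fubini's theorem almost all horizontal and vertical sections of a Borel representative are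
  square integrable. Setting it to 0 on the remaining lines changes it on a null set only and makes
  all sections square integrable.\<close>

lemma ex_B22:
  assumes f: "f \<in> L2 (rect a b)"
  obtains g where "g \<in> B22 a b" "AE z in lborel. z \<in> rect a b \<longrightarrow> f z = g z"
proof -
  obtain h where [measurable]: "h \<in> borel_measurable borel" and off: "\<And>z. z \<notin> rect a b \<Longrightarrow> h z = 0"
      and eq: "AE z in lborel. z \<in> rect a b \<longrightarrow> f z = h z"
    using ex_borel_representative[OF L2_measurable[OF f] rect_borel] by blast
  have [measurable]: "h \<in> borel_measurable (borel \<Otimes>\<^sub>M borel)" by (simp add: borel_prod)
  have mh: "h \<in> borel_measurable (lebesgue_on (rect a b))"
    by (intro measurable_restrict_space1 measurable_completion) simp
  have "integrable (lebesgue_on (rect a b)) (\<lambda>z. (norm (h z))\<^sup>2)"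
  proof (rule integrable_cong_AE_imp[OF L2_integrable_square[OF f]])
    show "AE z in lebesgue_on (rect a b). (norm (f z))\<^sup>2 = (norm (h z))\<^sup>2"
      unfolding AE_lebesgue_on_iff[OF rect_borel] using eq by eventually_elim auto
  qed (use mh in simp)
  then have sq: "integrable lborel (\<lambda>z. (norm (h z))\<^sup>2)"
    using off by (subst (asm) integrable_lebesgue_on_iff_lborel[OF _ rect_borel]) auto
  then have sq2: "integrable (lborel \<Otimes>\<^sub>M lborel) (\<lambda>z. (norm (h z))\<^sup>2)" by (simp add: lborel_prod)
  have "AE s in lborel. integrable lborel (\<lambda>x. (norm (h (s, x)))\<^sup>2)"
    by (rule lborel_pair.AE_integrable_fst'[OF sq2])
  from AE_lborel_null_cover[OF this]
  obtain N where N: "\<And>s. s \<notin> N \<Longrightarrow> integrable lborel (\<lambda>x. (norm (h (s, x)))\<^sup>2)" "N \<in> null_sets lborel"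
    by blast
  have "integrable (lborel \<Otimes>\<^sub>M lborel) (\<lambda>(x, s). (norm (h (s, x)))\<^sup>2)"
    using lborel_pair.integrable_product_swap[OF sq2] by simp
  then have "AE x in lborel. integrable lborel (\<lambda>s. (norm (h (s, x)))\<^sup>2)"
    by (rule lborel_pair.AE_integrable_fst'[THEN eventually_mono]) simp
  from AE_lborel_null_cover[OF this]
  obtain M where M: "\<And>x. x \<notin> M \<Longrightarrow> integrable lborel (\<lambda>s. (norm (h (s, x)))\<^sup>2)" "M \<in> null_sets lborel"
    by blast
  have [measurable]: "N \<in> sets borel" "M \<in> sets borel" using N(2) M(2) by (auto simp: null_sets_def)
  define g where "g z = indicator ((- N) \<times> (- M)) z *\<^sub>R h z" for z
  have NM: "(- N) \<times> (- M) \<in> sets (borel :: (real \<times> real) measure)"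
    unfolding borel_prod[symmetric] by (intro pair_measureI) auto
  have g_le: "norm (g z) \<le> norm (h z)" for z by (simp add: g_def indicator_def)
  have gm[measurable]: "g \<in> borel_measurable borel"
    unfolding g_def using NM by (intro borel_measurable_scaleR borel_measurable_indicator) auto
  have gm2[measurable]: "g \<in> borel_measurable (borel \<Otimes>\<^sub>M borel)" using gm by (simp add: borel_prod)
  show thesis
  proof (rule that[of g])
    have "integrable lborel (\<lambda>z. (norm (g z))\<^sup>2)"
      using sq by (rule Bochner_Integration.integrable_bound) (auto intro!: power_mono g_le)
    moreover have "(\<lambda>x. g (s, x)) \<in> B2 a b" for s
    proof -
      have "integrable lborel (\<lambda>x. (norm (g (s, x)))\<^sup>2)"
      proof (cases "s \<in> N")
        case False
        then have "integrable lborel (\<lambda>x. (norm (h (s, x)))\<^sup>2)" using N(1) by auto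
        then show ?thesis
          by (rule Bochner_Integration.integrable_bound) (auto intro!: power_mono g_le)
      qed (simp add: g_def)
      then show ?thesis unfolding B2_def using off by (auto simp: g_def)
    qed
    moreover have "(\<lambda>s. g (s, x)) \<in> B2 0 1" for x
    proof -
      have "integrable lborel (\<lambda>s. (norm (g (s, x)))\<^sup>2)"
      proof (cases "x \<in> M")
        case False
        then have "integrable lborel (\<lambda>s. (norm (h (s, x)))\<^sup>2)" using M(1) by auto
        then show ?thesis
          by (rule Bochner_Integration.integrable_bound) (auto intro!: power_mono g_le)
      qed (simp add: g_def)
      then show ?thesis unfolding B2_def using off by (auto simp: g_def)
    qed
    ultimately show "g \<in> B22 a b" unfolding B22_def using off by (auto simp: g_def)
    have "AE z in (lborel :: (real \<times> real) measure). fst z \<notin> N \<and> snd z \<notin> M"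
      by (intro AE_lborel_fst_snd AE_not_in N M)
    then show "AE z in lborel. z \<in> rect a b \<longrightarrow> f z = g z"
      using eq by eventually_elim (auto simp: g_def indicator_def mem_Times_iff)
  qed
qed

text \<open>The bound \<open>P(s) + Q(x)\<close> covers both kinds of operators: those that integrate over \<open>x\<close> are bounded
  by a function of \<open>s\<close>, those that integrate over \<open>s\<close> by a function of \<open>x\<close>.\<close>

lemma B22I:
  fixes h :: "real \<times> real \<Rightarrow> 'v::euclidean_space"
  assumes m: "h \<in> borel_measurable (borel \<Otimes>\<^sub>M borel)" and off: "\<And>z. z \<notin> rect a b \<Longrightarrow> h z = 0"
    and ab: "a \<le> b"
    and le: "\<And>s x. s \<in> {0..1} \<Longrightarrow> x \<in> {a..b} \<Longrightarrow> (norm (h (s, x)))\<^sup>2 \<le> P s + Q x"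
    and P: "integrable lborel P" "\<And>s. 0 \<le> P s" and Q: "integrable lborel Q" "\<And>x. 0 \<le> Q x"
  shows "h \<in> B22 a b"
    and "(L2_norm (rect a b) h)\<^sup>2 \<le> (b - a) * (LINT s|lborel. P s) + (LINT x|lborel. Q x)"
proof -
  note [measurable] = m
  have hm: "h \<in> borel_measurable borel" using m by (simp add: borel_prod)
  define R where "R z = P (fst z) * indicator {a..b} (snd z) + indicator {0..1} (fst z) * Q (snd z)" for z
  have le': "(norm (h (s, x)))\<^sup>2 \<le> R (s, x)" for s x
    using le[of s x] off[of "(s, x)"] P(2) Q(2) by (auto simp: R_def indicator_def)
  have iab: "integrable lborel (indicator {a..b} :: real \<Rightarrow> real)" "integrable lborel (indicator {0..1} :: real \<Rightarrow> real)"
    by (intro integrable_real_indicator; simp add: emeasure_lborel_Icc_eq)+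
  have iR: "integrable (lborel \<Otimes>\<^sub>M lborel) R"
    unfolding R_def by (intro Bochner_Integration.integrable_add integrable_prod_mult P Q iab)
  have int: "integrable lborel (\<lambda>z. (norm (h z))\<^sup>2)"
    using iR[unfolded lborel_prod]
    by (rule Bochner_Integration.integrable_bound) (use hm le' in \<open>auto intro!: AE_I2 intro: order_trans[OF _ abs_ge_self]\<close>)
  have s1: "(\<lambda>x. h (s, x)) \<in> B2 a b" for s
  proof -
    have "integrable lborel (\<lambda>x. P s * indicator {a..b} x + indicator {0..1} s * Q x)"
      using iab Q(1) by simp
    then have "integrable lborel (\<lambda>x. (norm (h (s, x)))\<^sup>2)"
      by (rule Bochner_Integration.integrable_bound)
         (use le'[of s] in \<open>auto intro!: AE_I2 simp: R_def intro: order_trans[OF _ abs_ge_self]\<close>)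
    then show ?thesis unfolding B2_def using off by auto
  qed
  have s2: "(\<lambda>s. h (s, x)) \<in> B2 0 1" for x
  proof -
    have "integrable lborel (\<lambda>s. P s * indicator {a..b} x + indicator {0..1} s * Q x)"
      using iab P(1) by simp
    then have "integrable lborel (\<lambda>s. (norm (h (s, x)))\<^sup>2)"
      by (rule Bochner_Integration.integrable_bound)
         (use le'[of _ x] in \<open>auto intro!: AE_I2 simp: R_def intro: order_trans[OF _ abs_ge_self]\<close>)
    then show ?thesis unfolding B2_def using off by auto
  qed
  show h: "h \<in> B22 a b" unfolding B22_def using hm off int s1 s2 by auto
  have "(L2_norm (rect a b) h)\<^sup>2 \<le> (LINT z|lborel. R z)"
    unfolding B22_L2_norm[OF h] using int iR le' by (intro integral_mono) (auto simp: lborel_prod)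
  also have "(LINT z|lborel. R z) = (LINT z|(lborel \<Otimes>\<^sub>M lborel). R z)" by (simp add: lborel_prod)
  also have "\<dots> = (LINT s|lborel. LINT x|lborel. R (s, x))"
    by (rule lborel_pair.integral_fst'[OF iR, symmetric])
  also have "\<dots> = (LINT s|lborel. P s * (b - a) + indicator {0..1} s * (LINT x|lborel. Q x))"
    using iab Q(1) ab by (simp add: R_def)
  also have "\<dots> = (b - a) * (LINT s|lborel. P s) + (LINT x|lborel. Q x)"
    using P(1) iab by simp
  finally show "(L2_norm (rect a b) h)\<^sup>2 \<le> (b - a) * (LINT s|lborel. P s) + (LINT x|lborel. Q x)" .
qed

section \<open>Weak partial derivatives on the rectangle\<close>

lemma test_fun_section_derivatives:
  fixes \<eta> :: "real \<times> real \<Rightarrow> real"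
  assumes "\<eta> \<in> test_fun U"
  shows "((\<lambda>x. \<eta> (s, x)) has_real_derivative pd (0, 1) \<eta> (s, x)) (at x)"
    and "((\<lambda>s. \<eta> (s, x)) has_real_derivative pd (1, 0) \<eta> (s, x)) (at s)"
proof -
  let ?D = "frechet_derivative \<eta> (at (s, x))"
  have D: "(\<eta> has_derivative ?D) (at (s, x))"
    using test_fun_differentiable[OF assms] by (simp add: frechet_derivative_works)
  then have lin: "linear ?D" by (rule has_derivative_linear)
  have "((\<lambda>y. \<eta> (s, y)) has_derivative (\<lambda>h. ?D (0, h))) (at x)"
    by (rule has_derivative_compose[of "\<lambda>y. (s, y)" "\<lambda>h. (0, h)", OF _ D])
       (auto intro!: derivative_eq_intros)
  moreover have "?D (0, h) = pd (0, 1) \<eta> (s, x) * h" for h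
    using linear_scale[OF lin, of h "(0, 1)"] by (simp add: pd_def mult.commute)
  ultimately show "((\<lambda>x. \<eta> (s, x)) has_real_derivative pd (0, 1) \<eta> (s, x)) (at x)"
    by (simp add: has_field_derivative_def)
  have "((\<lambda>y. \<eta> (y, x)) has_derivative (\<lambda>h. ?D (h, 0))) (at s)"
    by (rule has_derivative_compose[of "\<lambda>y. (y, x)" "\<lambda>h. (h, 0)", OF _ D])
       (auto intro!: derivative_eq_intros)
  moreover have "?D (h, 0) = pd (1, 0) \<eta> (s, x) * h" for h
    using linear_scale[OF lin, of h "(1, 0)"] by (simp add: pd_def mult.commute)
  ultimately show "((\<lambda>s. \<eta> (s, x)) has_real_derivative pd (1, 0) \<eta> (s, x)) (at s)"
    by (simp add: has_field_derivative_def)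
qed

lemma interior_rect: "interior (rect a b) = {0<..<1} \<times> {a<..<b}"
  by (simp add: interior_Times)

lemma test_times_B22:
  assumes f: "f \<in> B22 a b" and \<eta>: "\<eta> \<in> test_fun U"
  shows "(LINT z|lebesgue_on (rect a b). \<eta> z *\<^sub>R f z) = (LINT z|lborel. \<eta> z *\<^sub>R f z)"
    and "integrable (lborel \<Otimes>\<^sub>M lborel) (\<lambda>z. \<eta> z *\<^sub>R f z)"
proof -
  have m: "(\<lambda>z. \<eta> z *\<^sub>R f z) \<in> borel_measurable borel"
    using B22D(1)[OF f] borel_measurable_continuous_onI[OF test_fun_continuous[OF \<eta>]]
    by (rule borel_measurable_scaleR[rotated])
  have off: "\<And>z. z \<notin> rect a b \<Longrightarrow> \<eta> z *\<^sub>R f z = 0" using B22D(2)[OF f] by simp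
  show "(LINT z|lebesgue_on (rect a b). \<eta> z *\<^sub>R f z) = (LINT z|lborel. \<eta> z *\<^sub>R f z)"
    by (rule integral_lebesgue_on_eq_lborel[OF m rect_borel off])
  show "integrable (lborel \<Otimes>\<^sub>M lborel) (\<lambda>z. \<eta> z *\<^sub>R f z)"
    using test_fun_times_L2_integrable[OF \<eta> B22_L2[OF f] rect_lmeasurable]
      integrable_lebesgue_on_iff_lborel[OF m rect_borel off] by (simp add: lborel_prod)
qed

text \<open>Integration by parts on each section parallel to the \<open>x\<close>-axis, followed by integration over \<open>s\<close>.\<close>

lemma weak_derivative_x:
  assumes ab: "a < b" and f: "f \<in> B22 a b" and g: "g \<in> B22 a b"
    and eq: "\<And>s x. s \<in> {0..1} \<Longrightarrow> x \<in> {a..b} \<Longrightarrow> f (s, x) = k s + prim (\<lambda>y. g (s, y)) x"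
  shows "wd2 a b 0 1 f g"
proof -
  have "(LINT z|lebesgue_on (rect a b). pd (0, 1) \<eta> z *\<^sub>R f z) = - (LINT z|lebesgue_on (rect a b). \<eta> z *\<^sub>R g z)"
    if \<eta>: "\<eta> \<in> test_fun (interior (rect a b))" for \<eta>
  proof -
    have d\<eta>: "pd (0, 1) \<eta> \<in> test_fun (interior (rect a b))"
      using \<eta> by (rule test_fun_pd) (simp add: Basis_prod_def)
    have sec: "(LINT x|lborel. pd (0, 1) \<eta> (s, x) *\<^sub>R f (s, x)) = - (LINT x|lborel. \<eta> (s, x) *\<^sub>R g (s, x))" for s
    proof (cases "s \<in> {0..1}")
      case True
      have "(LINT x|lborel. pd (0, 1) \<eta> (s, x) *\<^sub>R f (s, x))
          = (LINT x|lborel. (indicator {a..b} x * pd (0, 1) \<eta> (s, x)) *\<^sub>R (k s + prim (\<lambda>y. g (s, y)) x))"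
        using True eq B22D(2)[OF f] by (intro Bochner_Integration.integral_cong) (auto simp: indicator_def)
      also have "\<dots> = - \<eta> (s, a) *\<^sub>R k s - (LINT x|lborel. \<eta> (s, x) *\<^sub>R g (s, x))"
        using ab test_fun_outside[OF \<eta>] B2D(2)[OF B22D(4)[OF g]]
        by (intro integral_by_parts_prim B2_integrable[OF B22D(4)[OF g]] test_fun_section_derivatives[OF \<eta>]
            continuous_on_compose2[OF test_fun_continuous[OF d\<eta>]] continuous_intros)
           (auto simp: interior_rect)
      also have "\<eta> (s, a) = 0" using test_fun_outside[OF \<eta>] by (simp add: interior_rect)
      finally show ?thesis by simp
    next
      case False
      then have "f (s, x) = 0" "g (s, x) = 0" for x
        using B22D(2)[OF f] B22D(2)[OF g] by auto
      then show ?thesis by simp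
    qed
    have "(LINT z|lebesgue_on (rect a b). pd (0, 1) \<eta> z *\<^sub>R f z)
        = (LINT z|(lborel \<Otimes>\<^sub>M lborel). pd (0, 1) \<eta> z *\<^sub>R f z)"
      by (simp add: test_times_B22(1)[OF f d\<eta>] lborel_prod)
    also have "\<dots> = (LINT s|lborel. LINT x|lborel. pd (0, 1) \<eta> (s, x) *\<^sub>R f (s, x))"
      by (rule lborel_pair.integral_fst'[OF test_times_B22(2)[OF f d\<eta>], symmetric])
    also have "\<dots> = - (LINT s|lborel. LINT x|lborel. \<eta> (s, x) *\<^sub>R g (s, x))"
      by (simp add: sec)
    also have "(LINT s|lborel. LINT x|lborel. \<eta> (s, x) *\<^sub>R g (s, x)) = (LINT z|(lborel \<Otimes>\<^sub>M lborel). \<eta> z *\<^sub>R g z)"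
      by (rule lborel_pair.integral_fst'[OF test_times_B22(2)[OF g \<eta>]])
    also have "\<dots> = (LINT z|lebesgue_on (rect a b). \<eta> z *\<^sub>R g z)"
      by (simp add: test_times_B22(1)[OF g \<eta>] lborel_prod)
    finally show ?thesis .
  qed
  then show ?thesis using B22_L2[OF f] B22_L2[OF g] by (simp add: weak_deriv_def)
qed

lemma weak_derivative_s:
  assumes f: "f \<in> B22 a b" and g: "g \<in> B22 a b"
    and eq: "\<And>s x. s \<in> {0..1} \<Longrightarrow> x \<in> {a..b} \<Longrightarrow> f (s, x) = k x + prim (\<lambda>r. g (r, x)) s"
  shows "wd2 a b 1 0 f g"
proof -
  have "(LINT z|lebesgue_on (rect a b). pd (1, 0) \<eta> z *\<^sub>R f z) = - (LINT z|lebesgue_on (rect a b). \<eta> z *\<^sub>R g z)"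
    if \<eta>: "\<eta> \<in> test_fun (interior (rect a b))" for \<eta>
  proof -
    have d\<eta>: "pd (1, 0) \<eta> \<in> test_fun (interior (rect a b))"
      using \<eta> by (rule test_fun_pd) (simp add: Basis_prod_def)
    have sec: "(LINT s|lborel. pd (1, 0) \<eta> (s, x) *\<^sub>R f (s, x)) = - (LINT s|lborel. \<eta> (s, x) *\<^sub>R g (s, x))" for x
    proof (cases "x \<in> {a..b}")
      case True
      have "(LINT s|lborel. pd (1, 0) \<eta> (s, x) *\<^sub>R f (s, x))
          = (LINT s|lborel. (indicator {0..1} s * pd (1, 0) \<eta> (s, x)) *\<^sub>R (k x + prim (\<lambda>r. g (r, x)) s))"
        using True eq B22D(2)[OF f] by (intro Bochner_Integration.integral_cong) (auto simp: indicator_def)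
      also have "\<dots> = - \<eta> (0, x) *\<^sub>R k x - (LINT s|lborel. \<eta> (s, x) *\<^sub>R g (s, x))"
        using test_fun_outside[OF \<eta>] B2D(2)[OF B22D(5)[OF g]]
        by (intro integral_by_parts_prim B2_integrable[OF B22D(5)[OF g]] test_fun_section_derivatives[OF \<eta>]
            continuous_on_compose2[OF test_fun_continuous[OF d\<eta>]] continuous_intros)
           (auto simp: interior_rect)
      also have "\<eta> (0, x) = 0" using test_fun_outside[OF \<eta>] by (simp add: interior_rect)
      finally show ?thesis by simp
    next
      case False
      then have "f (s, x) = 0" "g (s, x) = 0" for s
        using B22D(2)[OF f] B22D(2)[OF g] by auto
      then show ?thesis by simp
    qed
    have Fubini: "(LINT z|(lborel \<Otimes>\<^sub>M lborel). h z) = (LINT x|lborel. LINT s|lborel. h (s, x))"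
      if "integrable (lborel \<Otimes>\<^sub>M lborel) h" for h :: "real \<times> real \<Rightarrow> 'a"
      using lborel_pair.integral_snd[of "\<lambda>s x. h (s, x)"] that by simp
    have "(LINT z|lebesgue_on (rect a b). pd (1, 0) \<eta> z *\<^sub>R f z)
        = (LINT z|(lborel \<Otimes>\<^sub>M lborel). pd (1, 0) \<eta> z *\<^sub>R f z)"
      by (simp add: test_times_B22(1)[OF f d\<eta>] lborel_prod)
    also have "\<dots> = (LINT x|lborel. LINT s|lborel. pd (1, 0) \<eta> (s, x) *\<^sub>R f (s, x))"
      by (rule Fubini[OF test_times_B22(2)[OF f d\<eta>]])
    also have "\<dots> = - (LINT x|lborel. LINT s|lborel. \<eta> (s, x) *\<^sub>R g (s, x))"
      by (simp add: sec)
    also have "(LINT x|lborel. LINT s|lborel. \<eta> (s, x) *\<^sub>R g (s, x)) = (LINT z|(lborel \<Otimes>\<^sub>M lborel). \<eta> z *\<^sub>R g z)"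
      by (rule Fubini[OF test_times_B22(2)[OF g \<eta>], symmetric])
    also have "\<dots> = (LINT z|lebesgue_on (rect a b). \<eta> z *\<^sub>R g z)"
      by (simp add: test_times_B22(1)[OF g \<eta>] lborel_prod)
    finally show ?thesis .
  qed
  then show ?thesis using B22_L2[OF f] B22_L2[OF g] by (simp add: weak_deriv_def)
qed

section \<open>The kernels in block form\<close>

definition upper :: "'a^('p::finite + 'q::finite) \<Rightarrow> 'a^'p" where "upper z = (\<chi> i. z $ Inl i)"
definition lower :: "'a^('p::finite + 'q::finite) \<Rightarrow> 'a^'q" where "lower z = (\<chi> i. z $ Inr i)"

lemma bounded_linear_upper: "bounded_linear (upper :: real^('p::finite + 'q::finite) \<Rightarrow> real^'p)"
  by (intro linear_conv_bounded_linear[THEN iffD1] linearI) (simp_all add: upper_def vec_eq_iff)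

lemma bounded_linear_lower: "bounded_linear (lower :: real^('p::finite + 'q::finite) \<Rightarrow> real^'q)"
  by (intro linear_conv_bounded_linear[THEN iffD1] linearI) (simp_all add: lower_def vec_eq_iff)

lemma bounded_linear_on_top:
  fixes f :: "'v::euclidean_space \<Rightarrow> real^'p::finite" and g :: "'v \<Rightarrow> real^'q::finite"
  assumes "bounded_linear f" "bounded_linear g"
  shows "bounded_linear (\<lambda>z. f z on_top g z)"
proof -
  interpret f: bounded_linear f by fact
  interpret g: bounded_linear g by fact
  show ?thesis
    by (intro linear_conv_bounded_linear[THEN iffD1] linearI)
       (auto simp: on_top_def vec_eq_iff f.add g.add f.scale g.scale split: sum.split)
qed

lemma on_top_mult_vec: "(A on_top C) *v y = (A *v y) on_top (C *v y)"
  by (auto simp: vec_eq_iff matrix_vector_mult_def on_top_def split: sum.split)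

lemma beside_mult_vec:
  fixes A :: "real^'p::finite^'m" and C :: "real^'q::finite^'m"
  shows "(A beside C) *v z = A *v upper z + C *v lower z"
proof -
  have "(\<Sum>j\<in>UNIV. h j) = (\<Sum>k\<in>UNIV. h (Inl k)) + (\<Sum>k\<in>UNIV. h (Inr k))" for h :: "'p + 'q \<Rightarrow> real"
    unfolding UNIV_Plus_UNIV[symmetric] by (simp add: sum.Plus del: UNIV_Plus_UNIV)
  then show ?thesis
    by (simp add: vec_eq_iff matrix_vector_mult_def beside_def on_top_def upper_def lower_def)
qed

lemma mat_mult_vec: "mat c *v y = c *\<^sub>R (y :: real^'n)"
  by (simp add: vec_eq_iff matrix_vector_mult_def mat_def if_distrib[of "\<lambda>t. t * _"] cong: if_cong)

lemma K_mat_mult_vec: "K_mat a x *v z = upper z + (x - a) *\<^sub>R lower z"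
  by (simp add: K_mat_def beside_mult_vec mat_mult_vec)

lemma H_mat_mult_vec: "H_mat a b *v c = upper c on_top (upper c + (b - a) *\<^sub>R lower c) on_top lower c on_top lower c"
  by (simp add: H_mat_def on_top_mult_vec beside_mult_vec mat_mult_vec)

lemma Q_mat_mult_vec: "Q_mat b \<theta> *v y = 0 on_top ((b - \<theta>) *\<^sub>R y) on_top 0 on_top y"
  by (simp add: Q_mat_def on_top_mult_vec mat_mult_vec)

lemma on_top_add: "(x on_top y) + (x' on_top y') = (x + x') on_top (y + y' :: real^'q)"
  by (auto simp: vec_eq_iff on_top_def split: sum.split)

text \<open>\<open>kvec a b B p q\<close> is the vector \<open>c\<close> for which \<open>x \<mapsto> K(x) c\<close> corrects the boundary values of
  the double primitive of \<open>w\<close>, where \<open>p\<close> and \<open>q\<close> are the values at \<open>b\<close> of that primitive and of its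
  derivative.\<close>

definition kvec :: "real \<Rightarrow> real \<Rightarrow> real^('n::finite + 'n + 'n + 'n)^('n + 'n) \<Rightarrow> real^'n \<Rightarrow> real^'n \<Rightarrow> real^('n + 'n)"
  where "kvec a b B p q = - (matrix_inv (B ** H_mat a b) *v (B *v (0 on_top p on_top 0 on_top q)))"

lemma kvec_split:
  fixes B :: "real^('n::finite + 'n + 'n + 'n)^('n + 'n)"
  shows "kvec a b B p q = kvec a b B p 0 + kvec a b B 0 q"
proof -
  have "((0::real^'n) on_top p on_top (0::real^'n) on_top q)
      = (0 on_top p on_top 0 on_top 0) + (0 on_top 0 on_top 0 on_top q)"
    by (simp add: on_top_add)
  then show ?thesis
    unfolding kvec_def by (simp only: matrix_vector_right_distrib minus_add_distrib)
qed

lemma bounded_linear_kvec1: "bounded_linear (\<lambda>p. kvec a b B p 0)"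
  and bounded_linear_kvec2: "bounded_linear (\<lambda>q. kvec a b B 0 q)"
  unfolding kvec_def
  by (intro bounded_linear_minus bounded_linear_compose[OF matrix_vector_mul_bounded_linear]
      bounded_linear_on_top bounded_linear_zero bounded_linear_ident)+

text \<open>Applied to a vector, the product of block matrices is an affine function of \<open>x\<close> whose coefficients
  are the two halves of \<open>kvec\<close>.\<close>

lemma T2_ker_mult_vec:
  fixes B :: "real^('n::finite + 'n + 'n + 'n)^('n + 'n)"
  shows "T2_ker a b B x \<theta> *v y = upper (kvec a b B ((b - \<theta>) *\<^sub>R y) y) + (x - a) *\<^sub>R lower (kvec a b B ((b - \<theta>) *\<^sub>R y) y)"
proof -
  have neg: "(- A) *v y = - (A *v y)" for A :: "real^'n^'n" and y
    by (simp add: vec_eq_iff matrix_vector_mult_def sum_negf)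
  have "T2_ker a b B x \<theta> *v y = - (K_mat a x *v (matrix_inv (B ** H_mat a b) *v (B *v (Q_mat b \<theta> *v y))))"
    by (simp add: T2_ker_def neg matrix_vector_mul_assoc matrix_mul_assoc)
  also have "\<dots> = K_mat a x *v kvec a b B ((b - \<theta>) *\<^sub>R y) y"
    by (simp add: kvec_def Q_mat_mult_vec linear_neg[OF matrix_vector_mul_linear])
  finally show ?thesis by (simp add: K_mat_mult_vec)
qed

lemma T1_ker_mult_vec: "T1_ker a b B x \<theta> *v y = (x - \<theta>) *\<^sub>R y + T2_ker a b B x \<theta> *v y"
  by (simp add: T1_ker_def matrix_vector_mult_add_rdistrib mat_mult_vec)

text \<open>The kernels are affine in \<open>x\<close>.\<close>

lemma
  fixes B :: "real^('n::finite + 'n + 'n + 'n)^('n + 'n)"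
  shows T2_ker_deriv: "vector_derivative (\<lambda>y. T2_ker a b B y \<theta>) (at x) *v y
      = lower (kvec a b B ((b - \<theta>) *\<^sub>R y) y)"
    and T1_ker_deriv: "vector_derivative (\<lambda>y. T1_ker a b B y \<theta>) (at x) *v y
      = y + lower (kvec a b B ((b - \<theta>) *\<^sub>R y) y)"
proof -
  interpret u: bounded_linear "upper :: real^('n + 'n) \<Rightarrow> real^'n" by (rule bounded_linear_upper)
  interpret l: bounded_linear "lower :: real^('n + 'n) \<Rightarrow> real^'n" by (rule bounded_linear_lower)
  define e where "e y = kvec a b B ((b - \<theta>) *\<^sub>R y) y" for y
  have "bounded_linear e"
    unfolding e_def kvec_def
    by (intro bounded_linear_minus bounded_linear_compose[OF matrix_vector_mul_bounded_linear]
        bounded_linear_on_top bounded_linear_zero bounded_linear_ident bounded_linear_scaleR_right)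
  then have lin: "linear (\<lambda>y. upper (e y))" "linear (\<lambda>y. lower (e y))"
    by (auto intro!: bounded_linear.linear bounded_linear_compose[OF bounded_linear_upper]
        bounded_linear_compose[OF bounded_linear_lower])
  define M N where "M = matrix (\<lambda>y. upper (e y))" and "N = matrix (\<lambda>y. lower (e y))"
  have MN: "M *v y = upper (e y)" "N *v y = lower (e y)" for y
    unfolding M_def N_def by (simp_all add: matrix_works[OF linear_matrix_vector_mul_eq[THEN iffD2, OF lin(1)]]
        matrix_works[OF linear_matrix_vector_mul_eq[THEN iffD2, OF lin(2)]])
  have sc: "(c *\<^sub>R A) *v y = c *\<^sub>R (A *v y)" for c and A :: "real^'n^'n" and y
    by (simp add: vec_eq_iff matrix_vector_mult_def sum_distrib_left mult.assoc)
  have T2: "T2_ker a b B z \<theta> = M + (z - a) *\<^sub>R N" for z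
    by (simp add: matrix_eq T2_ker_mult_vec matrix_vector_mult_add_rdistrib sc MN e_def)
  have T1: "T1_ker a b B z \<theta> = (z - \<theta>) *\<^sub>R mat 1 + (M + (z - a) *\<^sub>R N)" for z
    by (simp add: matrix_eq T1_ker_mult_vec T2 matrix_vector_mult_add_rdistrib sc)
  have "((\<lambda>z. M + (z - a) *\<^sub>R N) has_vector_derivative N) (at x)"
    by (auto intro!: derivative_eq_intros)
  then show "vector_derivative (\<lambda>y. T2_ker a b B y \<theta>) (at x) *v y = lower (kvec a b B ((b - \<theta>) *\<^sub>R y) y)"
    by (simp add: T2 vector_derivative_at MN e_def)
  have "((\<lambda>z. (z - \<theta>) *\<^sub>R mat 1 + (M + (z - a) *\<^sub>R N)) has_vector_derivative (mat 1 + N)) (at x)"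
    by (auto intro!: derivative_eq_intros)
  then show "vector_derivative (\<lambda>y. T1_ker a b B y \<theta>) (at x) *v y = y + lower (kvec a b B ((b - \<theta>) *\<^sub>R y) y)"
    by (simp add: T1 vector_derivative_at matrix_vector_mult_add_rdistrib MN e_def)
qed

section \<open>The operator \<open>\<T>\<^sub>1\<close> as a double primitive\<close>

text \<open>All quantities derived from \<open>w\<close> below are weighted integrals of \<open>w\<close>. Linearity, bounds, limits and
  the exchange with integration in \<open>s\<close> are therefore proved once, for a general weight.\<close>

definition moment :: "(real \<Rightarrow> real) \<Rightarrow> (real \<Rightarrow> 'v::euclidean_space) \<Rightarrow> 'v"
  where "moment \<kappa> w = (LINT y|lborel. \<kappa> y *\<^sub>R w y)"

definition coef :: "real \<Rightarrow> real \<Rightarrow> real^('n::finite + 'n + 'n + 'n)^('n + 'n) \<Rightarrow> (real \<Rightarrow> real^'n) \<Rightarrow> real^('n + 'n)"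
  where "coef a b B w = kvec a b B (moment (\<lambda>y. b - y) w) (moment (\<lambda>y. 1) w)"

text \<open>\<open>\<T>\<^sub>1 w\<close> as the function \<open>K(x) c\<close> plus the double primitive of \<open>w\<close>, written as a single integral
  with weight \<open>x - y\<close>; \<open>DTk\<close> below is its derivative.\<close>

definition Tk :: "real \<Rightarrow> real \<Rightarrow> real^('n::finite + 'n + 'n + 'n)^('n + 'n) \<Rightarrow> (real \<Rightarrow> real^'n) \<Rightarrow> real \<Rightarrow> real^'n"
  where "Tk a b B w x = upper (coef a b B w) + (x - a) *\<^sub>R lower (coef a b B w) + prim (\<lambda>y. (x - y) *\<^sub>R w y) x"

definition DTk :: "real \<Rightarrow> real \<Rightarrow> real^('n::finite + 'n + 'n + 'n)^('n + 'n) \<Rightarrow> (real \<Rightarrow> real^'n) \<Rightarrow> real \<Rightarrow> real^'n"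
  where "DTk a b B w x = lower (coef a b B w) + prim w x"

lemma B2_affine_integrable:
  assumes w: "w \<in> B2 a b"
  shows "integrable lborel (\<lambda>y. (c + d * y) *\<^sub>R w y)"
proof -
  note [measurable] = B2D(1)[OF w]
  have "integrable lborel (\<lambda>y. (\<bar>c\<bar> + \<bar>d\<bar> * (\<bar>a\<bar> + \<bar>b\<bar>)) *\<^sub>R w y)" using B2_integrable[OF w] by simp
  then show ?thesis
  proof (rule Bochner_Integration.integrable_bound)
    have "\<bar>c + d * y\<bar> \<le> \<bar>c\<bar> + \<bar>d\<bar> * (\<bar>a\<bar> + \<bar>b\<bar>)" if "y \<in> {a..b}" for y
    proof -
      have "\<bar>d * y\<bar> \<le> \<bar>d\<bar> * (\<bar>a\<bar> + \<bar>b\<bar>)"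
        unfolding abs_mult using that by (intro mult_left_mono) auto
      then show ?thesis by linarith
    qed
    then have "norm ((c + d * y) *\<^sub>R w y) \<le> norm ((\<bar>c\<bar> + \<bar>d\<bar> * (\<bar>a\<bar> + \<bar>b\<bar>)) *\<^sub>R w y)" for y
      using B2D(2)[OF w, of y]
      by (cases "y \<in> {a..b}") (auto intro!: mult_right_mono intro: order_trans[OF _ abs_ge_self])
    then show "AE y in lborel. norm ((c + d * y) *\<^sub>R w y) \<le> norm ((\<bar>c\<bar> + \<bar>d\<bar> * (\<bar>a\<bar> + \<bar>b\<bar>)) *\<^sub>R w y)"
      by (rule AE_I2)
  qed measurable
qed

lemma B2_weighted_integrable:
  assumes w: "w \<in> B2 a b"
  shows "integrable lborel (\<lambda>y. (c - y) *\<^sub>R w y)"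
  using B2_affine_integrable[OF w, of c "-1"] by simp

lemma
  assumes w: "w \<in> B2 a b"
  shows kvec_integrable: "integrable lborel (\<lambda>\<theta>. kvec a b B ((b - \<theta>) *\<^sub>R w \<theta>) (w \<theta>))"
    and coef_eq_integral: "(LINT \<theta>|lborel. kvec a b B ((b - \<theta>) *\<^sub>R w \<theta>) (w \<theta>)) = coef a b B w"
proof -
  have i1: "integrable lborel (\<lambda>\<theta>. kvec a b B ((b - \<theta>) *\<^sub>R w \<theta>) 0)"
    by (rule integrable_bounded_linear[OF bounded_linear_kvec1 B2_weighted_integrable[OF w]])
  have i2: "integrable lborel (\<lambda>\<theta>. kvec a b B 0 (w \<theta>))"
    by (rule integrable_bounded_linear[OF bounded_linear_kvec2 B2_integrable[OF w]])
  show "integrable lborel (\<lambda>\<theta>. kvec a b B ((b - \<theta>) *\<^sub>R w \<theta>) (w \<theta>))"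
    unfolding kvec_split[of a b B "_ *\<^sub>R _" "w _"] using i1 i2 by (rule Bochner_Integration.integrable_add)
  have "(LINT \<theta>|lborel. kvec a b B ((b - \<theta>) *\<^sub>R w \<theta>) (w \<theta>))
      = (LINT \<theta>|lborel. kvec a b B ((b - \<theta>) *\<^sub>R w \<theta>) 0) + (LINT \<theta>|lborel. kvec a b B 0 (w \<theta>))"
    unfolding kvec_split[of a b B "_ *\<^sub>R _" "w _"] using i1 i2 by (rule Bochner_Integration.integral_add)
  also have "\<dots> = coef a b B w"
    using integral_bounded_linear[OF bounded_linear_kvec1 B2_weighted_integrable[OF w], of a b B b]
      integral_bounded_linear[OF bounded_linear_kvec2 B2_integrable[OF w], of a b B]
      kvec_split[of a b B "moment (\<lambda>y. b - y) w" "moment (\<lambda>y. 1) w"]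
    by (simp add: coef_def moment_def)
  finally show "(LINT \<theta>|lborel. kvec a b B ((b - \<theta>) *\<^sub>R w \<theta>) (w \<theta>)) = coef a b B w" .
qed

text \<open>\<open>\<T>\<^sub>1\<close> and \<open>\<A>\<^bsub>11,d\<^esub>\<close> have the same shape: one kernel on the whole interval, applied to \<open>kvec\<close>,
  and additional terms for \<open>\<theta> \<le> x\<close> only. The linear maps \<open>J\<close>, \<open>N\<close> and \<open>N'\<close> are chosen
  differently for the two operators.\<close>

lemma split_kernel_integral:
  fixes J :: "real^('n::finite + 'n) \<Rightarrow> 'u::euclidean_space" and B :: "real^('n + 'n + 'n + 'n)^('n + 'n)"
  assumes w: "w \<in> B2 a b" and x: "x \<in> {a..b}"
    and J: "bounded_linear J" and N: "bounded_linear N" and N': "bounded_linear N'"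
  shows "(LINT \<theta>:{a..x}|lebesgue. J (kvec a b B ((b - \<theta>) *\<^sub>R w \<theta>) (w \<theta>)) + (N ((x - \<theta>) *\<^sub>R w \<theta>) + N' (w \<theta>)))
       + (LINT \<theta>:{x..b}|lebesgue. J (kvec a b B ((b - \<theta>) *\<^sub>R w \<theta>) (w \<theta>)))
       = J (coef a b B w) + (N (prim (\<lambda>\<theta>. (x - \<theta>) *\<^sub>R w \<theta>) x) + N' (prim w x))"
proof -
  interpret J: bounded_linear J by fact
  interpret N: bounded_linear N by fact
  interpret N': bounded_linear N' by fact
  define h where "h \<theta> = J (kvec a b B ((b - \<theta>) *\<^sub>R w \<theta>) (w \<theta>))" for \<theta>
  define k where "k \<theta> = N ((x - \<theta>) *\<^sub>R w \<theta>) + N' (w \<theta>)" for \<theta>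
  have h: "integrable lborel h" unfolding h_def by (rule integrable_bounded_linear[OF J kvec_integrable[OF w]])
  have k1: "integrable lborel (\<lambda>\<theta>. N ((x - \<theta>) *\<^sub>R w \<theta>))" "integrable lborel (\<lambda>\<theta>. N' (w \<theta>))"
    by (rule integrable_bounded_linear[OF N B2_weighted_integrable[OF w]])
       (rule integrable_bounded_linear[OF N' B2_integrable[OF w]])
  then have k: "integrable lborel k" unfolding k_def by (rule Bochner_Integration.integrable_add)
  have [measurable]: "h \<in> borel_measurable borel" "k \<in> borel_measurable borel"
    using borel_measurable_integrable[OF h] borel_measurable_integrable[OF k] by auto
  have h0: "h \<theta> = 0" and k0: "k \<theta> = 0" if "\<theta> \<notin> {a..b}" for \<theta>
    using B2D(2)[OF w that] linear_0[OF bounded_linear.linear[OF bounded_linear_kvec1], of a b B]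
    by (simp_all add: h_def k_def J.zero N.zero N'.zero)
  have mono: "integrable lborel (\<lambda>\<theta>. indicator A \<theta> *\<^sub>R f \<theta>)" if "integrable lborel f" "A \<in> sets borel"
    for A and f :: "real \<Rightarrow> 'u"
    using that by (intro integrable_mult_indicator) auto
  have "(LINT \<theta>:{a..x}|lebesgue. h \<theta> + k \<theta>) + (LINT \<theta>:{x..b}|lebesgue. h \<theta>)
      = (LINT \<theta>|lborel. indicator {a..x} \<theta> *\<^sub>R (h \<theta> + k \<theta>)) + (LINT \<theta>|lborel. indicator {x..b} \<theta> *\<^sub>R h \<theta>)"
    unfolding set_lebesgue_integral_def by (simp add: integral_completion)
  also have "\<dots> = (LINT \<theta>|lborel. indicator {a..x} \<theta> *\<^sub>R (h \<theta> + k \<theta>) + indicator {x..b} \<theta> *\<^sub>R h \<theta>)"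
    using h k by (intro Bochner_Integration.integral_add[symmetric] mono) auto
  also have "\<dots> = (LINT \<theta>|lborel. h \<theta> + indicator {..x} \<theta> *\<^sub>R k \<theta>)"
  proof (rule integral_cong_AE)
    show "AE \<theta> in lborel. indicator {a..x} \<theta> *\<^sub>R (h \<theta> + k \<theta>) + indicator {x..b} \<theta> *\<^sub>R h \<theta> = h \<theta> + indicator {..x} \<theta> *\<^sub>R k \<theta>"
      using AE_lborel_singleton[of x]
    proof eventually_elim
      case (elim \<theta>)
      then show ?case using h0[of \<theta>] k0[of \<theta>] x by (cases "\<theta> \<in> {a..b}") (auto simp: indicator_def)
    qed
  qed measurable
  also have "\<dots> = (LINT \<theta>|lborel. h \<theta>) + (LINT \<theta>|lborel. indicator {..x} \<theta> *\<^sub>R k \<theta>)"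
    using h k by (intro Bochner_Integration.integral_add mono) auto
  also have "(LINT \<theta>|lborel. h \<theta>) = J (coef a b B w)"
    unfolding h_def using integral_bounded_linear[OF J kvec_integrable[OF w]] by (simp add: coef_eq_integral[OF w])
  also have "(LINT \<theta>|lborel. indicator {..x} \<theta> *\<^sub>R k \<theta>)
      = (LINT \<theta>|lborel. N (indicator {..x} \<theta> *\<^sub>R (x - \<theta>) *\<^sub>R w \<theta>) + N' (indicator {..x} \<theta> *\<^sub>R w \<theta>))"
    by (simp add: k_def N.scale N'.scale scaleR_add_right)
  also have "\<dots> = N (prim (\<lambda>\<theta>. (x - \<theta>) *\<^sub>R w \<theta>) x) + N' (prim w x)"
  proof -
    have iN: "integrable lborel (\<lambda>\<theta>. indicator {..x} \<theta> *\<^sub>R (x - \<theta>) *\<^sub>R w \<theta>)"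
      "integrable lborel (\<lambda>\<theta>. indicator {..x} \<theta> *\<^sub>R w \<theta>)"
      using B2_weighted_integrable[OF w] B2_integrable[OF w] by (auto intro!: integrable_mult_indicator simp del: scaleR_scaleR)
    show ?thesis
      unfolding prim_def
      using integrable_bounded_linear[OF N iN(1)] integrable_bounded_linear[OF N' iN(2)]
        integral_bounded_linear[OF N iN(1)] integral_bounded_linear[OF N' iN(2)] by simp
  qed
  finally show ?thesis by (simp add: h_def k_def)
qed

lemma T1_op_eq_Tk:
  fixes B :: "real^('n::finite + 'n + 'n + 'n)^('n + 'n)"
  assumes w: "w \<in> B2 a b" and x: "x \<in> {a..b}"
  shows "T1_op a b B w x = Tk a b B w x"
proof -
  have J: "bounded_linear (\<lambda>z :: real^('n + 'n). upper z + (x - a) *\<^sub>R lower z)"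
    by (intro bounded_linear_add bounded_linear_upper bounded_linear_const_scaleR bounded_linear_lower)
  show ?thesis
    using split_kernel_integral[OF w x J bounded_linear_ident bounded_linear_zero, of B]
    by (simp add: T1_op_def T1_ker_mult_vec T2_ker_mult_vec Tk_def add.commute)
qed

lemma A11d_op_eq:
  fixes B :: "real^('n::finite + 'n + 'n + 'n)^('n + 'n)"
  assumes w: "w \<in> B2 a b" and x: "x \<in> {a..b}"
  shows "A11d_op a b B A_d w x = A_d x *v (Tk a b B w x on_top DTk a b B w x on_top w x)"
proof -
  let ?J = "\<lambda>z :: real^('n + 'n). A_d x *v ((upper z + (x - a) *\<^sub>R lower z) on_top lower z on_top 0)"
  let ?N = "\<lambda>y :: real^'n. A_d x *v (y on_top 0 on_top 0)" and ?N' = "\<lambda>y :: real^'n. A_d x *v (0 on_top y on_top 0)"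
  have J: "bounded_linear ?J"
    by (intro bounded_linear_compose[OF matrix_vector_mul_bounded_linear] bounded_linear_on_top bounded_linear_zero
        bounded_linear_add bounded_linear_upper bounded_linear_const_scaleR bounded_linear_lower)
  have N: "bounded_linear ?N" "bounded_linear ?N'"
    by (intro bounded_linear_compose[OF matrix_vector_mul_bounded_linear] bounded_linear_on_top bounded_linear_zero
        bounded_linear_ident)+
  have 1: "Ad_ker A_d (T1_ker a b B) x \<theta> *v y = ?J (kvec a b B ((b - \<theta>) *\<^sub>R y) y) + (?N ((x - \<theta>) *\<^sub>R y) + ?N' y)" for \<theta> y
    by (simp add: Ad_ker_def matrix_vector_mul_assoc[symmetric] on_top_mult_vec T1_ker_mult_vec T2_ker_mult_vec
        T1_ker_deriv matrix_vector_right_distrib[symmetric] on_top_add add_ac)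
  have 2: "Ad_ker A_d (T2_ker a b B) x \<theta> *v y = ?J (kvec a b B ((b - \<theta>) *\<^sub>R y) y)" for \<theta> y
    by (simp add: Ad_ker_def matrix_vector_mul_assoc[symmetric] on_top_mult_vec T2_ker_mult_vec T2_ker_deriv)
  have "A11d_op a b B A_d w x = A_d x *v (0 on_top 0 on_top w x)
      + (?J (coef a b B w) + (?N (prim (\<lambda>\<theta>. (x - \<theta>) *\<^sub>R w \<theta>) x) + ?N' (prim w x)))"
    unfolding A11d_op_def 1 2 add.assoc split_kernel_integral[OF w x J N]
    by (simp add: Ad0_def matrix_vector_mul_assoc[symmetric] on_top_mult_vec)
  also have "\<dots> = A_d x *v (Tk a b B w x on_top DTk a b B w x on_top w x)"
    by (simp add: matrix_vector_right_distrib[symmetric] on_top_add Tk_def DTk_def add_ac)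
  finally show ?thesis .
qed

lemma prim_start:
  assumes "\<And>y. y < a \<Longrightarrow> w y = 0" shows "prim w a = 0"
proof -
  have "AE y in lborel. indicator {..a} y *\<^sub>R w y = 0"
    using AE_lborel_singleton[of a] by eventually_elim (use assms in \<open>auto simp: indicator_def\<close>)
  then show ?thesis unfolding prim_def by (rule integral_eq_zero_AE)
qed

lemma prim_end:
  assumes "\<And>y. b < y \<Longrightarrow> w y = 0" shows "prim w b = (LINT y|lborel. w y)"
  unfolding prim_def using assms
  by (intro Bochner_Integration.integral_cong) (auto simp: indicator_def not_le)

lemma Tk_boundary_values:
  assumes w: "w \<in> B2 a b"
  shows "Tk a b B w a = upper (coef a b B w)"
    and "Tk a b B w b = upper (coef a b B w) + (b - a) *\<^sub>R lower (coef a b B w) + moment (\<lambda>y. b - y) w"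
    and "DTk a b B w a = lower (coef a b B w)"
    and "DTk a b B w b = lower (coef a b B w) + moment (\<lambda>y. 1) w"
  using B2D(2)[OF w] prim_start[of a w] prim_start[of a "\<lambda>y. (a - y) *\<^sub>R w y"] prim_end[of b w]
    prim_end[of b "\<lambda>y. (b - y) *\<^sub>R w y"]
  by (auto simp: Tk_def DTk_def moment_def)

lemma matrix_inv_mult_vec:
  fixes M :: "real^'m::finite^'m"
  assumes "invertible M" shows "M *v (matrix_inv M *v y) = y"
proof -
  have "M ** matrix_inv M = mat 1"
    using assms unfolding invertible_def matrix_inv_def by (rule someI2_ex) simp
  then show ?thesis by (simp add: matrix_vector_mul_assoc)
qed

text \<open>The boundary values of \<open>\<T>\<^sub>1 w\<close> are \<open>H c + q\<close>, where \<open>q\<close> contains those of the double primitive,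
  and \<open>c = - (B H)\<^sup>-\<^sup>1 B q\<close> is chosen so that \<open>B\<close> annihilates the sum.\<close>

lemma Tk_boundary_condition:
  fixes B :: "real^('n::finite + 'n + 'n + 'n)^('n + 'n)"
  assumes w: "w \<in> B2 a b" and inv: "invertible (B ** H_mat a b)"
  shows "B *v (Tk a b B w a on_top Tk a b B w b on_top DTk a b B w a on_top DTk a b B w b) = 0"
proof -
  define c where "c = coef a b B w"
  define q where "q = (0::real^'n) on_top moment (\<lambda>y. b - y) w on_top (0::real^'n) on_top moment (\<lambda>y. 1) w"
  have c: "c = - (matrix_inv (B ** H_mat a b) *v (B *v q))"
    by (simp add: c_def coef_def kvec_def q_def)
  have "Tk a b B w a on_top Tk a b B w b on_top DTk a b B w a on_top DTk a b B w b = H_mat a b *v c + q"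
    by (simp add: Tk_boundary_values[OF w] H_mat_mult_vec c_def q_def on_top_add)
  moreover have "B *v (H_mat a b *v c) = - (B *v q)"
    using matrix_inv_mult_vec[OF inv, of "B *v q"]
    by (simp add: c linear_neg[OF matrix_vector_mul_linear] matrix_vector_mul_assoc matrix_mul_assoc)
  ultimately show ?thesis by (simp add: matrix_vector_right_distrib)
qed

text \<open>Integration by parts with \<open>\<eta>(y) = y - x\<close> on \<open>[a,x]\<close> turns the weight \<open>x - y\<close> into a second primitive.\<close>

lemma Tk_eq_prim:
  assumes w: "w \<in> B2 a b" and x: "x \<in> {a..b}"
  shows "Tk a b B w x = upper (coef a b B w) + prim (\<lambda>y. indicator {a..b} y *\<^sub>R DTk a b B w y) x"
proof -
  let ?c = "coef a b B w"
  have iw: "integrable lborel (\<lambda>y. indicator {..x} y *\<^sub>R w y)"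
    using B2_integrable[OF w] by (intro integrable_mult_indicator) auto
  have "prim (\<lambda>y. indicator {a..b} y *\<^sub>R DTk a b B w y) x
      = (LINT y|lborel. (indicator {a..x} y * 1) *\<^sub>R (lower ?c + prim (\<lambda>z. indicator {..x} z *\<^sub>R w z) y))"
  proof (subst prim_def, rule Bochner_Integration.integral_cong)
    fix y
    show "indicator {..x} y *\<^sub>R indicator {a..b} y *\<^sub>R DTk a b B w y
        = (indicator {a..x} y * 1) *\<^sub>R (lower ?c + prim (\<lambda>z. indicator {..x} z *\<^sub>R w z) y)"
    proof (cases "y \<in> {a..x}")
      case True
      then have "prim (\<lambda>z. indicator {..x} z *\<^sub>R w z) y = prim w y"
        unfolding prim_def by (intro Bochner_Integration.integral_cong) (auto simp: indicator_def)
      then show ?thesis using True x by (simp add: DTk_def)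
    qed (auto simp: indicator_def)
  qed simp
  also have "\<dots> = - (a - x) *\<^sub>R lower ?c - (LINT y|lborel. (y - x) *\<^sub>R indicator {..x} y *\<^sub>R w y)"
    using x B2D(2)[OF w] by (intro integral_by_parts_prim iw) (auto intro!: derivative_eq_intros simp: indicator_def)
  also have "(LINT y|lborel. (y - x) *\<^sub>R indicator {..x} y *\<^sub>R w y) = (LINT y|lborel. - (indicator {..x} y *\<^sub>R (x - y) *\<^sub>R w y))"
    by (intro Bochner_Integration.integral_cong) (auto simp: algebra_simps)
  also have "\<dots> = - prim (\<lambda>y. (x - y) *\<^sub>R w y) x"
    by (simp add: prim_def del: scaleR_scaleR)
  finally show ?thesis by (simp add: Tk_def)
qed

section \<open>Moments\<close>

lemma moment_integrable:
  assumes w: "w \<in> B2 a b" and [measurable]: "\<kappa> \<in> borel_measurable borel"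
    and \<kappa>: "\<And>y. y \<in> {a..b} \<Longrightarrow> \<bar>\<kappa> y\<bar> \<le> M"
  shows "integrable lborel (\<lambda>y. \<kappa> y *\<^sub>R w y)"
proof -
  note [measurable] = B2D(1)[OF w]
  have "norm (\<kappa> y *\<^sub>R w y) \<le> norm (M *\<^sub>R w y)" for y
    using \<kappa>[of y] B2D(2)[OF w, of y]
    by (cases "y \<in> {a..b}") (auto intro!: mult_right_mono)
  then have "AE y in lborel. norm (\<kappa> y *\<^sub>R w y) \<le> norm (M *\<^sub>R w y)" by (rule AE_I2)
  moreover have "integrable lborel (\<lambda>y. M *\<^sub>R w y)" using B2_integrable[OF w] by simp
  ultimately show ?thesis by (rule Bochner_Integration.integrable_bound[rotated 2]) measurable
qed

lemma moment_norm_le: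
  assumes w: "w \<in> B2 a b" and [measurable]: "\<kappa> \<in> borel_measurable borel"
    and \<kappa>: "\<And>y. y \<in> {a..b} \<Longrightarrow> \<bar>\<kappa> y\<bar> \<le> M"
  shows "norm (moment \<kappa> w) \<le> M * (LINT y|lborel. norm (w y))"
proof -
  have "norm (\<kappa> y *\<^sub>R w y) \<le> M * norm (w y)" for y
    using \<kappa>[of y] B2D(2)[OF w, of y]
    by (cases "y \<in> {a..b}") (auto intro!: mult_right_mono)
  then have "(LINT y|lborel. norm (\<kappa> y *\<^sub>R w y)) \<le> (LINT y|lborel. M * norm (w y))"
    using B2_integrable[OF w]
    by (intro integral_mono integrable_norm[OF moment_integrable[OF assms]]) auto
  moreover have "norm (moment \<kappa> w) \<le> (LINT y|lborel. norm (\<kappa> y *\<^sub>R w y))"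
    unfolding moment_def by (rule integral_norm_bound)
  ultimately show ?thesis by simp
qed

lemma moment_tendsto:
  assumes w: "\<And>n. w n \<in> B2 a b" "w' \<in> B2 a b" "\<And>y. (\<lambda>n. w n y) \<longlonglongrightarrow> w' y"
    and D: "integrable lborel D" "\<And>n y. norm (w n y) \<le> D y"
    and [measurable]: "\<And>n. \<kappa> n \<in> borel_measurable borel" "\<kappa>' \<in> borel_measurable borel"
    and M: "0 \<le> M" and \<kappa>: "\<And>n y. y \<in> {a..b} \<Longrightarrow> \<bar>\<kappa> n y\<bar> \<le> M" "AE y in lborel. (\<lambda>n. \<kappa> n y) \<longlonglongrightarrow> \<kappa>' y"
  shows "(\<lambda>n. moment (\<kappa> n) (w n)) \<longlonglongrightarrow> moment \<kappa>' w'"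
  unfolding moment_def
proof (rule integral_dominated_convergence[where w = "\<lambda>y. M * D y"])
  note [measurable] = B2D(1)[OF w(1)] B2D(1)[OF w(2)]
  show "(\<lambda>y. \<kappa>' y *\<^sub>R w' y) \<in> borel_measurable lborel" "(\<lambda>y. \<kappa> n y *\<^sub>R w n y) \<in> borel_measurable lborel" for n
    by measurable
  show "AE y in lborel. (\<lambda>n. \<kappa> n y *\<^sub>R w n y) \<longlonglongrightarrow> \<kappa>' y *\<^sub>R w' y"
    using \<kappa>(2) by eventually_elim (intro tendsto_intros w(3))
  show "integrable lborel (\<lambda>y. M * D y)" using D(1) by simp
  have "norm (\<kappa> n y *\<^sub>R w n y) \<le> M * D y" for n y
  proof (cases "y \<in> {a..b}")
    case True
    then show ?thesis using \<kappa>(1)[OF True, of n] D(2)[of n y] M by (auto intro!: mult_mono)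
  next
    case False
    have "0 \<le> D y" using D(2)[of 0 y] norm_ge_zero[of "w 0 y"] by linarith
    then show ?thesis using B2D(2)[OF w(1) False] M by simp
  qed
  then show "AE y in lborel. norm (\<kappa> n y *\<^sub>R w n y) \<le> M * D y" for n by (rule AE_I2)
qed

lemma moment_measurable [measurable]:
  fixes w :: "'a \<Rightarrow> real \<Rightarrow> 'v::euclidean_space"
  assumes [measurable]: "case_prod \<kappa> \<in> borel_measurable (M \<Otimes>\<^sub>M borel)" "case_prod w \<in> borel_measurable (M \<Otimes>\<^sub>M borel)"
  shows "(\<lambda>z. moment (\<kappa> z) (w z)) \<in> borel_measurable M"
proof -
  have [measurable]: "case_prod \<kappa> \<in> borel_measurable (M \<Otimes>\<^sub>M lborel)" "case_prod w \<in> borel_measurable (M \<Otimes>\<^sub>M lborel)"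
    using assms by (simp_all cong: measurable_cong_sets)
  show ?thesis unfolding moment_def by measurable
qed

lemma B2_add:
  assumes "v \<in> B2 a b" "w \<in> B2 a b" shows "(\<lambda>y. v y + w y) \<in> B2 a b"
proof -
  note [measurable] = B2D(1)[OF assms(1)] B2D(1)[OF assms(2)]
  have "integrable lborel (\<lambda>y. 2 * (norm (v y))\<^sup>2 + 2 * (norm (w y))\<^sup>2)"
    using B2D(3)[OF assms(1)] B2D(3)[OF assms(2)] by simp
  then have "integrable lborel (\<lambda>y. (norm (v y + w y))\<^sup>2)"
    by (rule Bochner_Integration.integrable_bound) (auto intro: norm_add_square_le)
  then show ?thesis using assms by (auto simp: B2_def)
qed

lemma B2_scaleR: "w \<in> B2 a b \<Longrightarrow> (\<lambda>y. c *\<^sub>R w y) \<in> B2 a b"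
  by (auto simp: B2_def power_mult_distrib)

lemma B2_zero: "(\<lambda>y. 0) \<in> B2 a b"
  by (simp add: B2_def)

lemma moment_add:
  assumes "v \<in> B2 a b" "w \<in> B2 a b" "\<kappa> \<in> borel_measurable borel" "\<And>y. y \<in> {a..b} \<Longrightarrow> \<bar>\<kappa> y\<bar> \<le> M"
  shows "moment \<kappa> (\<lambda>y. v y + w y) = moment \<kappa> v + moment \<kappa> w"
  unfolding moment_def scaleR_add_right
  by (intro Bochner_Integration.integral_add moment_integrable[OF assms(1,3,4)] moment_integrable[OF assms(2,3,4)])

lemma moment_scaleR: "moment \<kappa> (\<lambda>y. c *\<^sub>R w y) = c *\<^sub>R moment \<kappa> w"
proof -
  have "moment \<kappa> (\<lambda>y. c *\<^sub>R w y) = (LINT y|lborel. c *\<^sub>R \<kappa> y *\<^sub>R w y)"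
    by (simp add: moment_def mult.commute)
  then show ?thesis by (simp add: moment_def del: scaleR_scaleR)
qed

lemma prim_add:
  assumes "integrable lborel v" "integrable lborel w"
  shows "prim (\<lambda>y. v y + w y) x = prim v x + prim w x"
  unfolding prim_def scaleR_add_right
  using assms by (intro Bochner_Integration.integral_add integrable_mult_indicator) auto

lemma prim_bounded_linear:
  assumes L: "bounded_linear L" and w: "integrable lborel w"
  shows "prim (\<lambda>y. L (w y)) x = L (prim w x)"
proof -
  have "prim (\<lambda>y. L (w y)) x = (LINT y|lborel. L (indicator {..x} y *\<^sub>R w y))"
    by (simp add: prim_def linear_scale[OF bounded_linear.linear[OF L]])
  also have "\<dots> = L (prim w x)"
    unfolding prim_def using w by (intro integral_bounded_linear[OF L] integrable_mult_indicator) auto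
  finally show ?thesis .
qed

lemma prim_scaleR: "prim (\<lambda>y. c *\<^sub>R w y) x = c *\<^sub>R prim w x"
proof -
  have "prim (\<lambda>y. c *\<^sub>R w y) x = (LINT y|lborel. c *\<^sub>R indicator {..x} y *\<^sub>R w y)"
    by (simp add: prim_def mult.commute)
  then show ?thesis by (simp add: prim_def del: scaleR_scaleR)
qed

lemma B22_pair_measurable:
  assumes "g \<in> B22 a b" shows "g \<in> borel_measurable (borel \<Otimes>\<^sub>M borel)"
  using B22D(1)[OF assms] by (simp add: borel_prod)

text \<open>Fubini: integrating in \<open>s\<close> commutes with taking moments in \<open>x\<close>.\<close>

lemma
  assumes g: "g \<in> B22 a b" and \<kappa>m: "\<kappa> \<in> borel_measurable borel"
    and \<kappa>: "\<And>y. y \<in> {a..b} \<Longrightarrow> \<bar>\<kappa> y\<bar> \<le> M"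
  shows moment_sections_integrable: "integrable lborel (\<lambda>r. moment \<kappa> (\<lambda>y. g (r, y)))"
    and moment_prim: "moment \<kappa> (\<lambda>y. prim (\<lambda>r. g (r, y)) s) = prim (\<lambda>r. moment \<kappa> (\<lambda>y. g (r, y))) s"
proof -
  note [measurable] = \<kappa>m B22_pair_measurable[OF g]
  have le: "norm (\<kappa> (snd z) *\<^sub>R g z) \<le> norm (M *\<^sub>R g z)" for z
    using \<kappa>[of "snd z"] B22D(2)[OF g, of z]
    by (cases "z \<in> rect a b") (auto intro!: mult_right_mono)
  have "integrable (lborel \<Otimes>\<^sub>M lborel) (\<lambda>z. M *\<^sub>R g z)"
    using B22_integrable[OF g] by (simp add: lborel_prod)
  then have i: "integrable (lborel \<Otimes>\<^sub>M lborel) (\<lambda>z. \<kappa> (snd z) *\<^sub>R g z)"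
    by (rule Bochner_Integration.integrable_bound) (use le in auto)
  show "integrable lborel (\<lambda>r. moment \<kappa> (\<lambda>y. g (r, y)))"
    using lborel_pair.integrable_fst'[OF i] by (simp add: moment_def)
  have [measurable]: "(\<lambda>z. indicator {..s} (fst z) :: real) \<in> borel_measurable (lborel \<Otimes>\<^sub>M lborel)"
    by (intro measurable_compose[OF measurable_fst] borel_measurable_indicator) simp
  from i have i2: "integrable (lborel \<Otimes>\<^sub>M lborel) (\<lambda>(r, y). indicator {..s} r *\<^sub>R \<kappa> y *\<^sub>R g (r, y))"
    by (rule Bochner_Integration.integrable_bound) (auto simp: indicator_def case_prod_beta')
  have "moment \<kappa> (\<lambda>y. prim (\<lambda>r. g (r, y)) s) = (LINT y|lborel. LINT r|lborel. indicator {..s} r *\<^sub>R \<kappa> y *\<^sub>R g (r, y))"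
    unfolding moment_def prim_def
  proof (rule Bochner_Integration.integral_cong)
    fix y
    have "\<kappa> y *\<^sub>R (LINT r|lborel. indicator {..s} r *\<^sub>R g (r, y)) = (LINT r|lborel. \<kappa> y *\<^sub>R indicator {..s} r *\<^sub>R g (r, y))"
      by (simp del: scaleR_scaleR)
    then show "\<kappa> y *\<^sub>R (LINT r|lborel. indicator {..s} r *\<^sub>R g (r, y)) = (LINT r|lborel. indicator {..s} r *\<^sub>R \<kappa> y *\<^sub>R g (r, y))"
      by (simp add: mult.commute)
  qed simp
  also have "\<dots> = (LINT r|lborel. LINT y|lborel. indicator {..s} r *\<^sub>R \<kappa> y *\<^sub>R g (r, y))"
    by (rule lborel_pair.Fubini_integral[OF i2])
  also have "\<dots> = prim (\<lambda>r. moment \<kappa> (\<lambda>y. g (r, y))) s"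
    by (simp add: prim_def moment_def del: scaleR_scaleR)
  finally show "moment \<kappa> (\<lambda>y. prim (\<lambda>r. g (r, y)) s) = prim (\<lambda>r. moment \<kappa> (\<lambda>y. g (r, y))) s" .
qed

section \<open>Properties of \<open>\<T>\<^sub>1\<close>\<close>

abbreviation ker2 :: "real \<Rightarrow> real \<Rightarrow> real" where "ker2 x y \<equiv> indicator {..x} y * (x - y)"

lemma ker_measurable [measurable]:
  "ker2 x \<in> borel_measurable borel" "(indicator {..x} :: real \<Rightarrow> real) \<in> borel_measurable borel"
  "(\<lambda>y. b - y :: real) \<in> borel_measurable borel" "(\<lambda>y. 1 :: real) \<in> borel_measurable borel"
  by measurable

lemma ker_bounds:
  fixes a b y :: real
  assumes "y \<in> {a..b}"
  shows "x \<in> {a..b} \<Longrightarrow> \<bar>ker2 x y\<bar> \<le> 1 + (b - a)" "\<bar>indicator {..x} y :: real\<bar> \<le> 1 + (b - a)"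
    "\<bar>b - y\<bar> \<le> 1 + (b - a)" "\<bar>1 :: real\<bar> \<le> 1 + (b - a)"
  using assms by (auto simp: indicator_def)

lemma prim_eq_moment: "prim w x = moment (indicator {..x}) w"
  by (simp add: prim_def moment_def)

lemma Tk_eq_moments:
  "Tk a b B w x = upper (coef a b B w) + (x - a) *\<^sub>R lower (coef a b B w) + moment (ker2 x) w"
  "DTk a b B w x = lower (coef a b B w) + moment (indicator {..x}) w"
  by (simp_all add: Tk_def DTk_def prim_def moment_def)

lemma kvec_add: "kvec a b B (p + p') (q + q') = kvec a b B p q + kvec a b B p' q'"
  using linear_add[OF bounded_linear.linear[OF bounded_linear_kvec1], of a b B p p']
    linear_add[OF bounded_linear.linear[OF bounded_linear_kvec2], of a b B q q']
    kvec_split[of a b B "p + p'" "q + q'"] kvec_split[of a b B p q] kvec_split[of a b B p' q']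
  by (simp only: add_ac)

lemma kvec_scaleR: "kvec a b B (c *\<^sub>R p) (c *\<^sub>R q) = c *\<^sub>R kvec a b B p q"
  using linear_scale[OF bounded_linear.linear[OF bounded_linear_kvec1], of a b B c p]
    linear_scale[OF bounded_linear.linear[OF bounded_linear_kvec2], of a b B c q]
    kvec_split[of a b B "c *\<^sub>R p" "c *\<^sub>R q"] kvec_split[of a b B p q]
  by (simp only: scaleR_add_right)

lemma coef_split: "coef a b B w = kvec a b B (moment (\<lambda>y. b - y) w) 0 + kvec a b B 0 (moment (\<lambda>y. 1) w)"
  unfolding coef_def by (rule kvec_split)

lemma moment_ker_add:
  assumes "v \<in> B2 a b" "w \<in> B2 a b"
  shows "x \<in> {a..b} \<Longrightarrow> moment (ker2 x) (\<lambda>y. v y + w y) = moment (ker2 x) v + moment (ker2 x) w"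
    "moment (indicator {..x}) (\<lambda>y. v y + w y) = moment (indicator {..x}) v + moment (indicator {..x}) w"
    "moment (\<lambda>y. b - y) (\<lambda>y. v y + w y) = moment (\<lambda>y. b - y) v + moment (\<lambda>y. b - y) w"
    "moment (\<lambda>y. 1) (\<lambda>y. v y + w y) = moment (\<lambda>y. 1) v + moment (\<lambda>y. 1) w"
  by (rule moment_add[OF assms], (rule ker_measurable | (rule ker_bounds; assumption))+)+

lemma coef_add:
  assumes "v \<in> B2 a b" "w \<in> B2 a b"
  shows "coef a b B (\<lambda>y. v y + w y) = coef a b B v + coef a b B w"
  unfolding coef_def moment_ker_add[OF assms] kvec_add ..

lemma coef_scaleR: "coef a b B (\<lambda>y. c *\<^sub>R w y) = c *\<^sub>R coef a b B w"
  unfolding coef_def moment_scaleR kvec_scaleR ..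

lemma upper_lower_linear:
  fixes c d :: "real^('n::finite + 'n)"
  shows "upper (c + d) = upper c + upper d" "lower (c + d) = lower c + lower d"
    "upper (r *\<^sub>R c) = r *\<^sub>R upper c" "lower (r *\<^sub>R c) = r *\<^sub>R lower c"
  by (simp_all add: upper_def lower_def vec_eq_iff)

lemma
  assumes "v \<in> B2 a b" "w \<in> B2 a b" "x \<in> {a..b}"
  shows Tk_add: "Tk a b B (\<lambda>y. v y + w y) x = Tk a b B v x + Tk a b B w x"
    and DTk_add: "DTk a b B (\<lambda>y. v y + w y) x = DTk a b B v x + DTk a b B w x"
  unfolding Tk_eq_moments coef_add[OF assms(1,2)] upper_lower_linear
    moment_ker_add(1)[OF assms] moment_ker_add(2)[OF assms(1,2)]
  by (simp_all add: scaleR_add_right add_ac)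

lemma
  shows Tk_scaleR: "Tk a b B (\<lambda>y. c *\<^sub>R w y) x = c *\<^sub>R Tk a b B w x"
    and DTk_scaleR: "DTk a b B (\<lambda>y. c *\<^sub>R w y) x = c *\<^sub>R DTk a b B w x"
  unfolding Tk_eq_moments coef_scaleR upper_lower_linear moment_scaleR
  by (simp_all add: scaleR_add_right mult.commute)

lemma Tk_bounded:
  fixes B :: "real^('n::finite + 'n + 'n + 'n)^('n + 'n)"
  assumes ab: "a < b"
  obtains K where "K \<ge> 0"
    "\<And>w x. w \<in> B2 a b \<Longrightarrow> x \<in> {a..b} \<Longrightarrow> norm (Tk a b B w x) \<le> K * (LINT y|lborel. norm (w y))"
    "\<And>w x. w \<in> B2 a b \<Longrightarrow> x \<in> {a..b} \<Longrightarrow> norm (DTk a b B w x) \<le> K * (LINT y|lborel. norm (w y))"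
proof -
  obtain K1 where K1: "K1 > 0" "\<And>p. norm (kvec a b B p 0) \<le> norm p * K1"
    using bounded_linear.pos_bounded[OF bounded_linear_kvec1] by blast
  obtain K2 where K2: "K2 > 0" "\<And>p. norm (kvec a b B 0 p) \<le> norm p * K2"
    using bounded_linear.pos_bounded[OF bounded_linear_kvec2] by blast
  obtain U where U: "U > 0" "\<And>z :: real^('n + 'n). norm (upper z) \<le> norm z * U"
    using bounded_linear.pos_bounded[OF bounded_linear_upper] by blast
  obtain L where L: "L > 0" "\<And>z :: real^('n + 'n). norm (lower z) \<le> norm z * L"
    using bounded_linear.pos_bounded[OF bounded_linear_lower] by blast
  define M where "M = 1 + (b - a)"
  define C where "C = M * K1 + M * K2"
  have M: "M \<ge> 1" using ab by (simp add: M_def)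
  have C: "C \<ge> 0" using M K1(1) K2(1) by (simp add: C_def)
  have coef: "norm (coef a b B w) \<le> C * (LINT y|lborel. norm (w y))" if w: "w \<in> B2 a b" for w
  proof -
    have "norm (coef a b B w) \<le> norm (moment (\<lambda>y. b - y) w) * K1 + norm (moment (\<lambda>y. 1) w) * K2"
      unfolding coef_split by (intro order_trans[OF norm_triangle_ineq] add_mono K1 K2)
    also have "\<dots> \<le> (M * (LINT y|lborel. norm (w y))) * K1 + (M * (LINT y|lborel. norm (w y))) * K2"
      unfolding M_def using K1(1) K2(1)
      by (intro add_mono mult_right_mono moment_norm_le[OF w] ker_bounds) auto
    finally show ?thesis by (simp add: C_def algebra_simps)
  qed
  define K where "K = C * U + M * (C * L) + M"
  show thesis
  proof (rule that[of K])
    show "K \<ge> 0" using M C U(1) L(1) by (simp add: K_def)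
    fix w :: "real \<Rightarrow> real^'n" and x assume w: "w \<in> B2 a b" and x: "x \<in> {a..b}"
    define I where "I = (LINT y|lborel. norm (w y))"
    have I: "I \<ge> 0" by (simp add: I_def)
    have up: "norm (upper (coef a b B w)) \<le> C * I * U"
      by (rule order_trans[OF U(2)]) (use coef[OF w] U(1) in \<open>auto simp: I_def intro!: mult_right_mono\<close>)
    have lo: "norm (lower (coef a b B w)) \<le> C * I * L"
      by (rule order_trans[OF L(2)]) (use coef[OF w] L(1) in \<open>auto simp: I_def intro!: mult_right_mono\<close>)
    have xa: "\<bar>x - a\<bar> \<le> M" using x by (auto simp: M_def)
    have m1: "norm (moment (ker2 x) w) \<le> M * I"
      unfolding I_def M_def by (intro moment_norm_le[OF w] ker_bounds x) auto
    have m2: "norm (moment (indicator {..x}) w) \<le> M * I"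
      unfolding I_def M_def by (intro moment_norm_le[OF w] ker_bounds) auto
    have "norm (Tk a b B w x) \<le> norm (upper (coef a b B w)) + \<bar>x - a\<bar> * norm (lower (coef a b B w)) + norm (moment (ker2 x) w)"
      unfolding Tk_eq_moments by (intro order_trans[OF norm_triangle_ineq] add_mono order_refl) simp
    also have "\<dots> \<le> C * I * U + M * (C * I * L) + M * I"
      using up lo m1 xa M by (intro add_mono mult_mono) auto
    also have "\<dots> = K * I" by (simp add: K_def algebra_simps)
    finally show "norm (Tk a b B w x) \<le> K * (LINT y|lborel. norm (w y))" by (simp add: I_def)
    have "norm (DTk a b B w x) \<le> norm (lower (coef a b B w)) + norm (moment (indicator {..x}) w)"
      unfolding Tk_eq_moments by (rule norm_triangle_ineq)
    also have "\<dots> \<le> 1 * (C * I * L) + M * I" using lo m2 by simp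
    also have "\<dots> \<le> C * I * U + M * (C * I * L) + M * I"
    proof -
      have "0 \<le> C * I * U" using C I U(1) by simp
      then show ?thesis using C I L(1) mult_right_mono[OF M, of "C * I * L"] by simp
    qed
    also have "\<dots> = K * I" by (simp add: K_def algebra_simps)
    finally show "norm (DTk a b B w x) \<le> K * (LINT y|lborel. norm (w y))" by (simp add: I_def)
  qed
qed

lemma indicator_atMost_tendsto:
  fixes x :: "nat \<Rightarrow> real"
  assumes x: "x \<longlonglongrightarrow> x'"
  shows "AE y in lborel. (\<lambda>n. indicator {..x n} y :: real) \<longlonglongrightarrow> indicator {..x'} y"
  using AE_lborel_singleton[of x']
proof eventually_elim
  case (elim y)
  have "eventually (\<lambda>n. indicator {..x n} y = (indicator {..x'} y :: real)) sequentially"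
  proof (cases "y < x'")
    case True
    show ?thesis using order_tendstoD(1)[OF x True] by eventually_elim (use True in \<open>auto simp: indicator_def\<close>)
  next
    case False
    then have less: "x' < y" using elim by simp
    show ?thesis using order_tendstoD(2)[OF x less] by eventually_elim (use less in \<open>auto simp: indicator_def\<close>)
  qed
  then show ?case by (rule tendsto_eventually)
qed

lemma prim_tendsto:
  assumes w: "w \<in> B2 a b" and x: "x \<longlonglongrightarrow> x'"
  shows "(\<lambda>n. prim w (x n)) \<longlonglongrightarrow> prim w x'"
  unfolding prim_eq_moment
proof (rule moment_tendsto[OF w w tendsto_const, where D = "\<lambda>y. norm (w y)" and M = 1])
  show "AE y in lborel. (\<lambda>n. indicator {..x n} y :: real) \<longlonglongrightarrow> indicator {..x'} y"
    by (rule indicator_atMost_tendsto[OF x])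
qed (use B2_integrable[OF w] in \<open>auto simp: indicator_def\<close>)

lemma
  fixes B :: "real^('n::finite + 'n + 'n + 'n)^('n + 'n)"
  assumes ab: "a < b"
    and w: "\<And>n. w n \<in> B2 a b" "w' \<in> B2 a b" "\<And>y. (\<lambda>n. w n y) \<longlonglongrightarrow> w' y"
    and D: "integrable lborel D" "\<And>n y. norm (w n y) \<le> D y"
    and x: "\<And>n. x n \<in> {a..b}" "x \<longlonglongrightarrow> x'"
  shows Tk_tendsto: "(\<lambda>n. Tk a b B (w n) (x n)) \<longlonglongrightarrow> Tk a b B w' x'"
    and DTk_tendsto: "(\<lambda>n. DTk a b B (w n) (x n)) \<longlonglongrightarrow> DTk a b B w' x'"
proof -
  have M: "0 \<le> 1 + (b - a)" using ab by simp
  note tends = moment_tendsto[OF w D, where M = "1 + (b - a)"]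
  have m0: "(\<lambda>n. moment (\<lambda>y. 1) (w n)) \<longlonglongrightarrow> moment (\<lambda>y. 1) w'"
    and m1: "(\<lambda>n. moment (\<lambda>y. b - y) (w n)) \<longlonglongrightarrow> moment (\<lambda>y. b - y) w'"
    using ab by (intro tends; (simp add: M ker_bounds)?)+
  have m2: "(\<lambda>n. moment (ker2 (x n)) (w n)) \<longlonglongrightarrow> moment (ker2 x') w'"
  proof (rule tends)
    have "(\<lambda>n. max 0 (x n - y)) \<longlonglongrightarrow> max 0 (x' - y)" for y
      by (intro tendsto_intros x)
    moreover have "max 0 (t - y) = ker2 t y" for t y by (simp add: indicator_def max_def)
    ultimately show "AE y in lborel. (\<lambda>n. ker2 (x n) y) \<longlonglongrightarrow> ker2 x' y" by simp
  qed (use x(1) M in \<open>auto intro!: ker_bounds\<close>)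
  have m3: "(\<lambda>n. moment (indicator {..x n}) (w n)) \<longlonglongrightarrow> moment (indicator {..x'}) w'"
  proof (rule tends)
    show "AE y in lborel. (\<lambda>n. indicator {..x n} y :: real) \<longlonglongrightarrow> indicator {..x'} y"
      by (rule indicator_atMost_tendsto[OF x(2)])
  qed (use ab in \<open>auto simp: indicator_def\<close>)
  have c: "(\<lambda>n. coef a b B (w n)) \<longlonglongrightarrow> coef a b B w'"
    unfolding coef_split
    by (intro tendsto_add bounded_linear.tendsto[OF bounded_linear_kvec1] bounded_linear.tendsto[OF bounded_linear_kvec2] m0 m1)
  show "(\<lambda>n. Tk a b B (w n) (x n)) \<longlonglongrightarrow> Tk a b B w' x'" "(\<lambda>n. DTk a b B (w n) (x n)) \<longlonglongrightarrow> DTk a b B w' x'"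
    unfolding Tk_eq_moments
    by (intro tendsto_intros bounded_linear.tendsto[OF bounded_linear_upper] bounded_linear.tendsto[OF bounded_linear_lower] c m2 m3 x)+
qed

lemma
  assumes "a < b" "w \<in> B2 a b"
  shows Tk_continuous: "continuous_on {a..b} (Tk a b B w)"
    and DTk_continuous: "continuous_on {a..b} (DTk a b B w)"
  unfolding continuous_on_sequentially
  using Tk_tendsto[OF assms(1), of "\<lambda>_. w" w "\<lambda>y. norm (w y)"] DTk_tendsto[OF assms(1), of "\<lambda>_. w" w "\<lambda>y. norm (w y)"]
    assms(2) B2_integrable[OF assms(2)]
  by (auto simp: o_def)

lemma
  assumes ab: "a < b" and w: "w \<in> B2 a b"
  shows wd1_Tk: "wd1 a b 1 (Tk a b B w) (DTk a b B w)"
    and wd1_DTk: "wd1 a b 1 (DTk a b B w) w"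
    and wd1_2_Tk: "wd1 a b 2 (Tk a b B w) w"
proof -
  show D: "wd1 a b 1 (DTk a b B w) w"
    by (rule weak_derivative_prim[OF ab w _ DTk_continuous[OF ab w]]) (simp add: DTk_def)
  have i: "(\<lambda>y. indicator {a..b} y *\<^sub>R DTk a b B w y) \<in> B2 a b"
  proof -
    note [measurable] = B2D(1)[OF w]
    have m: "(\<lambda>y. indicator {a..b} y *\<^sub>R DTk a b B w y) \<in> borel_measurable borel"
      unfolding DTk_def by measurable
    have "integrable lborel (\<lambda>y. indicator {a..b} y *\<^sub>R (norm (DTk a b B w y))\<^sup>2)"
      using DTk_continuous[OF ab w, of B]
      by (intro borel_integrable_compact continuous_intros) auto
    moreover have "indicator {a..b} y *\<^sub>R (norm (DTk a b B w y))\<^sup>2 = (norm (indicator {a..b} y *\<^sub>R DTk a b B w y))\<^sup>2" for y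
      by (simp add: indicator_def)
    ultimately show ?thesis using m by (simp add: B2_def)
  qed
  have "wd1 a b 1 (Tk a b B w) (\<lambda>y. indicator {a..b} y *\<^sub>R DTk a b B w y)"
    by (rule weak_derivative_prim[OF ab i Tk_eq_prim[OF w] Tk_continuous[OF ab w]])
  then show T: "wd1 a b 1 (Tk a b B w) (DTk a b B w)"
    by (rule weak_deriv_AE_right[OF _ continuous_L2[OF DTk_continuous[OF ab w]]]) (auto intro!: AE_I2)
  show "wd1 a b 2 (Tk a b B w) w"
    using weak_deriv_append[OF T D] by (simp add: numeral_2_eq_2)
qed

lemma Tk_in_X_B:
  assumes ab: "a < b" and inv: "invertible (B ** H_mat a b)" and w: "w \<in> B2 a b"
  shows "Tk a b B w \<in> X_B a b B"
proof -
  have "\<exists>g. wd1 a b \<beta> (Tk a b B w) g" if \<beta>: "\<beta> \<le> 2" for \<beta>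
  proof -
    consider "\<beta> = 0" | "\<beta> = 1" | "\<beta> = 2" using \<beta> by linarith
    then show ?thesis
    proof cases
      case 1
      then show ?thesis using weak_deriv_Nil[OF continuous_L2[OF Tk_continuous[OF ab w]]] by auto
    qed (use wd1_Tk[OF ab w] wd1_2_Tk[OF ab w] in blast)+
  qed
  then have "Tk a b B w \<in> H2 a b" using Tk_continuous[OF ab w] by (simp add: H2_def)
  then show ?thesis
    using DTk_continuous[OF ab w] wd1_Tk[OF ab w] Tk_boundary_condition[OF w inv]
    unfolding X_B_def by blast
qed

section \<open>The operators on the rectangle\<close>

text \<open>\<open>\<T>\<^sub>1\<close> and its \<open>x\<close>-derivative, applied to each slice \<open>g(s,\<cdot>)\<close> and cut off outside the rectangle.\<close>

definition TT :: "real \<Rightarrow> real \<Rightarrow> real^('n::finite + 'n + 'n + 'n)^('n + 'n) \<Rightarrow> (real \<times> real \<Rightarrow> real^'n) \<Rightarrow> real \<times> real \<Rightarrow> real^'n"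
  where "TT a b B g z = indicator (rect a b) z *\<^sub>R Tk a b B (\<lambda>y. g (fst z, y)) (snd z)"

definition DD :: "real \<Rightarrow> real \<Rightarrow> real^('n::finite + 'n + 'n + 'n)^('n + 'n) \<Rightarrow> (real \<times> real \<Rightarrow> real^'n) \<Rightarrow> real \<times> real \<Rightarrow> real^'n"
  where "DD a b B g z = indicator (rect a b) z *\<^sub>R DTk a b B (\<lambda>y. g (fst z, y)) (snd z)"

text \<open>The function \<open>W(s,x) = v(x) + \<integral>\<^sub>0\<^sup>s g(r,x) dr\<close>, which is \<open>\<partial>\<^sub>x\<^sup>2\<close> of the state.\<close>

definition WW :: "real \<Rightarrow> real \<Rightarrow> (real \<Rightarrow> 'v::euclidean_space) \<Rightarrow> (real \<times> real \<Rightarrow> 'v) \<Rightarrow> real \<times> real \<Rightarrow> 'v"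
  where "WW a b v g z = indicator (rect a b) z *\<^sub>R (v (snd z) + prim (\<lambda>r. g (r, snd z)) (fst z))"

lemma on_rect:
  assumes "s \<in> {0..1}" "x \<in> {a..b}"
  shows "TT a b B g (s, x) = Tk a b B (\<lambda>y. g (s, y)) x" "DD a b B g (s, x) = DTk a b B (\<lambda>y. g (s, y)) x"
  using assms by (simp_all add: TT_def DD_def)

lemma WW_on_rect:
  assumes "s \<in> {0..1}" "x \<in> {a..b}"
  shows "WW a b v g (s, x) = v x + prim (\<lambda>r. g (r, x)) s"
  using assms by (simp add: WW_def)

lemma rect_indicator_measurable [measurable]:
  "(indicator (rect a b) :: _ \<Rightarrow> real) \<in> borel_measurable (borel \<Otimes>\<^sub>M borel)"
  using rect_borel[of a b] by (intro borel_measurable_indicator) (simp add: borel_prod)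

lemma sections_square_integrable:
  assumes g: "g \<in> B22 a b"
  shows "integrable lborel (\<lambda>s. LINT y|lborel. (norm (g (s, y)))\<^sup>2)"
    "(LINT s|lborel. LINT y|lborel. (norm (g (s, y)))\<^sup>2) = (L2_norm (rect a b) g)\<^sup>2"
    "integrable lborel (\<lambda>x. LINT r|lborel. (norm (g (r, x)))\<^sup>2)"
    "(LINT x|lborel. LINT r|lborel. (norm (g (r, x)))\<^sup>2) = (L2_norm (rect a b) g)\<^sup>2"
proof -
  have i: "integrable (lborel \<Otimes>\<^sub>M lborel) (\<lambda>z. (norm (g z))\<^sup>2)"
    using B22D(3)[OF g] by (simp add: lborel_prod)
  show "integrable lborel (\<lambda>s. LINT y|lborel. (norm (g (s, y)))\<^sup>2)"
    using lborel_pair.integrable_fst'[OF i] .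
  show "(LINT s|lborel. LINT y|lborel. (norm (g (s, y)))\<^sup>2) = (L2_norm (rect a b) g)\<^sup>2"
    unfolding lborel_pair.integral_fst'[OF i] B22_L2_norm[OF g] by (simp add: lborel_prod)
  have i': "integrable (lborel \<Otimes>\<^sub>M lborel) (case_prod (\<lambda>s x. (norm (g (s, x)))\<^sup>2))"
    using i by (simp add: case_prod_beta')
  show "integrable lborel (\<lambda>x. LINT r|lborel. (norm (g (r, x)))\<^sup>2)"
    using lborel_pair.integrable_snd[OF i'] by simp
  show "(LINT x|lborel. LINT r|lborel. (norm (g (r, x)))\<^sup>2) = (L2_norm (rect a b) g)\<^sup>2"
    unfolding lborel_pair.integral_snd[OF i'] B22_L2_norm[OF g] by (simp add: lborel_prod case_prod_beta')
qed

lemma TT_measurable: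
  fixes B :: "real^('n::finite + 'n + 'n + 'n)^('n + 'n)"
  assumes [measurable]: "g \<in> borel_measurable (borel \<Otimes>\<^sub>M borel)"
  shows "TT a b B g \<in> borel_measurable (borel \<Otimes>\<^sub>M borel)" "DD a b B g \<in> borel_measurable (borel \<Otimes>\<^sub>M borel)"
proof -
  have [measurable]: "(upper :: real^('n + 'n) \<Rightarrow> real^'n) \<in> borel_measurable borel"
    "(lower :: real^('n + 'n) \<Rightarrow> real^'n) \<in> borel_measurable borel"
    using borel_measurable_continuous_onI[OF linear_continuous_on[OF bounded_linear_upper]]
      borel_measurable_continuous_onI[OF linear_continuous_on[OF bounded_linear_lower]] by auto
  have [measurable]: "(\<lambda>p. kvec a b B p 0) \<in> borel_measurable borel" "(\<lambda>p. kvec a b B 0 p) \<in> borel_measurable borel"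
    using borel_measurable_continuous_onI[OF linear_continuous_on[OF bounded_linear_kvec1]]
      borel_measurable_continuous_onI[OF linear_continuous_on[OF bounded_linear_kvec2]] by auto
  have [measurable]: "(\<lambda>z. coef a b B (\<lambda>y. g (fst z, y))) \<in> borel_measurable (borel \<Otimes>\<^sub>M borel)"
    unfolding coef_split
    by (intro borel_measurable_add measurable_compose[OF _ \<open>(\<lambda>p. kvec a b B p 0) \<in> borel_measurable borel\<close>]
        measurable_compose[OF _ \<open>(\<lambda>p. kvec a b B 0 p) \<in> borel_measurable borel\<close>]) measurable
  show "TT a b B g \<in> borel_measurable (borel \<Otimes>\<^sub>M borel)" "DD a b B g \<in> borel_measurable (borel \<Otimes>\<^sub>M borel)"
    unfolding TT_def[abs_def] DD_def[abs_def] Tk_def DTk_def by measurable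
qed

lemma TT_bounded:
  fixes B :: "real^('n::finite + 'n + 'n + 'n)^('n + 'n)"
  assumes ab: "a < b"
  obtains K where "K \<ge> 0"
    "\<And>g. g \<in> B22 a b \<Longrightarrow> TT a b B g \<in> B22 a b" "\<And>g. g \<in> B22 a b \<Longrightarrow> DD a b B g \<in> B22 a b"
    "\<And>g. g \<in> B22 a b \<Longrightarrow> L2_norm (rect a b) (TT a b B g) \<le> K * L2_norm (rect a b) g"
    "\<And>g. g \<in> B22 a b \<Longrightarrow> L2_norm (rect a b) (DD a b B g) \<le> K * L2_norm (rect a b) g"
proof -
  obtain K where K: "K \<ge> 0"
    "\<And>w x. w \<in> B2 a b \<Longrightarrow> x \<in> {a..b} \<Longrightarrow> norm (Tk a b B w x) \<le> K * (LINT y|lborel. norm (w y))"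
    "\<And>w x. w \<in> B2 a b \<Longrightarrow> x \<in> {a..b} \<Longrightarrow> norm (DTk a b B w x) \<le> K * (LINT y|lborel. norm (w y))"
    using Tk_bounded[OF ab] by blast
  define P where "P g s = K\<^sup>2 * (b - a) * (LINT y|lborel. (norm (g (s, y)))\<^sup>2)" for g :: "real \<times> real \<Rightarrow> real^'n" and s
  have sq: "(norm u)\<^sup>2 \<le> P g s + 0"
    if g: "g \<in> B22 a b" and u: "norm u \<le> K * (LINT y|lborel. norm (g (s, y)))" for u :: "real^'n" and g s
  proof -
    have "(norm u)\<^sup>2 \<le> (K * (LINT y|lborel. norm (g (s, y))))\<^sup>2" using u by (intro power_mono) auto
    also have "\<dots> = K\<^sup>2 * (LINT y|lborel. norm (g (s, y)))\<^sup>2" by (simp add: power_mult_distrib)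
    also have "\<dots> \<le> K\<^sup>2 * ((b - a) * (LINT y|lborel. (norm (g (s, y)))\<^sup>2))"
      by (intro mult_left_mono B2_Cauchy_Schwarz[OF B22D(4)[OF g] ab]) auto
    finally show ?thesis by (simp add: P_def mult.assoc)
  qed
  have P: "integrable lborel (P g)" "\<And>s. 0 \<le> P g s" "(LINT s|lborel. P g s) = K\<^sup>2 * (b - a) * (L2_norm (rect a b) g)\<^sup>2"
    if g: "g \<in> B22 a b" for g
    using sections_square_integrable(1,2)[OF g] ab unfolding P_def by simp_all
  have fin: "L2_norm (rect a b) h \<le> (K * (b - a)) * L2_norm (rect a b) g"
    if g: "g \<in> B22 a b" and "(L2_norm (rect a b) h)\<^sup>2 \<le> (b - a) * (LINT s|lborel. P g s) + integral\<^sup>L lborel (\<lambda>_::real. 0 :: real)" for g h :: "real \<times> real \<Rightarrow> real^'n"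
  proof (rule power2_le_imp_le)
    show "(L2_norm (rect a b) h)\<^sup>2 \<le> (K * (b - a) * L2_norm (rect a b) g)\<^sup>2"
      using that(2) P(3)[OF g] by (simp add: power2_eq_square mult_ac)
  qed (use K(1) ab in \<open>auto intro!: mult_nonneg_nonneg L2_norm_nonneg\<close>)
  have TT: "TT a b B g \<in> B22 a b" "L2_norm (rect a b) (TT a b B g) \<le> (K * (b - a)) * L2_norm (rect a b) g"
    if g: "g \<in> B22 a b" for g
  proof -
    note * = TT_measurable(1)[OF B22_pair_measurable[OF g]]
    have le: "(norm (TT a b B g (s, x)))\<^sup>2 \<le> P g s + 0" if "s \<in> {0..1}" "x \<in> {a..b}" for s x
      unfolding on_rect[OF that] by (rule sq[OF g K(2)[OF B22D(4)[OF g] that(2)]])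
    have off: "TT a b B g z = 0" if "z \<notin> rect a b" for z using that by (simp add: TT_def)
    show "TT a b B g \<in> B22 a b"
      by (rule B22I(1)[OF * off less_imp_le[OF ab] le P(1,2)[OF g]]; simp)
    have "(L2_norm (rect a b) (TT a b B g))\<^sup>2 \<le> (b - a) * (LINT s|lborel. P g s) + integral\<^sup>L lborel (\<lambda>_::real. 0 :: real)"
      by (rule B22I(2)[where P = "P g" and Q = "\<lambda>_. 0", OF * off less_imp_le[OF ab] le P(1,2)[OF g]]; simp)
    then show "L2_norm (rect a b) (TT a b B g) \<le> (K * (b - a)) * L2_norm (rect a b) g"
      by (rule fin[OF g])
  qed
  have DD: "DD a b B g \<in> B22 a b" "L2_norm (rect a b) (DD a b B g) \<le> (K * (b - a)) * L2_norm (rect a b) g"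
    if g: "g \<in> B22 a b" for g
  proof -
    note * = TT_measurable(2)[OF B22_pair_measurable[OF g]]
    have le: "(norm (DD a b B g (s, x)))\<^sup>2 \<le> P g s + 0" if "s \<in> {0..1}" "x \<in> {a..b}" for s x
      unfolding on_rect[OF that] by (rule sq[OF g K(3)[OF B22D(4)[OF g] that(2)]])
    have off: "DD a b B g z = 0" if "z \<notin> rect a b" for z using that by (simp add: DD_def)
    show "DD a b B g \<in> B22 a b"
      by (rule B22I(1)[OF * off less_imp_le[OF ab] le P(1,2)[OF g]]; simp)
    have "(L2_norm (rect a b) (DD a b B g))\<^sup>2 \<le> (b - a) * (LINT s|lborel. P g s) + integral\<^sup>L lborel (\<lambda>_::real. 0 :: real)"
      by (rule B22I(2)[where P = "P g" and Q = "\<lambda>_. 0", OF * off less_imp_le[OF ab] le P(1,2)[OF g]]; simp)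
    then show "L2_norm (rect a b) (DD a b B g) \<le> (K * (b - a)) * L2_norm (rect a b) g"
      by (rule fin[OF g])
  qed
  show thesis using that[of "K * (b - a)"] TT DD K(1) ab by simp
qed

lemma WW_bounded:
  assumes v: "v \<in> B2 a b" and g: "g \<in> B22 a b" and ab: "a < b"
  shows "WW a b v g \<in> B22 a b"
    and "(L2_norm (rect a b) (WW a b v g))\<^sup>2 \<le> 2 * (L2_norm {a..b} v)\<^sup>2 + 2 * (L2_norm (rect a b) g)\<^sup>2"
proof -
  note [measurable] = B2D(1)[OF v] B22_pair_measurable[OF g]
  have m: "WW a b v g \<in> borel_measurable (borel \<Otimes>\<^sub>M borel)"
    unfolding WW_def[abs_def] by measurable
  define Q where "Q x = 2 * (norm (v x))\<^sup>2 + 2 * (LINT r|lborel. (norm (g (r, x)))\<^sup>2)" for x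
  have le: "(norm (WW a b v g (s, x)))\<^sup>2 \<le> 0 + Q x" if "s \<in> {0..1}" "x \<in> {a..b}" for s x
  proof -
    have "norm (prim (\<lambda>r. g (r, x)) s) \<le> (LINT r|lborel. norm (g (r, x)))"
      by (rule prim_norm_le[OF B2_integrable[OF B22D(5)[OF g]]])
    then have "(norm (prim (\<lambda>r. g (r, x)) s))\<^sup>2 \<le> (LINT r|lborel. norm (g (r, x)))\<^sup>2" by (intro power_mono) auto
    also have "\<dots> \<le> (1 - 0) * (LINT r|lborel. (norm (g (r, x)))\<^sup>2)"
      by (rule B2_Cauchy_Schwarz[OF B22D(5)[OF g]]) simp
    finally show ?thesis
      unfolding WW_on_rect[OF that] Q_def using norm_add_square_le[of "v x" "prim (\<lambda>r. g (r, x)) s"] by simp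
  qed
  have Q: "integrable lborel Q" "\<And>x. 0 \<le> Q x"
    "(LINT x|lborel. Q x) = 2 * (L2_norm {a..b} v)\<^sup>2 + 2 * (L2_norm (rect a b) g)\<^sup>2"
    unfolding Q_def using sections_square_integrable(3,4)[OF g] B2D(3)[OF v] by (simp_all add: B2_L2_norm[OF v])
  have P: "integrable lborel (\<lambda>_::real. 0 :: real)" by simp
  have off: "WW a b v g z = 0" if "z \<notin> rect a b" for z using that by (simp add: WW_def)
  show "WW a b v g \<in> B22 a b"
    "(L2_norm (rect a b) (WW a b v g))\<^sup>2 \<le> 2 * (L2_norm {a..b} v)\<^sup>2 + 2 * (L2_norm (rect a b) g)\<^sup>2"
    using B22I[OF m off less_imp_le[OF ab] le P _ Q(1,2)] by (simp_all add: Q(3))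
qed

lemma wd2_DD:
  assumes ab: "a < b" and g: "g \<in> B22 a b" shows "wd2 a b 0 1 (DD a b B g) g"
proof -
  obtain "DD a b B g \<in> B22 a b" using TT_bounded[OF ab, of B] g by metis
  then show ?thesis
    by (rule weak_derivative_x[OF ab _ g, of _ "\<lambda>s. lower (coef a b B (\<lambda>y. g (s, y)))"])
       (simp only: on_rect DTk_def)
qed

lemma wd2_TT:
  assumes ab: "a < b" and g: "g \<in> B22 a b" shows "wd2 a b 0 1 (TT a b B g) (DD a b B g)"
proof -
  have m: "TT a b B g \<in> B22 a b" "DD a b B g \<in> B22 a b" using TT_bounded[OF ab, of B] g by metis+
  show ?thesis
  proof (rule weak_derivative_x[OF ab m, of "\<lambda>s. upper (coef a b B (\<lambda>y. g (s, y)))"])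
    fix s x assume s: "s \<in> {0..1::real}" and x: "x \<in> {a..b}"
    have "(\<lambda>y. indicator {a..b} y *\<^sub>R DTk a b B (\<lambda>y. g (s, y)) y) = (\<lambda>y. DD a b B g (s, y))"
      using s by (auto simp: DD_def indicator_def)
    then show "TT a b B g (s, x) = upper (coef a b B (\<lambda>y. g (s, y))) + prim (\<lambda>y. DD a b B g (s, y)) x"
      using Tk_eq_prim[OF B22D(4)[OF g, of s] x, where B = B] by (simp only: on_rect[OF s x])
  qed
qed

lemma Tk_zero: "Tk a b B (\<lambda>y. 0) x = 0" "DTk a b B (\<lambda>y. 0) x = 0"
  using Tk_scaleR[of a b B 0 "\<lambda>y. 0" x] DTk_scaleR[of a b B 0 "\<lambda>y. 0" x] by simp_all

lemma moment_ker_prim: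
  assumes g: "g \<in> B22 a b"
  shows "x \<in> {a..b} \<Longrightarrow> moment (ker2 x) (\<lambda>y. prim (\<lambda>r. g (r, y)) s) = prim (\<lambda>r. moment (ker2 x) (\<lambda>y. g (r, y))) s"
    "moment (indicator {..x}) (\<lambda>y. prim (\<lambda>r. g (r, y)) s) = prim (\<lambda>r. moment (indicator {..x}) (\<lambda>y. g (r, y))) s"
    "moment (\<lambda>y. b - y) (\<lambda>y. prim (\<lambda>r. g (r, y)) s) = prim (\<lambda>r. moment (\<lambda>y. b - y) (\<lambda>y. g (r, y))) s"
    "moment (\<lambda>y. 1) (\<lambda>y. prim (\<lambda>r. g (r, y)) s) = prim (\<lambda>r. moment (\<lambda>y. 1) (\<lambda>y. g (r, y))) s"
    "x \<in> {a..b} \<Longrightarrow> integrable lborel (\<lambda>r. moment (ker2 x) (\<lambda>y. g (r, y)))"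
    "integrable lborel (\<lambda>r. moment (indicator {..x}) (\<lambda>y. g (r, y)))"
    "integrable lborel (\<lambda>r. moment (\<lambda>y. b - y) (\<lambda>y. g (r, y)))"
    "integrable lborel (\<lambda>r. moment (\<lambda>y. 1) (\<lambda>y. g (r, y)))"
  by ((rule moment_prim[OF g] | rule moment_sections_integrable[OF g]),
      (rule ker_measurable | (rule ker_bounds; assumption))+)+

lemma coef_prim:
  fixes B :: "real^('n::finite + 'n + 'n + 'n)^('n + 'n)"
  assumes g: "g \<in> B22 a b"
  shows "coef a b B (\<lambda>y. prim (\<lambda>r. g (r, y)) s) = prim (\<lambda>r. coef a b B (\<lambda>y. g (r, y))) s"
    and "integrable lborel (\<lambda>r. coef a b B (\<lambda>y. g (r, y)))"
proof -
  note k1 = bounded_linear_kvec1[of a b B] and k2 = bounded_linear_kvec2[of a b B]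
  note m = moment_ker_prim[OF g]
  show "integrable lborel (\<lambda>r. coef a b B (\<lambda>y. g (r, y)))"
    unfolding coef_split
    by (intro Bochner_Integration.integrable_add integrable_bounded_linear[OF k1] integrable_bounded_linear[OF k2] m)
  show "coef a b B (\<lambda>y. prim (\<lambda>r. g (r, y)) s) = prim (\<lambda>r. coef a b B (\<lambda>y. g (r, y))) s"
    unfolding coef_split m(3,4)
      prim_add[OF integrable_bounded_linear[OF k1 m(7)] integrable_bounded_linear[OF k2 m(8)]]
      prim_bounded_linear[OF k1 m(7)] prim_bounded_linear[OF k2 m(8)] ..
qed

text \<open>\<open>\<T>\<^sub>1\<close> commutes with integration in \<open>s\<close>; hence \<open>\<T>\<^sub>1 v + \<T>\<^sub>2 \<psi> = \<T>\<^sub>1 W\<close> with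
  \<open>W(s,x) = v(x) + \<integral>\<^sub>0\<^sup>s \<psi>(r,x) dr\<close>, which reduces derivatives in \<open>x\<close> to those of \<open>\<T>\<^sub>1\<close>.\<close>

lemma
  fixes B :: "real^('n::finite + 'n + 'n + 'n)^('n + 'n)"
  assumes g: "g \<in> B22 a b" and x: "x \<in> {a..b}"
  shows Tk_prim: "Tk a b B (\<lambda>y. prim (\<lambda>r. g (r, y)) s) x = prim (\<lambda>r. Tk a b B (\<lambda>y. g (r, y)) x) s"
    and DTk_prim: "DTk a b B (\<lambda>y. prim (\<lambda>r. g (r, y)) s) x = prim (\<lambda>r. DTk a b B (\<lambda>y. g (r, y)) x) s"
    and Tk_sections_integrable: "integrable lborel (\<lambda>r. Tk a b B (\<lambda>y. g (r, y)) x)"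
    and DTk_sections_integrable: "integrable lborel (\<lambda>r. DTk a b B (\<lambda>y. g (r, y)) x)"
proof -
  note m = moment_ker_prim[OF g] and c = coef_prim[OF g, of B]
  have J: "bounded_linear (\<lambda>z :: real^('n + 'n). upper z + (x - a) *\<^sub>R lower z)"
    by (intro bounded_linear_add bounded_linear_upper bounded_linear_const_scaleR bounded_linear_lower)
  note L = bounded_linear_lower[where 'p = 'n and 'q = 'n]
  show "integrable lborel (\<lambda>r. Tk a b B (\<lambda>y. g (r, y)) x)" "integrable lborel (\<lambda>r. DTk a b B (\<lambda>y. g (r, y)) x)"
    unfolding Tk_eq_moments
    by (intro Bochner_Integration.integrable_add integrable_bounded_linear[OF J c(2)] m(5)[OF x] m(6) integrable_bounded_linear[OF L c(2)])+
  show "Tk a b B (\<lambda>y. prim (\<lambda>r. g (r, y)) s) x = prim (\<lambda>r. Tk a b B (\<lambda>y. g (r, y)) x) s"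
    unfolding Tk_eq_moments c(1) m(1)[OF x] prim_add[OF integrable_bounded_linear[OF J c(2)] m(5)[OF x]]
      prim_bounded_linear[OF J c(2)] ..
  show "DTk a b B (\<lambda>y. prim (\<lambda>r. g (r, y)) s) x = prim (\<lambda>r. DTk a b B (\<lambda>y. g (r, y)) x) s"
    unfolding Tk_eq_moments c(1) m(2) prim_add[OF integrable_bounded_linear[OF L c(2)] m(6)]
      prim_bounded_linear[OF L c(2)] ..
qed

lemma WW_section:
  assumes "s \<in> {0..1}" "v \<in> B2 a b" "g \<in> B22 a b"
  shows "(\<lambda>y. WW a b v g (s, y)) = (\<lambda>y. v y + prim (\<lambda>r. g (r, y)) s)"
proof
  fix y
  show "WW a b v g (s, y) = v y + prim (\<lambda>r. g (r, y)) s"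
  proof (cases "y \<in> {a..b}")
    case True then show ?thesis using WW_on_rect[OF assms(1) True] by simp
  next
    case False
    then have "v y = 0" "g (r, y) = 0" for r using B2D(2)[OF assms(2)] B22D(2)[OF assms(3)] by auto
    with False show ?thesis by (simp add: WW_def prim_def)
  qed
qed

lemma
  fixes B :: "real^('n::finite + 'n + 'n + 'n)^('n + 'n)"
  assumes v: "v \<in> B2 a b" and g: "g \<in> B22 a b" and ab: "a < b" and s: "s \<in> {0..1}" and x: "x \<in> {a..b}"
  shows Tk_WW: "Tk a b B (\<lambda>y. WW a b v g (s, y)) x = Tk a b B v x + prim (\<lambda>r. Tk a b B (\<lambda>y. g (r, y)) x) s"
    and DTk_WW: "DTk a b B (\<lambda>y. WW a b v g (s, y)) x = DTk a b B v x + prim (\<lambda>r. DTk a b B (\<lambda>y. g (r, y)) x) s"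
proof -
  have p: "(\<lambda>y. prim (\<lambda>r. g (r, y)) s) \<in> B2 a b"
    using B22D(4)[OF WW_bounded(1)[OF B2_zero g ab], of s] unfolding WW_section[OF s B2_zero g] by simp
  show "Tk a b B (\<lambda>y. WW a b v g (s, y)) x = Tk a b B v x + prim (\<lambda>r. Tk a b B (\<lambda>y. g (r, y)) x) s"
    "DTk a b B (\<lambda>y. WW a b v g (s, y)) x = DTk a b B v x + prim (\<lambda>r. DTk a b B (\<lambda>y. g (r, y)) x) s"
    unfolding WW_section[OF s v g]
    by (simp_all add: Tk_add[OF v p x] DTk_add[OF v p x] Tk_prim[OF g x] DTk_prim[OF g x])
qed

lemma wd2_s_TT_WW:
  fixes B :: "real^('n::finite + 'n + 'n + 'n)^('n + 'n)"
  assumes v: "v \<in> B2 a b" and g: "g \<in> B22 a b" and ab: "a < b"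
  shows "wd2 a b 1 0 (TT a b B (WW a b v g)) (TT a b B g)"
proof -
  have m: "TT a b B (WW a b v g) \<in> B22 a b" "TT a b B g \<in> B22 a b"
    using TT_bounded[OF ab, of B] g WW_bounded(1)[OF v g ab] by metis+
  show ?thesis
  proof (rule weak_derivative_s[OF m, of "Tk a b B v"])
    fix s x assume s: "s \<in> {0..1::real}" and x: "x \<in> {a..b}"
    have "Tk a b B (\<lambda>y. g (r, y)) x = TT a b B g (r, x)" for r
    proof (cases "r \<in> {0..1}")
      case False
      then have "g (r, y) = 0" for y using B22D(2)[OF g] by auto
      with False show ?thesis by (simp add: TT_def Tk_zero)
    next
      case True
      show ?thesis by (rule on_rect(1)[OF True x, symmetric])
    qed
    then show "TT a b B (WW a b v g) (s, x) = Tk a b B v x + prim (\<lambda>r. TT a b B g (r, x)) s"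
      using Tk_WW[OF v g ab s x, of B] by (simp add: on_rect[OF s x])
  qed
qed

text \<open>Dominated convergence: \<open>W(s,y)\<close> is continuous in \<open>s\<close> for every \<open>y\<close> and bounded by
  \<open>\<bar>v(y)\<bar> + \<integral> \<bar>g(r,y)\<bar> dr\<close>, uniformly in \<open>s\<close>.\<close>

lemma TT_WW_continuous:
  fixes B :: "real^('n::finite + 'n + 'n + 'n)^('n + 'n)"
  assumes v: "v \<in> B2 a b" and g: "g \<in> B22 a b" and ab: "a < b"
  shows "continuous_on (rect a b) (TT a b B (WW a b v g))"
  unfolding continuous_on_sequentially
proof (intro ballI allI impI)
  fix z u assume z: "z \<in> rect a b" and u: "(\<forall>n. u n \<in> rect a b) \<and> u \<longlonglongrightarrow> z"
  define s x where "s n = fst (u n)" and "x n = snd (u n)" for n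
  obtain s' x' where z': "z = (s', x')" by (cases z)
  have sx: "\<And>n. s n \<in> {0..1}" "\<And>n. x n \<in> {a..b}" "s \<longlonglongrightarrow> s'" "x \<longlonglongrightarrow> x'"
    using u tendsto_fst[of u z] tendsto_snd[of u z] by (auto simp: s_def[abs_def] x_def[abs_def] z' mem_Times_iff)
  have z'': "s' \<in> {0..1}" "x' \<in> {a..b}" using z by (auto simp: z')
  note W = WW_bounded(1)[OF v g ab]
  have iD: "integrable lborel (\<lambda>y. LINT r|lborel. norm (g (r, y)))"
  proof -
    have "integrable (lborel \<Otimes>\<^sub>M lborel) (case_prod (\<lambda>r y. norm (g (r, y))))"
      using B22_integrable[OF g] by (simp add: lborel_prod case_prod_beta')
    then show ?thesis using lborel_pair.integrable_snd by blast
  qed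
  have "(\<lambda>n. Tk a b B (\<lambda>y. WW a b v g (s n, y)) (x n)) \<longlonglongrightarrow> Tk a b B (\<lambda>y. WW a b v g (s', y)) x'"
  proof (rule Tk_tendsto[OF ab B22D(4)[OF W] B22D(4)[OF W], where D = "\<lambda>y. norm (v y) + (LINT r|lborel. norm (g (r, y)))"])
    show "(\<lambda>n. WW a b v g (s n, y)) \<longlonglongrightarrow> WW a b v g (s', y)" for y
      unfolding WW_section[OF sx(1) v g, THEN fun_cong] WW_section[OF z''(1) v g, THEN fun_cong]
      by (intro tendsto_add tendsto_const prim_tendsto[OF B22D(5)[OF g]] sx)
    show "integrable lborel (\<lambda>y. norm (v y) + (LINT r|lborel. norm (g (r, y))))"
      using B2_integrable[OF v] iD by simp
    show "norm (WW a b v g (s n, y)) \<le> norm (v y) + (LINT r|lborel. norm (g (r, y)))" for n y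
      unfolding WW_section[OF sx(1) v g, THEN fun_cong]
      by (intro order_trans[OF norm_triangle_ineq] add_mono order_refl prim_norm_le B2_integrable[OF B22D(5)[OF g]])
  qed (use sx in auto)
  moreover have "(TT a b B (WW a b v g) \<circ> u) n = Tk a b B (\<lambda>y. WW a b v g (s n, y)) (x n)" for n
    using on_rect(1)[OF sx(1)[of n] sx(2)[of n]] by (simp add: s_def x_def o_def)
  ultimately show "(TT a b B (WW a b v g) \<circ> u) \<longlonglongrightarrow> TT a b B (WW a b v g) z"
    by (simp add: z' on_rect[OF z''] o_def)
qed

section \<open>Passing from arbitrary to Borel representatives\<close>

text \<open>By completeness of the Lebesgue measure. It is applied to slices of Lebesgue measurable functions
  of two variables, which are only known to agree almost everywhere with Borel functions.\<close>

lemma lebesgue_measurable_AE: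
  fixes f g :: "real \<Rightarrow> 'v::euclidean_space"
  assumes g: "g \<in> borel_measurable borel" and eq: "AE x in lborel. f x = g x"
  shows "f \<in> borel_measurable lebesgue"
proof (rule measurableI)
  fix A :: "'v set" assume A: "A \<in> sets borel"
  obtain N where N: "N \<in> null_sets lborel" "\<And>x. x \<notin> N \<Longrightarrow> f x = g x"
    using AE_lborel_null_cover[OF eq] by blast
  have N': "N \<in> null_sets lebesgue" using N(1) by (rule null_sets_completionI)
  have "g -` A \<in> sets lborel" using measurable_sets[OF g A] by simp
  then have "g -` A \<in> sets lebesgue" by (rule sets_completionI_sets)
  moreover have "f -` A \<inter> N \<in> sets lebesgue"
    using completion.complete[of "f -` A \<inter> N" N] N' by auto
  moreover have "N \<in> sets lebesgue" using N' by auto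
  moreover have "f -` A \<inter> space lebesgue = (g -` A - N) \<union> (f -` A \<inter> N)" using N(2) by auto
  ultimately show "f -` A \<inter> space lebesgue \<in> sets lebesgue" by (simp only: sets.Un sets.Diff)
qed auto

lemma lebesgue_integral_eq_lborel_AE:
  fixes f g :: "real \<Rightarrow> 'v::euclidean_space"
  assumes g: "g \<in> borel_measurable borel" and eq: "AE x in lborel. f x = g x"
  shows "(LINT x|lebesgue. f x) = (LINT x|lborel. g x)"
proof -
  have "(LINT x|lebesgue. f x) = (LINT x|lebesgue. g x)"
    using g by (intro integral_cong_AE lebesgue_measurable_AE[OF g eq] measurable_completion AE_completion[OF eq]) simp
  then show ?thesis using g by (simp add: integral_completion)
qed

lemma set_integral_cong_AE_borel:
  fixes k :: "real \<Rightarrow> 'v::euclidean_space \<Rightarrow> 'u::euclidean_space"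
  assumes "(\<lambda>\<theta>. k \<theta> (w' \<theta>)) \<in> borel_measurable borel" "A \<in> sets borel"
    and "AE y in lborel. y \<in> A \<longrightarrow> w y = w' y"
  shows "(LINT \<theta>:A|lebesgue. k \<theta> (w \<theta>)) = (LINT \<theta>:A|lebesgue. k \<theta> (w' \<theta>))"
proof -
  have m: "(\<lambda>\<theta>. indicator A \<theta> *\<^sub>R k \<theta> (w' \<theta>)) \<in> borel_measurable borel"
    using assms(1,2) by (intro borel_measurable_scaleR borel_measurable_indicator) auto
  have "AE \<theta> in lborel. indicator A \<theta> *\<^sub>R k \<theta> (w \<theta>) = indicator A \<theta> *\<^sub>R k \<theta> (w' \<theta>)"
    using assms(3) by eventually_elim (auto simp: indicator_def)
  then show ?thesis
    unfolding set_lebesgue_integral_def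
    using lebesgue_integral_eq_lborel_AE[OF m] m by (simp add: integral_completion)
qed

lemma T1_op_cong_rep:
  fixes B :: "real^('n::finite + 'n + 'n + 'n)^('n + 'n)"
  assumes w: "w' \<in> B2 a b" and x: "x \<in> {a..b}" and eq: "AE y in lborel. y \<in> {a..b} \<longrightarrow> w y = w' y"
  shows "T1_op a b B w x = Tk a b B w' x"
    and "w x = w' x \<Longrightarrow> A11d_op a b B A_d w x = A11d_op a b B A_d w' x"
proof -
  note [measurable] = B2D(1)[OF w]
  have eqs: "AE y in lborel. y \<in> {a..x} \<longrightarrow> w y = w' y" "AE y in lborel. y \<in> {x..b} \<longrightarrow> w y = w' y"
    using eq x by (auto elim!: eventually_mono)
  have [measurable]: "(\<lambda>z. upper z :: real^'n) \<in> borel_measurable borel" "(\<lambda>z. lower z :: real^'n) \<in> borel_measurable borel"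
    by (intro borel_measurable_continuous_onI linear_continuous_on bounded_linear_upper bounded_linear_lower)+
  have k[measurable]: "(\<lambda>\<theta>. kvec a b B ((b - \<theta>) *\<^sub>R w' \<theta>) (w' \<theta>)) \<in> borel_measurable borel"
    using borel_measurable_integrable[OF kvec_integrable[OF w, of B]] by simp
  have T2: "(\<lambda>\<theta>. T2_ker a b B x \<theta> *v w' \<theta>) \<in> borel_measurable borel"
    unfolding T2_ker_mult_vec
    by (intro borel_measurable_add borel_measurable_scaleR measurable_compose[OF k]) measurable
  have T1: "(\<lambda>\<theta>. T1_ker a b B x \<theta> *v w' \<theta>) \<in> borel_measurable borel"
    unfolding T1_ker_mult_vec by (intro borel_measurable_add T2) measurable
  show "T1_op a b B w x = Tk a b B w' x"
    unfolding T1_op_eq_Tk[OF w x, symmetric] T1_op_def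
    by (intro arg_cong2[where f = "(+)"] set_integral_cong_AE_borel[where k = "\<lambda>\<theta> y. T1_ker a b B x \<theta> *v y"]
        set_integral_cong_AE_borel[where k = "\<lambda>\<theta> y. T2_ker a b B x \<theta> *v y"] T1 T2 eqs) auto
  have D2: "(\<lambda>\<theta>. vector_derivative (\<lambda>y. T2_ker a b B y \<theta>) (at x) *v w' \<theta>) \<in> borel_measurable borel"
    unfolding T2_ker_deriv by (intro measurable_compose[OF k]) measurable
  have D1: "(\<lambda>\<theta>. vector_derivative (\<lambda>y. T1_ker a b B y \<theta>) (at x) *v w' \<theta>) \<in> borel_measurable borel"
    unfolding T1_ker_deriv by (intro borel_measurable_add measurable_compose[OF k]) measurable
  have J: "bounded_linear (\<lambda>p. A_d x *v (fst p on_top snd p on_top (0 :: real^'n)))"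
    by (intro bounded_linear_compose[OF matrix_vector_mul_bounded_linear] bounded_linear_on_top bounded_linear_zero
        bounded_linear_fst bounded_linear_snd)
  have Jm: "(\<lambda>\<theta>. A_d x *v (f \<theta> on_top g \<theta> on_top (0 :: real^'n))) \<in> borel_measurable borel"
    if "f \<in> borel_measurable borel" "g \<in> borel_measurable borel" for f g :: "real \<Rightarrow> real^'n"
    using measurable_compose[OF borel_measurable_Pair[OF that] borel_measurable_continuous_onI[OF linear_continuous_on[OF J]]]
    by simp
  have m: "(\<lambda>\<theta>. Ad_ker A_d (T1_ker a b B) x \<theta> *v w' \<theta>) \<in> borel_measurable borel"
    "(\<lambda>\<theta>. Ad_ker A_d (T2_ker a b B) x \<theta> *v w' \<theta>) \<in> borel_measurable borel"
    unfolding Ad_ker_def matrix_vector_mul_assoc[symmetric] on_top_mult_vec matrix_vector_mult_0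
    by (intro Jm T1 D1 T2 D2)+
  show "A11d_op a b B A_d w x = A11d_op a b B A_d w' x" if "w x = w' x"
    unfolding A11d_op_def that
    by (intro arg_cong2[where f = "(+)"] refl set_integral_cong_AE_borel[where k = "\<lambda>\<theta> y. Ad_ker A_d (T1_ker a b B) x \<theta> *v y"]
        set_integral_cong_AE_borel[where k = "\<lambda>\<theta> y. Ad_ker A_d (T2_ker a b B) x \<theta> *v y"] m eqs) auto
qed

text \<open>\<open>rep a b v \<psi> v' g\<close>: the Borel functions \<open>v'\<close> and \<open>g\<close> represent the \<open>L\<^sub>2\<close> functions \<open>v\<close> and \<open>\<psi>\<close>.\<close>

definition rep :: "real \<Rightarrow> real \<Rightarrow> (real \<Rightarrow> 'v::euclidean_space) \<Rightarrow> (real \<times> real \<Rightarrow> 'v) \<Rightarrow> (real \<Rightarrow> 'v) \<Rightarrow> (real \<times> real \<Rightarrow> 'v) \<Rightarrow> bool"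
  where "rep a b v \<psi> v' g \<longleftrightarrow> v \<in> L2 {a..b} \<and> \<psi> \<in> L2 (rect a b) \<and> v' \<in> B2 a b \<and> g \<in> B22 a b \<and>
    (AE x in lborel. x \<in> {a..b} \<longrightarrow> v x = v' x) \<and> (AE z in lborel. z \<in> rect a b \<longrightarrow> \<psi> z = g z)"

lemma repD:
  assumes "rep a b v \<psi> v' g"
  shows "v \<in> L2 {a..b}" "\<psi> \<in> L2 (rect a b)" "v' \<in> B2 a b" "g \<in> B22 a b"
    "AE x in lborel. x \<in> {a..b} \<longrightarrow> v x = v' x" "AE z in lborel. z \<in> rect a b \<longrightarrow> \<psi> z = g z"
  using assms unfolding rep_def by blast+

lemma ex_rep:
  assumes "v \<in> L2 {a..b}" "\<psi> \<in> L2 (rect a b)"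
  obtains v' g where "rep a b v \<psi> v' g"
proof -
  obtain v' where v': "v' \<in> B2 a b" "AE x in lborel. x \<in> {a..b} \<longrightarrow> v x = v' x"
    using ex_B2[OF assms(1)] by blast
  obtain g where "g \<in> B22 a b" "AE z in lborel. z \<in> rect a b \<longrightarrow> \<psi> z = g z"
    using ex_B22[OF assms(2)] by blast
  then show thesis using that v' assms unfolding rep_def by blast
qed

lemma AE_sections_rep:
  assumes "rep a b v \<psi> v' g"
  shows "AE s in lborel. AE y in lborel. y \<in> {a..b} \<longrightarrow> s \<in> {0..1} \<longrightarrow> \<psi> (s, y) = g (s, y)"
    "AE y in lborel. AE s in lborel. y \<in> {a..b} \<longrightarrow> s \<in> {0..1} \<longrightarrow> \<psi> (s, y) = g (s, y)"
proof -
  have "AE z in lborel. snd z \<in> {a..b} \<longrightarrow> fst z \<in> {0..1} \<longrightarrow> \<psi> z = g z"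
    using repD(6)[OF assms] by (rule eventually_mono) (auto simp: mem_Times_iff)
  from AE_lborel_sections[OF this]
  show "AE s in lborel. AE y in lborel. y \<in> {a..b} \<longrightarrow> s \<in> {0..1} \<longrightarrow> \<psi> (s, y) = g (s, y)"
    "AE y in lborel. AE s in lborel. y \<in> {a..b} \<longrightarrow> s \<in> {0..1} \<longrightarrow> \<psi> (s, y) = g (s, y)" by simp_all
qed

lemma B22_section_zero:
  assumes "g \<in> B22 a b" "r \<notin> {0..1}" shows "(\<lambda>y. g (r, y)) = (\<lambda>y. 0)"
  using B22D(2)[OF assms(1)] assms(2) by auto

lemma AE_T1_op_rep:
  fixes B :: "real^('n::finite + 'n + 'n + 'n)^('n + 'n)"
  assumes R: "rep a b v \<psi> v' g"
  shows "AE s in lborel. s \<in> {0..1} \<longrightarrow> (\<forall>x\<in>{a..b}. T1_op a b B (\<lambda>y. \<psi> (s, y)) x = Tk a b B (\<lambda>y. g (s, y)) x)"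
  using AE_sections_rep(1)[OF R]
proof eventually_elim
  case (elim s)
  then show ?case by (auto intro!: T1_op_cong_rep(1) B22D(4)[OF repD(4)[OF R]])
qed

lemma AE_rect_T1_op_rep:
  fixes B :: "real^('n::finite + 'n + 'n + 'n)^('n + 'n)"
  assumes R: "rep a b v \<psi> v' g"
  shows "AE z in lebesgue_on (rect a b). T1_op a b B (\<lambda>y. \<psi> (fst z, y)) (snd z) = TT a b B g z"
proof -
  have "AE z in (lborel :: (real \<times> real) measure).
      (fst z \<in> {0..1} \<longrightarrow> (\<forall>x\<in>{a..b}. T1_op a b B (\<lambda>y. \<psi> (fst z, y)) x = Tk a b B (\<lambda>y. g (fst z, y)) x)) \<and> True"
    by (rule AE_lborel_fst_snd[OF AE_T1_op_rep[OF R]]) simp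
  then show ?thesis
    unfolding AE_lebesgue_on_iff[OF rect_borel]
    by (rule eventually_mono) (auto simp: on_rect)
qed

lemma T2_op_rep:
  fixes B :: "real^('n::finite + 'n + 'n + 'n)^('n + 'n)"
  assumes R: "rep a b v \<psi> v' g" and s: "s \<in> {0..1}" and x: "x \<in> {a..b}"
  shows "T2_op a b B \<psi> (s, x) = prim (\<lambda>r. Tk a b B (\<lambda>y. g (r, y)) x) s"
proof -
  let ?T = "\<lambda>r. Tk a b B (\<lambda>y. g (r, y)) x"
  have [measurable]: "?T \<in> borel_measurable borel"
    using borel_measurable_integrable[OF Tk_sections_integrable[OF repD(4)[OF R] x, of B]] by simp
  have 0: "?T r = 0" if "r \<notin> {0..1}" for r using B22_section_zero[OF repD(4)[OF R] that] by (simp add: Tk_zero)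
  have "(LINT r|lebesgue. indicator {0..s} r *\<^sub>R T1_op a b B (\<lambda>y. \<psi> (r, y)) x) = (LINT r|lborel. indicator {..s} r *\<^sub>R ?T r)"
  proof (rule lebesgue_integral_eq_lborel_AE)
    show "AE r in lborel. indicator {0..s} r *\<^sub>R T1_op a b B (\<lambda>y. \<psi> (r, y)) x = indicator {..s} r *\<^sub>R ?T r"
      using AE_T1_op_rep[OF R, of B]
    proof eventually_elim
      case (elim r)
      show ?case
      proof (cases "r \<in> {0..1}")
        case True
        with elim x show ?thesis by (auto simp: indicator_def)
      next
        case False
        then have "r \<notin> {0..s}" using s by auto
        then show ?thesis using 0[OF False] by simp
      qed
    qed
  qed measurable
  then show ?thesis by (simp add: T2_op_def set_lebesgue_integral_def prim_def)
qed

lemma T12_op_rep: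
  fixes B :: "real^('n::finite + 'n + 'n + 'n)^('n + 'n)"
  assumes R: "rep a b v \<psi> v' g" and ab: "a < b" and z: "z \<in> rect a b"
  shows "T12_op a b B v \<psi> z = TT a b B (WW a b v' g) z"
proof -
  obtain s x where sx: "z = (s, x)" "s \<in> {0..1}" "x \<in> {a..b}" using z by auto
  show ?thesis
    unfolding sx(1) T12_op_def prod.case T2_op_rep[OF R sx(2,3)] on_rect(1)[OF sx(2,3)]
      Tk_WW[OF repD(3,4)[OF R] ab sx(2,3)] T1_op_cong_rep(1)[OF repD(3)[OF R] sx(3) repD(5)[OF R]] ..
qed

text \<open>In \<open>\<A>\<^bsub>11,d\<^esub>\<close> and \<open>\<A>\<^bsub>12\<^esub>\<close> the matrix \<open>A\<^sub>d(x)\<close> is a constant factor of integrals over other variables. Taking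
  it out leaves \<open>\<T>\<^sub>1\<close>, its derivative and the identity, applied to \<open>v\<close> and to the slices of \<open>\<psi>\<close>, and
  the sum is their value at \<open>W(1,\<cdot>)\<close>.\<close>

lemma output_rep:
  fixes B :: "real^('n::finite + 'n + 'n + 'n)^('n + 'n)"
  assumes R: "rep a b v \<psi> v' g" and ab: "a < b"
  shows "AE x in lebesgue_on {a..b}. A11d_op a b B A_d v x + A12_op a b B A_d \<psi> x
    = A_d x *v (Tk a b B (\<lambda>y. WW a b v' g (1, y)) x on_top DTk a b B (\<lambda>y. WW a b v' g (1, y)) x
                on_top WW a b v' g (1, x))"
proof -
  note g = repD(4)[OF R] and v = repD(3)[OF R]
  let ?J = "\<lambda>x y y' y''. A_d x *v (y on_top y' on_top y'')"
  have add: "?J x p p' p'' + ?J x q q' q'' = ?J x (p + q) (p' + q') (p'' + q'')" for x and p p' p'' q q' q'' :: "real^'n"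
    by (simp add: matrix_vector_right_distrib[symmetric] on_top_add)
  have A12: "A12_op a b B A_d \<psi> x = ?J x (prim (\<lambda>r. Tk a b B (\<lambda>y. g (r, y)) x) 1)
       (prim (\<lambda>r. DTk a b B (\<lambda>y. g (r, y)) x) 1) (prim (\<lambda>r. g (r, x)) 1)"
    if x: "x \<in> {a..b}" and sec: "AE s in lborel. x \<in> {a..b} \<longrightarrow> s \<in> {0..1} \<longrightarrow> \<psi> (s, x) = g (s, x)" for x
  proof -
    let ?f = "\<lambda>r. ?J x (Tk a b B (\<lambda>y. g (r, y)) x) (DTk a b B (\<lambda>y. g (r, y)) x) (g (r, x))"
    note i = Tk_sections_integrable[OF g x, of B] DTk_sections_integrable[OF g x, of B] B2_integrable[OF B22D(5)[OF g, of x]]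
    have L: "bounded_linear (\<lambda>y. ?J x y 0 0)" "bounded_linear (\<lambda>y. ?J x 0 y 0)" "bounded_linear (\<lambda>y. ?J x 0 0 y)"
      by (intro bounded_linear_compose[OF matrix_vector_mul_bounded_linear] bounded_linear_on_top bounded_linear_zero
          bounded_linear_ident)+
    have split: "?J x y y' y'' = ?J x y 0 0 + (?J x 0 y' 0 + ?J x 0 0 y'')" for y y' y'' by (simp add: add)
    have iL: "integrable lborel (\<lambda>r. ?J x (Tk a b B (\<lambda>y. g (r, y)) x) 0 0)" "integrable lborel (\<lambda>r. ?J x 0 (DTk a b B (\<lambda>y. g (r, y)) x) 0)"
       "integrable lborel (\<lambda>r. ?J x 0 0 (g (r, x)))"
      by (rule integrable_bounded_linear[OF L(1) i(1)] integrable_bounded_linear[OF L(2) i(2)] integrable_bounded_linear[OF L(3) i(3)])+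
    have if': "integrable lborel ?f"
      using Bochner_Integration.integrable_add[OF iL(1) Bochner_Integration.integrable_add[OF iL(2,3)]]
      by (rule Bochner_Integration.integrable_cong[THEN iffD1, OF refl, rotated]) (rule split[symmetric])
    have [measurable]: "?f \<in> borel_measurable borel" using borel_measurable_integrable[OF if'] by simp
    have f0: "?f r = 0" if "r \<notin> {0..1}" for r
      using B22_section_zero[OF g that] fun_cong[OF B22_section_zero[OF g that], of x] linear_0[OF bounded_linear.linear[OF L(1)]]
      by (simp add: Tk_zero)
    have "A12_op a b B A_d \<psi> x = (LINT s|lebesgue. indicator {0..1} s *\<^sub>R A11d_op a b B A_d (\<lambda>y. \<psi> (s, y)) x)"
      by (simp add: A12_op_def set_lebesgue_integral_def)
    also have "\<dots> = (LINT s|lborel. indicator {..1} s *\<^sub>R ?f s)"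
    proof (rule lebesgue_integral_eq_lborel_AE)
      show "AE s in lborel. indicator {0..1} s *\<^sub>R A11d_op a b B A_d (\<lambda>y. \<psi> (s, y)) x = indicator {..1} s *\<^sub>R ?f s"
        using sec AE_sections_rep(1)[OF R]
      proof eventually_elim
        case (elim s)
        show ?case
        proof (cases "s \<in> {0..1}")
          case True
          then have "A11d_op a b B A_d (\<lambda>y. \<psi> (s, y)) x = A11d_op a b B A_d (\<lambda>y. g (s, y)) x"
            using elim x by (intro T1_op_cong_rep(2)[OF B22D(4)[OF g] x]) auto
          also have "\<dots> = ?f s" by (rule A11d_op_eq[OF B22D(4)[OF g] x])
          finally show ?thesis using True by simp
        next
          case False
          show ?thesis using f0[OF False] False by simp
        qed
      qed
    qed measurable
    also have "\<dots> = prim ?f 1" by (simp add: prim_def)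
    also have "\<dots> = ?J x (prim (\<lambda>r. Tk a b B (\<lambda>y. g (r, y)) x) 1)
       (prim (\<lambda>r. DTk a b B (\<lambda>y. g (r, y)) x) 1) (prim (\<lambda>r. g (r, x)) 1)"
    proof -
      let ?T = "\<lambda>r. Tk a b B (\<lambda>y. g (r, y)) x" and ?D = "\<lambda>r. DTk a b B (\<lambda>y. g (r, y)) x"
      have "?f = (\<lambda>r. ?J x (?T r) 0 0 + (?J x 0 (?D r) 0 + ?J x 0 0 (g (r, x))))"
        by (rule ext) (rule split)
      then have "prim ?f 1 = prim (\<lambda>r. ?J x (?T r) 0 0 + (?J x 0 (?D r) 0 + ?J x 0 0 (g (r, x)))) 1"
        by (rule arg_cong[where f = "\<lambda>h. prim h 1"])
      also have "\<dots> = ?J x (prim ?T 1) 0 0 + (?J x 0 (prim ?D 1) 0 + ?J x 0 0 (prim (\<lambda>r. g (r, x)) 1))"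
        unfolding prim_add[OF iL(1) Bochner_Integration.integrable_add[OF iL(2,3)]] prim_add[OF iL(2,3)]
          prim_bounded_linear[OF L(1) i(1)] prim_bounded_linear[OF L(2) i(2)] prim_bounded_linear[OF L(3) i(3)] ..
      finally show ?thesis by (rule trans) (rule split[symmetric])
    qed
    finally show ?thesis .
  qed
  show ?thesis
    unfolding AE_lebesgue_on_iff[OF atLeastAtMost_borel]
    using AE_sections_rep(2)[OF R] repD(5)[OF R]
  proof eventually_elim
    case (elim x)
    have "A11d_op a b B A_d v x + A12_op a b B A_d \<psi> x
      = ?J x (Tk a b B (\<lambda>y. WW a b v' g (1, y)) x) (DTk a b B (\<lambda>y. WW a b v' g (1, y)) x) (WW a b v' g (1, x))"
      if x: "x \<in> {a..b}"
    proof -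
      have "A11d_op a b B A_d v x = A11d_op a b B A_d v' x"
        using elim(2) x by (intro T1_op_cong_rep(2)[OF v x repD(5)[OF R]]) auto
      also have "\<dots> = ?J x (Tk a b B v' x) (DTk a b B v' x) (v' x)" by (rule A11d_op_eq[OF v x])
      finally show ?thesis
        unfolding A12[OF x elim(1)] using Tk_WW[OF v g ab _ x, of 1 B] DTk_WW[OF v g ab _ x, of 1 B] WW_on_rect[OF _ x, of 1 v' g]
        by (simp add: add)
    qed
    then show ?case by blast
  qed
qed

section \<open>The state map \<open>(v, \<psi>) \<mapsto> \<T>\<^sub>1 v + \<T>\<^sub>2 \<psi>\<close>\<close>

text \<open>The mixed derivatives of the state: differentiating in \<open>s\<close> replaces \<open>W\<close> by \<open>g\<close>, and differentiating
  twice in \<open>x\<close> removes \<open>\<T>\<^sub>1\<close>.\<close>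

definition T12_wd :: "real \<Rightarrow> real \<Rightarrow> real^('n::finite + 'n + 'n + 'n)^('n + 'n) \<Rightarrow> (real \<Rightarrow> real^'n) \<Rightarrow>
    (real \<times> real \<Rightarrow> real^'n) \<Rightarrow> nat \<Rightarrow> nat \<Rightarrow> real \<times> real \<Rightarrow> real^'n"
  where "T12_wd a b B v g \<alpha> \<beta> =
    (let h = if \<alpha> = 0 then WW a b v g else g
     in if \<beta> = 0 then TT a b B h else if \<beta> = 1 then DD a b B h else h)"

lemma T12_weak_derivatives:
  fixes B :: "real^('n::finite + 'n + 'n + 'n)^('n + 'n)"
  assumes R: "rep a b v \<psi> v' g" and ab: "a < b" and \<alpha>: "\<alpha> \<le> 1" and \<beta>: "\<beta> \<le> 2"
  shows "wd2 a b \<alpha> \<beta> (T12_op a b B v \<psi>) (T12_wd a b B v' g \<alpha> \<beta>)"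
proof -
  note v = repD(3)[OF R] and g = repD(4)[OF R]
  note W = WW_bounded(1)[OF v g ab]
  let ?\<phi> = "TT a b B (WW a b v' g)"
  have dir: "set [(0, 1)] \<subseteq> (Basis :: (real \<times> real) set)" by (simp add: Basis_prod_def)
  have x: "wd2 a b 0 \<beta> (TT a b B h) (if \<beta> = 0 then TT a b B h else if \<beta> = 1 then DD a b B h else h)"
    if h: "h \<in> B22 a b" for h
  proof -
    have T: "TT a b B h \<in> B22 a b" using TT_bounded[OF ab, of B] h by metis
    have "wd2 a b 0 2 (TT a b B h) h"
      using weak_deriv_append[OF wd2_TT[OF ab h, of B] wd2_DD[OF ab h]] by (simp add: dir[simplified] numeral_2_eq_2)
    moreover have "wd2 a b 0 0 (TT a b B h) (TT a b B h)"
      using weak_deriv_Nil[OF B22_L2[OF T]] by simp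
    moreover consider "\<beta> = 0" | "\<beta> = 1" | "\<beta> = 2" using \<beta> by linarith
    ultimately show ?thesis using wd2_TT[OF ab h, of B] by cases auto
  qed
  have "wd2 a b \<alpha> \<beta> ?\<phi> (T12_wd a b B v' g \<alpha> \<beta>)"
  proof (cases "\<alpha> = 0")
    case True
    then show ?thesis using x[OF W] by (simp add: T12_wd_def Let_def)
  next
    case False
    then have "\<alpha> = 1" using \<alpha> by simp
    moreover have "set (replicate \<beta> (0, 1)) \<subseteq> (Basis :: (real \<times> real) set)" by (auto simp: Basis_prod_def)
    ultimately show ?thesis
      using weak_deriv_append[OF wd2_s_TT_WW[OF v g ab, of B], of "replicate \<beta> (0, 1)"] x[OF g]
      by (simp add: T12_wd_def Let_def)
  qed
  then show ?thesis
    using weak_deriv_cong[of "rect a b" "T12_op a b B v \<psi>" ?\<phi>, OF T12_op_rep[OF R ab]] by blast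
qed

lemma T12_wd_simps:
  "T12_wd a b B v g 0 0 = TT a b B (WW a b v g)" "T12_wd a b B v g 0 2 = WW a b v g"
  "T12_wd a b B v g 1 0 = TT a b B g" "T12_wd a b B v g 1 2 = g"
  by (simp_all add: T12_wd_def)

lemma rep_AE:
  assumes "rep a b v \<psi> v' g"
  shows "AE x in lebesgue_on {a..b}. v x = v' x" "AE z in lebesgue_on (rect a b). \<psi> z = g z"
  using repD(5,6)[OF assms] by (simp_all only: AE_lebesgue_on_iff[OF atLeastAtMost_borel] AE_lebesgue_on_iff[OF rect_borel])

lemma rep_norms:
  assumes "rep a b v \<psi> v' g"
  shows "L2_norm {a..b} v = L2_norm {a..b} v'" "L2_norm (rect a b) \<psi> = L2_norm (rect a b) g"
  using L2_norm_cong_AE[OF repD(1)[OF assms] B2_L2[OF repD(3)[OF assms]] rep_AE(1)[OF assms]]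
    L2_norm_cong_AE[OF repD(2)[OF assms] B22_L2[OF repD(4)[OF assms]] rep_AE(2)[OF assms]] .

lemma T12_wd2_12:
  fixes B :: "real^('n::finite + 'n + 'n + 'n)^('n + 'n)"
  assumes v: "v \<in> L2 {a..b}" and \<psi>: "\<psi> \<in> L2 (rect a b)" and ab: "a < b"
  shows "wd2 a b 1 2 (T12_op a b B v \<psi>) \<psi>"
proof -
  obtain v' g where R: "rep a b v \<psi> v' g" using ex_rep[OF v \<psi>] .
  have "AE z in lebesgue_on (rect a b). g z = \<psi> z" using rep_AE(2)[OF R] by (rule eventually_mono) simp
  then show ?thesis
    using weak_deriv_AE_right[OF T12_weak_derivatives[OF R ab, of 1 2 B, unfolded T12_wd_simps] \<psi>] by simp
qed

lemma T12_in_H12: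
  fixes B :: "real^('n::finite + 'n + 'n + 'n)^('n + 'n)"
  assumes v: "v \<in> L2 {a..b}" and \<psi>: "\<psi> \<in> L2 (rect a b)" and ab: "a < b"
  shows "T12_op a b B v \<psi> \<in> H12 a b"
proof -
  obtain v' g where R: "rep a b v \<psi> v' g" using ex_rep[OF v \<psi>] .
  have "continuous_on (rect a b) (T12_op a b B v \<psi>) \<longleftrightarrow> continuous_on (rect a b) (TT a b B (WW a b v' g))"
    by (intro continuous_on_cong refl T12_op_rep[OF R ab])
  then show ?thesis
    using TT_WW_continuous[OF repD(3,4)[OF R] ab] T12_weak_derivatives[OF R ab, of _ _ B] unfolding H12_def by blast
qed

lemma H2_cong:
  fixes u w :: "real \<Rightarrow> 'v::euclidean_space"
  assumes "\<And>x. x \<in> {a..b} \<Longrightarrow> u x = w x" shows "u \<in> H2 a b \<longleftrightarrow> w \<in> H2 a b"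
proof -
  have "wd1 a b \<beta> u = wd1 a b \<beta> w" for \<beta> using weak_deriv_cong[of "{a..b}" u w, OF assms] by blast
  moreover have "continuous_on {a..b} u \<longleftrightarrow> continuous_on {a..b} w" by (intro continuous_on_cong assms refl)
  ultimately show ?thesis unfolding H2_def by simp
qed

lemma X_B_cong:
  fixes u w :: "real \<Rightarrow> real^'n::finite"
  assumes "a \<le> b" and "\<And>x. x \<in> {a..b} \<Longrightarrow> u x = w x"
  shows "u \<in> X_B a b B \<longleftrightarrow> w \<in> X_B a b B"
proof -
  have "wd1 a b 1 u = wd1 a b 1 w" using weak_deriv_cong[of "{a..b}" u w, OF assms(2)] by blast
  then show ?thesis unfolding X_B_def using H2_cong[of a b u w, OF assms(2)] assms by simp
qed

lemma T12_at_0: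
  fixes B :: "real^('n::finite + 'n + 'n + 'n)^('n + 'n)"
  assumes v: "v \<in> L2 {a..b}" and \<psi>: "\<psi> \<in> L2 (rect a b)" and ab: "a < b" and x: "x \<in> {a..b}"
  shows "T12_op a b B v \<psi> (0, x) = T1_op a b B v x"
proof -
  obtain v' g where R: "rep a b v \<psi> v' g" using ex_rep[OF v \<psi>] .
  have "prim (\<lambda>r. Tk a b B (\<lambda>y. g (r, y)) x) 0 = 0"
    by (rule prim_start) (simp add: B22_section_zero[OF repD(4)[OF R]] Tk_zero)
  then show ?thesis using T2_op_rep[OF R _ x, of 0 B] by (simp add: T12_op_def)
qed

lemma T12_in_Y:
  fixes B :: "real^('n::finite + 'n + 'n + 'n)^('n + 'n)"
  assumes v: "v \<in> L2 {a..b}" and \<psi>: "\<psi> \<in> L2 (rect a b)" and ab: "a < b" and inv: "invertible (B ** H_mat a b)"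
  shows "T12_op a b B v \<psi> \<in> Y_space a b B (T1_op a b B v)"
proof -
  obtain v' g where R: "rep a b v \<psi> v' g" using ex_rep[OF v \<psi>] .
  have "(\<lambda>x. T12_op a b B v \<psi> (s, x)) \<in> X_B a b B" if s: "s \<in> {0..1}" for s
  proof -
    have eq: "T12_op a b B v \<psi> (s, x) = Tk a b B (\<lambda>y. WW a b v' g (s, y)) x" if "x \<in> {a..b}" for x
      using T12_op_rep[OF R ab, of "(s, x)" B] on_rect(1)[OF s that] s that by simp
    show ?thesis
      using X_B_cong[of a b "\<lambda>x. T12_op a b B v \<psi> (s, x)" "Tk a b B (\<lambda>y. WW a b v' g (s, y))" B,
          OF less_imp_le[OF ab] eq] Tk_in_X_B[OF ab inv B22D(4)[OF WW_bounded(1)[OF repD(3,4)[OF R] ab]]]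
      by blast
  qed
  then show ?thesis
    unfolding Y_space_def using T12_in_H12[OF v \<psi> ab] T12_at_0[OF v \<psi> ab] by blast
qed

lemma T12_bounded:
  fixes B :: "real^('n::finite + 'n + 'n + 'n)^('n + 'n)"
  assumes ab: "a < b"
  obtains K where "K \<ge> 0" "\<And>v \<psi>. v \<in> L2 {a..b} \<Longrightarrow> \<psi> \<in> L2 (rect a b) \<Longrightarrow>
    H12_norm a b (T12_op a b B v \<psi>) \<le> K * (L2_norm {a..b} v + L2_norm (rect a b) \<psi>)"
proof -
  obtain K where K: "K \<ge> 0"
    "\<And>g. g \<in> B22 a b \<Longrightarrow> L2_norm (rect a b) (TT a b B g) \<le> K * L2_norm (rect a b) g"
    "\<And>g. g \<in> B22 a b \<Longrightarrow> L2_norm (rect a b) (DD a b B g) \<le> K * L2_norm (rect a b) g"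
    using TT_bounded[OF ab, of B] by metis
  have *: "H12_norm a b (T12_op a b B v \<psi>) \<le> (6 * (K + 1)) * (L2_norm {a..b} v + L2_norm (rect a b) \<psi>)"
    if v: "v \<in> L2 {a..b}" and \<psi>: "\<psi> \<in> L2 (rect a b)" for v \<psi>
  proof -
    obtain v' g where R: "rep a b v \<psi> v' g" using ex_rep[OF v \<psi>] .
    define N where "N = L2_norm {a..b} v + L2_norm (rect a b) \<psi>"
    have N0: "N \<ge> 0" by (simp add: N_def L2_norm_nonneg)
    note W = WW_bounded[OF repD(3,4)[OF R] ab]
    have "L2_norm (rect a b) (WW a b v' g) \<le> 2 * N"
    proof (rule power2_le_imp_le)
      have "2 * (L2_norm {a..b} v)\<^sup>2 + 2 * (L2_norm (rect a b) \<psi>)\<^sup>2 \<le> (2 * N)\<^sup>2"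
        using L2_norm_nonneg[of "{a..b}" v] L2_norm_nonneg[of "rect a b" \<psi>]
        by (simp add: N_def power2_eq_square algebra_simps)
      then show "(L2_norm (rect a b) (WW a b v' g))\<^sup>2 \<le> (2 * N)\<^sup>2"
        using W(2) by (simp add: rep_norms[OF R])
    qed (use N0 in simp)
    moreover have "L2_norm (rect a b) g \<le> 2 * N"
      using L2_norm_nonneg[of "{a..b}" v] L2_norm_nonneg[of "rect a b" g] by (simp add: N_def rep_norms(2)[OF R])
    ultimately have h: "L2_norm (rect a b) h \<le> 2 * N" "h \<in> B22 a b" if "h = WW a b v' g \<or> h = g" for h
      using that W(1) repD(4)[OF R] by auto
    have bound: "L2_norm (rect a b) (T12_wd a b B v' g \<alpha> \<beta>) \<le> (K + 1) * (2 * N)" for \<alpha> \<beta>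
    proof -
      define h where "h = (if \<alpha> = 0 then WW a b v' g else g)"
      have hh: "L2_norm (rect a b) h \<le> 2 * N" "h \<in> B22 a b" using h[of h] by (auto simp: h_def)
      have Kh: "K * L2_norm (rect a b) h \<le> K * (2 * N)" using hh(1) K(1) by (rule mult_left_mono)
      have KN: "0 \<le> K * (2 * N)" using K(1) N0 by simp
      have le: "L2_norm (rect a b) (TT a b B h) \<le> K * (2 * N) + 2 * N" "L2_norm (rect a b) (DD a b B h) \<le> K * (2 * N) + 2 * N"
        "L2_norm (rect a b) h \<le> K * (2 * N) + 2 * N"
        using K(2,3)[OF hh(2)] Kh hh(1) N0 KN by linarith+
      show ?thesis
        unfolding T12_wd_def Let_def h_def[symmetric] using le by (simp add: distrib_right)
    qed
    have "H12_norm a b (T12_op a b B v \<psi>) = sqrt (\<Sum>\<alpha>\<le>1. \<Sum>\<beta>\<le>2. (L2_norm (rect a b) (T12_wd a b B v' g \<alpha> \<beta>))\<^sup>2)"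
      by (rule H12_norm_eq) (rule T12_weak_derivatives[OF R ab])
    \<comment> \<open>Six derivatives, each bounded by \<open>(K + 1) * (2 * N)\<close>.\<close>
    also have "\<dots> \<le> sqrt (\<Sum>\<alpha>\<le>(1::nat). \<Sum>\<beta>\<le>(2::nat). ((K + 1) * (2 * N))\<^sup>2)"
      by (intro real_sqrt_le_mono sum_mono power_mono bound L2_norm_nonneg)
    also have "\<dots> \<le> sqrt ((6 * (K + 1) * N)\<^sup>2)"
    proof (rule real_sqrt_le_mono)
      have "(6 * (K + 1) * N)\<^sup>2 = 36 * ((K + 1)\<^sup>2 * N\<^sup>2)"
        by (simp only: power_mult_distrib mult.assoc) simp
      moreover have "(\<Sum>\<alpha>\<le>(1::nat). \<Sum>\<beta>\<le>(2::nat). ((K + 1) * (2 * N))\<^sup>2) = 24 * ((K + 1)\<^sup>2 * N\<^sup>2)"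
        by (simp add: power_mult_distrib)
      moreover have "0 \<le> (K + 1)\<^sup>2 * N\<^sup>2" by simp
      ultimately show "(\<Sum>\<alpha>\<le>(1::nat). \<Sum>\<beta>\<le>(2::nat). ((K + 1) * (2 * N))\<^sup>2) \<le> (6 * (K + 1) * N)\<^sup>2"
        by linarith
    qed
    also have "\<dots> = 6 * (K + 1) * N" using K(1) N0 by simp
    finally show ?thesis by (simp add: N_def)
  qed
  show thesis by (rule that[of "6 * (K + 1)"]) (use K(1) * in auto)
qed

lemma WW_lincomb: 
  assumes "g \<in> B22 a b" "g' \<in> B22 a b"
  shows "WW a b (\<lambda>y. v y + c *\<^sub>R v' y) (\<lambda>z. g z + c *\<^sub>R g' z) z = WW a b v g z + c *\<^sub>R WW a b v' g' z"
proof -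
  have "prim (\<lambda>r. g (r, x) + c *\<^sub>R g' (r, x)) s = prim (\<lambda>r. g (r, x)) s + c *\<^sub>R prim (\<lambda>r. g' (r, x)) s" for x s
    using prim_add[of "\<lambda>r. g (r, x)" "\<lambda>r. c *\<^sub>R g' (r, x)"] B2_integrable[OF B22D(5)[OF assms(1), of x]]
      B2_integrable[OF B22D(5)[OF assms(2), of x]] by (simp add: prim_scaleR)
  then show ?thesis by (simp add: WW_def algebra_simps)
qed

lemma B22_lincomb:
  assumes g: "g \<in> B22 a b" and g': "g' \<in> B22 a b"
  shows "(\<lambda>z. g z + c *\<^sub>R g' z) \<in> B22 a b"
proof -
  note [measurable] = B22D(1)[OF g] B22D(1)[OF g']
  have "integrable lborel (\<lambda>z. 2 * (norm (g z))\<^sup>2 + 2 * (norm (c *\<^sub>R g' z))\<^sup>2)"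
    using B22D(3)[OF g] B22D(3)[OF g'] by (simp add: power_mult_distrib)
  then have i: "integrable lborel (\<lambda>z. (norm (g z + c *\<^sub>R g' z))\<^sup>2)"
    by (rule Bochner_Integration.integrable_bound) (auto intro: order_trans[OF norm_add_square_le] simp del: norm_scaleR)
  have "(\<lambda>z. g z + c *\<^sub>R g' z) \<in> borel_measurable borel" by measurable
  moreover have "\<forall>z. z \<notin> rect a b \<longrightarrow> g z + c *\<^sub>R g' z = 0"
    using B22D(2)[OF g] B22D(2)[OF g'] by simp
  ultimately show ?thesis
    using i B2_add[OF B22D(4)[OF g] B2_scaleR[OF B22D(4)[OF g']]] B2_add[OF B22D(5)[OF g] B2_scaleR[OF B22D(5)[OF g']]]
    unfolding B22_def by blast
qed

lemma rep_lincomb: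
  assumes R: "rep a b v \<psi> v1 g" and R': "rep a b v' \<psi>' v1' g'"
  shows "rep a b (\<lambda>y. v y + c *\<^sub>R v' y) (\<lambda>z. \<psi> z + c *\<^sub>R \<psi>' z) (\<lambda>y. v1 y + c *\<^sub>R v1' y) (\<lambda>z. g z + c *\<^sub>R g' z)"
  unfolding rep_def
proof (intro conjI)
  show "AE x in lborel. x \<in> {a..b} \<longrightarrow> v x + c *\<^sub>R v' x = v1 x + c *\<^sub>R v1' x"
    using repD(5)[OF R] repD(5)[OF R'] by eventually_elim simp
  show "AE z in lborel. z \<in> rect a b \<longrightarrow> \<psi> z + c *\<^sub>R \<psi>' z = g z + c *\<^sub>R g' z"
    using repD(6)[OF R] repD(6)[OF R'] by eventually_elim simp
qed (intro L2_add L2_scaleR B2_add B2_scaleR B22_lincomb repD[OF R] repD[OF R'])+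

lemma T12_linear:
  fixes B :: "real^('n::finite + 'n + 'n + 'n)^('n + 'n)"
  assumes v: "v \<in> L2 {a..b}" "\<psi> \<in> L2 (rect a b)" and v': "v' \<in> L2 {a..b}" "\<psi>' \<in> L2 (rect a b)" and ab: "a < b"
    and z: "z \<in> rect a b"
  shows "T12_op a b B (\<lambda>y. v y + c *\<^sub>R v' y) (\<lambda>z. \<psi> z + c *\<^sub>R \<psi>' z) z
    = T12_op a b B v \<psi> z + c *\<^sub>R T12_op a b B v' \<psi>' z"
proof -
  obtain v1 g where R: "rep a b v \<psi> v1 g" using ex_rep[OF v] .
  obtain v1' g' where R': "rep a b v' \<psi>' v1' g'" using ex_rep[OF v'] .
  obtain s x where sx: "z = (s, x)" "s \<in> {0..1}" "x \<in> {a..b}" using z by auto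
  note W = B22D(4)[OF WW_bounded(1)[OF repD(3,4)[OF R] ab], of s] and W' = B22D(4)[OF WW_bounded(1)[OF repD(3,4)[OF R'] ab], of s]
  show ?thesis
    unfolding T12_op_rep[OF rep_lincomb[OF R R'] ab z] T12_op_rep[OF R ab z] T12_op_rep[OF R' ab z]
    unfolding sx(1) on_rect(1)[OF sx(2,3)] WW_lincomb[OF repD(4)[OF R] repD(4)[OF R']]
      Tk_add[OF W B2_scaleR[OF W'] sx(3)] Tk_scaleR ..
qed

lemma T12_increment:
  fixes B :: "real^('n::finite + 'n + 'n + 'n)^('n + 'n)"
  assumes "v \<in> L2 {a..b}" "\<psi> \<in> L2 (rect a b)" "v' \<in> L2 {a..b}" "\<psi>' \<in> L2 (rect a b)" "w \<in> L2 {a..b}" "\<xi> \<in> L2 (rect a b)"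
    and ab: "a < b" and z: "z \<in> rect a b"
  shows "T12_op a b B (\<lambda>y. v y - v' y - c *\<^sub>R w y) (\<lambda>z. \<psi> z - \<psi>' z - c *\<^sub>R \<xi> z) z
    = T12_op a b B v \<psi> z - T12_op a b B v' \<psi>' z - c *\<^sub>R T12_op a b B w \<xi> z"
proof -
  have 1: "T12_op a b B (\<lambda>y. v y - v' y) (\<lambda>z. \<psi> z - \<psi>' z) z = T12_op a b B v \<psi> z - T12_op a b B v' \<psi>' z"
    using T12_linear[OF assms(1-4) ab z, of B "-1"] by simp
  show ?thesis
    using T12_linear[OF L2_diff[OF assms(1,3)] L2_diff[OF assms(2,4)] assms(5,6) ab z, of B "- c"] by (simp add: 1)
qed

section \<open>Time derivatives\<close>

lemma time_deriv_bound:
  assumes "time_deriv N u u' t" "t \<ge> 0" "K \<ge> 0"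
    and le: "\<And>r. r \<ge> 0 \<Longrightarrow> M (\<lambda>z. w r z - w t z - (r - t) *\<^sub>R w' z) \<le> K * N (\<lambda>z. u r z - u t z - (r - t) *\<^sub>R u' z)"
    and nonneg: "\<And>f. 0 \<le> M f"
  shows "time_deriv M w w' t"
  unfolding time_deriv_def
proof (rule tendsto_sandwich[OF _ _ tendsto_const])
  have "((\<lambda>r. K * (N (\<lambda>z. u r z - u t z - (r - t) *\<^sub>R u' z) / \<bar>r - t\<bar>)) \<longlongrightarrow> K * 0) (at t within {0..})"
    using assms(1) unfolding time_deriv_def by (intro tendsto_intros)
  then show "((\<lambda>r. K * (N (\<lambda>z. u r z - u t z - (r - t) *\<^sub>R u' z) / \<bar>r - t\<bar>)) \<longlongrightarrow> 0) (at t within {0..})" by simp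
  show "\<forall>\<^sub>F r in at t within {0..}. 0 \<le> M (\<lambda>z. w r z - w t z - (r - t) *\<^sub>R w' z) / \<bar>r - t\<bar>"
    using nonneg by (intro always_eventually allI divide_nonneg_nonneg) auto
  show "\<forall>\<^sub>F r in at t within {0..}. M (\<lambda>z. w r z - w t z - (r - t) *\<^sub>R w' z) / \<bar>r - t\<bar>
      \<le> K * (N (\<lambda>z. u r z - u t z - (r - t) *\<^sub>R u' z) / \<bar>r - t\<bar>)"
    using le by (auto simp: eventually_at_filter intro!: always_eventually divide_right_mono simp flip: times_divide_eq_right[symmetric])
qed

text \<open>The error of the difference quotient is itself an image under the linear map, so the bound
  \<open>T12_bounded\<close> applies to it.\<close>

lemma time_deriv_T12:
  fixes B :: "real^('n::finite + 'n + 'n + 'n)^('n + 'n)"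
  assumes ab: "a < b" and v: "\<forall>t\<ge>0. v t \<in> L2 {a..b}" and \<psi>: "\<forall>t\<ge>0. \<psi> t \<in> L2 (rect a b)" and t: "t \<ge> 0"
    and vt: "vt \<in> L2 {a..b}" "time_deriv (L2_norm {a..b}) v vt t"
    and \<psi>t: "\<psi>t \<in> L2 (rect a b)" "time_deriv (L2_norm (rect a b)) \<psi> \<psi>t t"
  shows "time_deriv (H12_norm a b) (\<lambda>t. T12_op a b B (v t) (\<psi> t)) (T12_op a b B vt \<psi>t) t"
proof -
  obtain K where K: "K \<ge> 0" "\<And>v \<psi>. v \<in> L2 {a..b} \<Longrightarrow> \<psi> \<in> L2 (rect a b) \<Longrightarrow>
    H12_norm a b (T12_op a b B v \<psi>) \<le> K * (L2_norm {a..b} v + L2_norm (rect a b) \<psi>)"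
    using T12_bounded[OF ab] by blast
  let ?v = "\<lambda>r. L2_norm {a..b} (\<lambda>z. v r z - v t z - (r - t) *\<^sub>R vt z)"
  let ?\<psi> = "\<lambda>r. L2_norm (rect a b) (\<lambda>z. \<psi> r z - \<psi> t z - (r - t) *\<^sub>R \<psi>t z)"
  let ?H = "\<lambda>r. H12_norm a b (\<lambda>z. T12_op a b B (v r) (\<psi> r) z - T12_op a b B (v t) (\<psi> t) z - (r - t) *\<^sub>R T12_op a b B vt \<psi>t z)"
  have le: "?H r \<le> K * (?v r + ?\<psi> r)" if r: "r \<ge> 0" for r
  proof -
    have "?H r = H12_norm a b (T12_op a b B (\<lambda>z. v r z - v t z - (r - t) *\<^sub>R vt z) (\<lambda>z. \<psi> r z - \<psi> t z - (r - t) *\<^sub>R \<psi>t z))"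
      using v \<psi> t r vt \<psi>t ab by (intro H12_norm_cong T12_increment[symmetric]) auto
    also have "\<dots> \<le> K * (?v r + ?\<psi> r)"
      using v \<psi> t r vt \<psi>t by (intro K(2) L2_diff L2_scaleR) auto
    finally show ?thesis .
  qed
  show ?thesis
    unfolding time_deriv_def
  proof (rule tendsto_sandwich[OF _ _ tendsto_const])
    have "((\<lambda>r. K * (?v r / \<bar>r - t\<bar> + ?\<psi> r / \<bar>r - t\<bar>)) \<longlongrightarrow> K * (0 + 0)) (at t within {0..})"
      using vt(2) \<psi>t(2) unfolding time_deriv_def by (intro tendsto_intros)
    then show "((\<lambda>r. K * (?v r / \<bar>r - t\<bar> + ?\<psi> r / \<bar>r - t\<bar>)) \<longlongrightarrow> 0) (at t within {0..})" by simp
    show "\<forall>\<^sub>F r in at t within {0..}. 0 \<le> ?H r / \<bar>r - t\<bar>"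
      by (intro always_eventually allI divide_nonneg_nonneg) (auto simp: H12_norm_def sum_nonneg)
    have "\<forall>\<^sub>F r in at t within {0..}. r \<ge> 0" by (simp add: eventually_at_filter)
    then show "\<forall>\<^sub>F r in at t within {0..}. ?H r / \<bar>r - t\<bar> \<le> K * (?v r / \<bar>r - t\<bar> + ?\<psi> r / \<bar>r - t\<bar>)"
    proof eventually_elim
      case (elim r)
      have "?H r / \<bar>r - t\<bar> \<le> K * (?v r + ?\<psi> r) / \<bar>r - t\<bar>" using le[OF elim] by (intro divide_right_mono) auto
      also have "\<dots> = K * (?v r / \<bar>r - t\<bar> + ?\<psi> r / \<bar>r - t\<bar>)" by (simp add: add_divide_distrib ring_distribs)
      finally show ?case .
    qed
  qed
qed

lemma H12_lincomb:
  assumes "\<phi> \<in> H12 a b" "\<phi>' \<in> H12 a b"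
  shows "(\<lambda>z. \<phi> z - c *\<^sub>R \<phi>' z) \<in> H12 a b"
  unfolding H12_def
proof (intro CollectI conjI allI impI)
  show "continuous_on (rect a b) (\<lambda>z. \<phi> z - c *\<^sub>R \<phi>' z)"
    using assms by (auto simp: H12_def intro!: continuous_intros)
  fix \<alpha> \<beta> :: nat assume le: "\<alpha> \<le> 1" "\<beta> \<le> 2"
  obtain g where g: "wd2 a b \<alpha> \<beta> \<phi> g" using assms(1) le unfolding H12_def by blast
  obtain g' where g': "wd2 a b \<alpha> \<beta> \<phi>' g'" using assms(2) le unfolding H12_def by blast
  from weak_deriv_diff[OF g weak_deriv_scaleR[OF g', of c] rect_lmeasurable rect_directions]
  show "\<exists>g. wd2 a b \<alpha> \<beta> (\<lambda>z. \<phi> z - c *\<^sub>R \<phi>' z) g" by blast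
qed

lemma H12_increment:
  assumes "\<phi> \<in> H12 a b" "\<phi>' \<in> H12 a b" "\<xi> \<in> H12 a b"
  shows "(\<lambda>z. \<phi> z - \<phi>' z - c *\<^sub>R \<xi> z) \<in> H12 a b"
  using H12_lincomb[OF H12_lincomb[OF assms(1,2), of 1] assms(3), of c] by simp

lemma wd2_increment:
  assumes "wd2 a b \<alpha> \<beta> \<phi> g" "wd2 a b \<alpha> \<beta> \<phi>' g'" "wd2 a b \<alpha> \<beta> \<xi> k"
  shows "wd2 a b \<alpha> \<beta> (\<lambda>z. \<phi> z - \<phi>' z - c *\<^sub>R \<xi> z) (\<lambda>z. g z - g' z - c *\<^sub>R k z)"
  by (intro weak_deriv_diff weak_deriv_scaleR assms rect_lmeasurable rect_directions)

lemma at_within_nonneg_nontrivial: "t \<ge> 0 \<Longrightarrow> at t within {0::real..} \<noteq> bot"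
proof -
  assume "t \<ge> 0"
  then have "at_right t \<le> at t within {0..}" by (intro at_le) auto
  then show ?thesis by (metis bot_unique trivial_limit_at_right_real)
qed

text \<open>The \<open>L\<^sub>2\<close> norm is dominated by the norm of \<open>H\<^bsub>(1,2)\<^esub>\<close> and limits there are unique.\<close>

lemma time_deriv_H12_unique:
  assumes t: "t \<ge> 0" and \<phi>: "\<forall>r\<ge>0. \<phi> r \<in> H12 a b" and D: "\<phi>1 \<in> H12 a b" "\<phi>2 \<in> H12 a b"
    and d: "time_deriv (H12_norm a b) \<phi> \<phi>1 t" "time_deriv (H12_norm a b) \<phi> \<phi>2 t"
  shows "AE z in lebesgue_on (rect a b). \<phi>1 z = \<phi>2 z"
proof -
  let ?E = "\<lambda>\<phi>' r z. \<phi> r z - \<phi> t z - (r - t) *\<^sub>R \<phi>' z"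
  let ?N = "L2_norm (rect a b)"
  have wd0: "h \<in> H12 a b \<Longrightarrow> wd2 a b 0 0 h h" for h :: "real \<times> real \<Rightarrow> 'a"
  proof -
    assume "h \<in> H12 a b"
    then obtain g where "wd2 a b 0 0 h g" unfolding H12_def by blast
    then have "h \<in> L2 (rect a b)" by (rule weak_deriv_L2)
    then show "wd2 a b 0 0 h h" using weak_deriv_Nil by simp
  qed
  have L2: "h \<in> H12 a b \<Longrightarrow> h \<in> L2 (rect a b)" for h :: "real \<times> real \<Rightarrow> 'a" using weak_deriv_L2(1)[OF wd0] .
  have E: "?E \<phi>' r \<in> H12 a b" if "\<phi>' \<in> H12 a b" "r \<ge> 0" for \<phi>' r
    using \<phi> t that by (intro H12_increment) auto
  have le: "?N (\<lambda>z. \<phi>1 z - \<phi>2 z) \<le> 2 * (H12_norm a b (?E \<phi>2 r) / \<bar>r - t\<bar> + H12_norm a b (?E \<phi>1 r) / \<bar>r - t\<bar>)"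
    if r: "r \<ge> 0" "r \<noteq> t" for r
  proof -
    have "\<bar>r - t\<bar> * ?N (\<lambda>z. \<phi>1 z - \<phi>2 z) = ?N (\<lambda>z. (r - t) *\<^sub>R (\<phi>1 z - \<phi>2 z))" by (rule L2_norm_scaleR[symmetric])
    also have "\<dots> = ?N (\<lambda>z. ?E \<phi>2 r z - ?E \<phi>1 r z)" by (simp add: algebra_simps)
    also have "\<dots> \<le> 2 * (?N (?E \<phi>2 r) + ?N (?E \<phi>1 r))"
      by (intro L2_norm_diff L2 E D r)
    also have "\<dots> \<le> 2 * (H12_norm a b (?E \<phi>2 r) + H12_norm a b (?E \<phi>1 r))"
      using L2_norm_le_H12_norm[OF E[OF D(1) r(1)] wd0[OF E[OF D(1) r(1)]]]
        L2_norm_le_H12_norm[OF E[OF D(2) r(1)] wd0[OF E[OF D(2) r(1)]]] by simp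
    finally have "?N (\<lambda>z. \<phi>1 z - \<phi>2 z) \<le> 2 * (H12_norm a b (?E \<phi>2 r) + H12_norm a b (?E \<phi>1 r)) / \<bar>r - t\<bar>"
      using r(2) by (simp add: pos_le_divide_eq mult.commute)
    then show ?thesis by (simp add: add_divide_distrib)
  qed
  have "((\<lambda>r. 2 * (H12_norm a b (?E \<phi>2 r) / \<bar>r - t\<bar> + H12_norm a b (?E \<phi>1 r) / \<bar>r - t\<bar>)) \<longlongrightarrow> 2 * (0 + 0)) (at t within {0..})"
    using d unfolding time_deriv_def by (intro tendsto_intros)
  then have "?N (\<lambda>z. \<phi>1 z - \<phi>2 z) \<le> 2 * (0 + 0)"
    by (rule tendsto_lowerbound[OF _ _ at_within_nonneg_nontrivial[OF t]]) (use le in \<open>auto simp: eventually_at_filter\<close>)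
  then have "?N (\<lambda>z. \<phi>1 z - \<phi>2 z) = 0" using L2_norm_nonneg[of "rect a b" "\<lambda>z. \<phi>1 z - \<phi>2 z"] by simp
  then show ?thesis using L2_norm_eq_0[OF L2_diff[OF L2[OF D(1)] L2[OF D(2)]]] by simp
qed

section \<open>Differentiability of the input and of the fundamental state\<close>

definition avg :: "(real \<times> real \<Rightarrow> 'v::euclidean_space) \<Rightarrow> real \<Rightarrow> 'v"
  where "avg k x = (LINT s|lborel. k (s, x))"

lemma
  assumes k: "k \<in> B22 a b"
  shows avg_B2: "avg k \<in> B2 a b"
    and avg_norm: "L2_norm {a..b} (avg k) \<le> L2_norm (rect a b) k"
proof -
  have [measurable]: "k \<in> borel_measurable (borel \<Otimes>\<^sub>M lborel)"
    using B22_pair_measurable[OF k] by (simp cong: measurable_cong_sets)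
  have km[measurable]: "(\<lambda>(x, s). k (s, x)) \<in> borel_measurable (borel \<Otimes>\<^sub>M lborel)"
    using measurable_compose[OF measurable_Pair[OF measurable_snd measurable_fst] B22_pair_measurable[OF k]]
    by (simp add: case_prod_beta' cong: measurable_cong_sets)
  have m[measurable]: "avg k \<in> borel_measurable borel"
    unfolding avg_def[abs_def] by (rule lborel.borel_measurable_lebesgue_integral) (use km in simp)
  have off: "avg k x = 0" if "x \<notin> {a..b}" for x
    using B22D(2)[OF k] that by (simp add: avg_def)
  have le: "(norm (avg k x))\<^sup>2 \<le> (LINT s|lborel. (norm (k (s, x)))\<^sup>2)" for x
  proof -
    have "(norm (avg k x))\<^sup>2 \<le> (LINT s|lborel. norm (k (s, x)))\<^sup>2"
      unfolding avg_def by (intro power_mono integral_norm_bound) auto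
    also have "\<dots> \<le> (1 - 0) * (LINT s|lborel. (norm (k (s, x)))\<^sup>2)"
      by (rule B2_Cauchy_Schwarz[OF B22D(5)[OF k]]) simp
    finally show ?thesis by simp
  qed
  have i: "integrable lborel (\<lambda>x. (norm (avg k x))\<^sup>2)"
    using sections_square_integrable(3)[OF k]
    by (rule Bochner_Integration.integrable_bound) (use le in \<open>auto intro!: AE_I2 intro: order_trans[OF _ abs_ge_self]\<close>)
  show B2: "avg k \<in> B2 a b" unfolding B2_def using i m off by auto
  show "L2_norm {a..b} (avg k) \<le> L2_norm (rect a b) k"
  proof (rule power2_le_imp_le)
    show "(L2_norm {a..b} (avg k))\<^sup>2 \<le> (L2_norm (rect a b) k)\<^sup>2"
      unfolding B2_L2_norm[OF B2] sections_square_integrable(4)[OF k, symmetric]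
      using i sections_square_integrable(3)[OF k] le by (intro integral_mono) auto
  qed (rule L2_norm_nonneg)
qed

text \<open>The input is recovered from the state by \<open>v = \<partial>\<^sub>x\<^sup>2 \<phi> - \<integral>\<^sub>0\<^sup>s \<partial>\<^sub>s \<partial>\<^sub>x\<^sup>2 \<phi>\<close>, an identity of functions on the
  rectangle whose left side does not depend on \<open>s\<close>. Averaging over \<open>s\<close> therefore bounds \<open>v\<close>, and its
  difference quotients, by norms on the rectangle.\<close>

lemma time_derivs_of_state:
  fixes B :: "real^('n::finite + 'n + 'n + 'n)^('n + 'n)"
  assumes ab: "a < b" and v: "\<forall>t\<ge>0. v t \<in> L2 {a..b}" and \<psi>: "\<forall>t\<ge>0. \<psi> t \<in> L2 (rect a b)" and t: "t \<ge> 0"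
    and \<phi>t: "\<phi>t \<in> H12 a b" "time_deriv (H12_norm a b) (\<lambda>t. T12_op a b B (v t) (\<psi> t)) \<phi>t t"
  shows "\<exists>vt\<in>L2 {a..b}. \<exists>\<psi>t\<in>L2 (rect a b). time_deriv (L2_norm {a..b}) v vt t \<and> time_deriv (L2_norm (rect a b)) \<psi> \<psi>t t"
proof -
  let ?\<phi> = "\<lambda>t. T12_op a b B (v t) (\<psi> t)"
  let ?E = "\<lambda>r z. ?\<phi> r z - ?\<phi> t z - (r - t) *\<^sub>R \<phi>t z"
  have E: "?E r \<in> H12 a b" if "r \<ge> 0" for r
    using that t v \<psi> ab by (intro H12_increment \<phi>t T12_in_H12) auto
  obtain G where G: "wd2 a b 0 2 \<phi>t G" using \<phi>t(1) unfolding H12_def by blast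
  obtain \<psi>t where \<psi>t: "wd2 a b 1 2 \<phi>t \<psi>t" using \<phi>t(1) unfolding H12_def by blast
  obtain G' where G': "G' \<in> B22 a b" "AE z in lborel. z \<in> rect a b \<longrightarrow> G z = G' z" using ex_B22[OF weak_deriv_L2(2)[OF G]] by blast
  obtain p where p: "p \<in> B22 a b" "AE z in lborel. z \<in> rect a b \<longrightarrow> \<psi>t z = p z" using ex_B22[OF weak_deriv_L2(2)[OF \<psi>t]] by blast
  have wdG: "wd2 a b 0 2 \<phi>t G'"
    using weak_deriv_AE_right[OF G B22_L2[OF G'(1)]] G'(2) by (simp only: AE_lebesgue_on_iff[OF rect_borel])
  have wdp: "wd2 a b 1 2 \<phi>t p"
    using weak_deriv_AE_right[OF \<psi>t B22_L2[OF p(1)]] p(2) by (simp only: AE_lebesgue_on_iff[OF rect_borel])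
  \<comment> \<open>\<open>h = \<partial>\<^sub>x\<^sup>2 \<phi>\<^sub>t - \<integral>\<^sub>0\<^sup>s \<partial>\<^sub>s \<partial>\<^sub>x\<^sup>2 \<phi>\<^sub>t\<close>, the candidate for the derivative of \<open>v\<close> before averaging.\<close>
  define Z where "Z = WW a b (\<lambda>_. 0 :: real^'n) p"
  have Z: "Z \<in> B22 a b" unfolding Z_def by (rule WW_bounded(1)[OF B2_zero p(1) ab])
  define h where "h z = G' z + (-1) *\<^sub>R Z z" for z
  have h: "h \<in> B22 a b" unfolding h_def[abs_def] by (rule B22_lincomb[OF G'(1) Z])
  define vt where "vt = avg h"
  have vt: "vt \<in> B2 a b" unfolding vt_def by (rule avg_B2[OF h])
  have le: "L2_norm {a..b} (\<lambda>x. v r x - v t x - (r - t) *\<^sub>R vt x) \<le> 6 * H12_norm a b (?E r)" if r: "r \<ge> 0" for r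
  proof -
    obtain vr gr where R: "rep a b (v r) (\<psi> r) vr gr" using ex_rep v \<psi> r by metis
    obtain v0 g0 where R0: "rep a b (v t) (\<psi> t) v0 g0" using ex_rep v \<psi> t by metis
    note B22s = repD(4)[OF R] repD(4)[OF R0]
    \<comment> \<open>\<open>A\<close> and \<open>q\<close> are \<open>\<partial>\<^sub>x\<^sup>2\<close> and \<open>\<partial>\<^sub>s \<partial>\<^sub>x\<^sup>2\<close> of the error of the difference quotient of \<open>\<phi>\<close>.\<close>
    define w where "w x = vr x + (-1) *\<^sub>R v0 x" for x
    define g where "g z = gr z + (-1) *\<^sub>R g0 z" for z
    define A where "A z = WW a b w g z + (- (r - t)) *\<^sub>R G' z" for z
    define q where "q z = g z + (- (r - t)) *\<^sub>R p z" for z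
    have w: "w \<in> B2 a b" unfolding w_def[abs_def] by (intro B2_add B2_scaleR repD(3)[OF R] repD(3)[OF R0])
    have g: "g \<in> B22 a b" unfolding g_def[abs_def] by (rule B22_lincomb[OF B22s])
    have A: "A \<in> B22 a b" unfolding A_def[abs_def] by (rule B22_lincomb[OF WW_bounded(1)[OF w g ab] G'(1)])
    have q: "q \<in> B22 a b" unfolding q_def[abs_def] by (rule B22_lincomb[OF g p(1)])
    have Wq: "WW a b (\<lambda>_. 0) q \<in> B22 a b" by (rule WW_bounded(1)[OF B2_zero q ab])
    have "wd2 a b 0 2 (?E r) A"
    proof -
      have "A = (\<lambda>z. WW a b vr gr z - WW a b v0 g0 z - (r - t) *\<^sub>R G' z)"
        unfolding A_def w_def[abs_def] g_def[abs_def] WW_lincomb[OF B22s] by (simp add: algebra_simps)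
      then show ?thesis
        using wd2_increment[OF T12_weak_derivatives[OF R ab, of 0 2 B, unfolded T12_wd_simps]
            T12_weak_derivatives[OF R0 ab, of 0 2 B, unfolded T12_wd_simps] wdG, of "r - t"] by simp
    qed
    then have nA: "L2_norm (rect a b) A \<le> H12_norm a b (?E r)" by (rule L2_norm_le_H12_norm[OF E[OF r]]) auto
    have "wd2 a b 1 2 (?E r) q"
    proof -
      have "q = (\<lambda>z. gr z - g0 z - (r - t) *\<^sub>R p z)" unfolding q_def g_def by (simp add: algebra_simps)
      then show ?thesis
        using wd2_increment[OF T12_weak_derivatives[OF R ab, of 1 2 B, unfolded T12_wd_simps]
            T12_weak_derivatives[OF R0 ab, of 1 2 B, unfolded T12_wd_simps] wdp, of "r - t"] by simp
    qed
    then have nq: "L2_norm (rect a b) q \<le> H12_norm a b (?E r)" by (rule L2_norm_le_H12_norm[OF E[OF r]]) auto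
    have nWq: "L2_norm (rect a b) (WW a b (\<lambda>_. 0) q) \<le> 2 * L2_norm (rect a b) q"
    proof (rule power2_le_imp_le)
      have "(L2_norm (rect a b) (WW a b (\<lambda>_. 0) q))\<^sup>2 \<le> 2 * (L2_norm (rect a b) q)\<^sup>2"
        using WW_bounded(2)[OF B2_zero q ab] by (simp add: L2_norm_def)
      then show "(L2_norm (rect a b) (WW a b (\<lambda>_. 0) q))\<^sup>2 \<le> (2 * L2_norm (rect a b) q)\<^sup>2"
        using zero_le_power2[of "L2_norm (rect a b) q"] by (simp only: power2_eq_square)
    qed (simp add: L2_norm_nonneg)
    \<comment> \<open>On the rectangle \<open>k(s,x) = vr(x) - v0(x) - (r - t) h(s,x)\<close>; its average over \<open>s\<close> is the error for \<open>v\<close>.\<close>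
    define k where "k z = A z + (-1) *\<^sub>R WW a b (\<lambda>_. 0) q z" for z
    have k: "k \<in> B22 a b" unfolding k_def[abs_def] by (rule B22_lincomb[OF A Wq])
    have k_eq: "k z = indicator (rect a b) z *\<^sub>R w (snd z) - (r - t) *\<^sub>R h z" for z
    proof -
      have "WW a b (\<lambda>_. 0) q z = WW a b (\<lambda>_. 0) g z + (- (r - t)) *\<^sub>R Z z"
        using WW_lincomb[OF g p(1), of "\<lambda>_. 0" "- (r - t)" "\<lambda>_. 0" z] by (simp add: q_def[abs_def] Z_def)
      moreover have "WW a b w g z = indicator (rect a b) z *\<^sub>R w (snd z) + WW a b (\<lambda>_. 0) g z"
        by (simp add: WW_def scaleR_add_right)
      ultimately show ?thesis by (simp add: k_def A_def h_def algebra_simps)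
    qed
    have avg_k: "avg k x = w x - (r - t) *\<^sub>R vt x" if x: "x \<in> {a..b}" for x
    proof -
      have ih: "integrable lborel (\<lambda>s. h (s, x))" by (rule B2_integrable[OF B22D(5)[OF h]])
      have i01: "integrable lborel (indicator {0..1} :: real \<Rightarrow> real)"
        by (intro integrable_real_indicator) (auto simp: emeasure_lborel_Icc_eq)
      have "avg k x = (LINT s|lborel. indicator {0..1} s *\<^sub>R w x - (r - t) *\<^sub>R h (s, x))"
        unfolding avg_def k_eq using x by (intro Bochner_Integration.integral_cong) (auto simp: indicator_def)
      also have "\<dots> = w x - (r - t) *\<^sub>R vt x" using ih i01 by (simp add: vt_def avg_def)
      finally show ?thesis .
    qed
    have "AE x in lebesgue_on {a..b}. v r x - v t x - (r - t) *\<^sub>R vt x = avg k x"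
      unfolding AE_lebesgue_on_iff[OF atLeastAtMost_borel]
      using repD(5)[OF R] repD(5)[OF R0] by eventually_elim (auto simp: avg_k w_def)
    then have "L2_norm {a..b} (\<lambda>x. v r x - v t x - (r - t) *\<^sub>R vt x) = L2_norm {a..b} (avg k)"
      using v t r B2_L2[OF vt] B2_L2[OF avg_B2[OF k]] by (intro L2_norm_cong_AE L2_diff L2_scaleR) auto
    also have "\<dots> \<le> L2_norm (rect a b) k" by (rule avg_norm[OF k])
    also have "\<dots> \<le> 2 * (L2_norm (rect a b) A + L2_norm (rect a b) (WW a b (\<lambda>_. 0) q))"
      using L2_norm_diff[OF B22_L2[OF A] B22_L2[OF Wq]] by (simp add: k_def[abs_def])
    also have "\<dots> \<le> 6 * H12_norm a b (?E r)" using nA nq nWq by simp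
    finally show ?thesis .
  qed
  have le\<psi>: "L2_norm (rect a b) (\<lambda>z. \<psi> r z - \<psi> t z - (r - t) *\<^sub>R \<psi>t z) \<le> 1 * H12_norm a b (?E r)" if r: "r \<ge> 0" for r
    using L2_norm_le_H12_norm[OF E[OF r] wd2_increment[OF T12_wd2_12 T12_wd2_12 \<psi>t]] v \<psi> r t ab by simp
  have "time_deriv (L2_norm {a..b}) v vt t"
    by (rule time_deriv_bound[OF \<phi>t(2) t _ le]) (auto simp: L2_norm_nonneg)
  moreover have "time_deriv (L2_norm (rect a b)) \<psi> \<psi>t t"
    by (rule time_deriv_bound[OF \<phi>t(2) t _ le\<psi>]) (auto simp: L2_norm_nonneg)
  ultimately show ?thesis using B2_L2[OF vt] weak_deriv_L2(2)[OF \<psi>t] by blast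
qed

section \<open>Every state is an image\<close>

lemma test_fun_tensor:
  assumes \<alpha>: "\<alpha> \<in> test_fun {0<..<1}" and \<beta>: "\<beta> \<in> test_fun {a<..<b}"
  shows "(\<lambda>z. \<alpha> (fst z) * \<beta> (snd z)) \<in> test_fun (interior (rect a b))"
proof -
  have "Ck k (\<lambda>z :: real \<times> real. \<alpha> (fst z) * \<beta> (snd z))" for k
  proof -
    have "Ck k (\<lambda>z :: real \<times> real. \<alpha> (z \<bullet> (1, 0) + 0) * \<beta> (z \<bullet> (0, 1) + 0))"
      by (intro Ck_mult Ck_affine_comp test_fun_Ck[OF \<alpha>] test_fun_Ck[OF \<beta>])
    then show ?thesis by (simp add: inner_prod_def)
  qed
  moreover obtain C where C: "compact C" "C \<subseteq> {0<..<1}" "\<And>z. z \<notin> C \<Longrightarrow> \<alpha> z = 0"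
    using \<alpha> unfolding test_fun_def by blast
  moreover obtain D where D: "compact D" "D \<subseteq> {a<..<b}" "\<And>z. z \<notin> D \<Longrightarrow> \<beta> z = 0"
    using \<beta> unfolding test_fun_def by blast
  moreover have "compact (C \<times> D)" using C(1) D(1) by (rule compact_Times)
  moreover have "C \<times> D \<subseteq> interior (rect a b)" using C(2) D(2) unfolding interior_rect by blast
  moreover have "\<forall>z. z \<notin> C \<times> D \<longrightarrow> \<alpha> (fst z) * \<beta> (snd z) = 0" using C(3) D(3) by (auto simp: mem_Times_iff)
  ultimately show ?thesis unfolding test_fun_def by blast
qed

lemma pd_tensor:
  fixes \<alpha> \<beta> :: "real \<Rightarrow> real"
  assumes "\<And>x. \<alpha> differentiable (at x)" "\<And>x. \<beta> differentiable (at x)"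
  shows "pd (1, 0) (\<lambda>z. \<alpha> (fst z) * \<beta> (snd z)) = (\<lambda>z. pd 1 \<alpha> (fst z) * \<beta> (snd z))"
    and "pd (0, 1) (\<lambda>z. \<alpha> (fst z) * \<beta> (snd z)) = (\<lambda>z. \<alpha> (fst z) * pd 1 \<beta> (snd z))"
proof -
  have d: "((\<lambda>z. \<alpha> (fst z) * \<beta> (snd z)) has_derivative
      (\<lambda>h. \<alpha> (fst z) * (snd h * pd 1 \<beta> (snd z)) + (fst h * pd 1 \<alpha> (fst z)) * \<beta> (snd z))) (at z)" for z
  proof -
    have "((\<lambda>z. \<alpha> (fst z)) has_derivative (\<lambda>h. fst h * pd 1 \<alpha> (fst z))) (at z)"
      using has_derivative_affine_comp[of \<alpha> z "(1, 0)" 0] assms(1) by (simp add: inner_prod_def)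
    moreover have "((\<lambda>z. \<beta> (snd z)) has_derivative (\<lambda>h. snd h * pd 1 \<beta> (snd z))) (at z)"
      using has_derivative_affine_comp[of \<beta> z "(0, 1)" 0] assms(2) by (simp add: inner_prod_def)
    ultimately show ?thesis by (rule has_derivative_mult)
  qed
  show "pd (1, 0) (\<lambda>z. \<alpha> (fst z) * \<beta> (snd z)) = (\<lambda>z. pd 1 \<alpha> (fst z) * \<beta> (snd z))"
    "pd (0, 1) (\<lambda>z. \<alpha> (fst z) * \<beta> (snd z)) = (\<lambda>z. \<alpha> (fst z) * pd 1 \<beta> (snd z))"
    by (rule ext, subst pd_at[OF d], simp)+
qed

lemma continuous_AE_constant:
  fixes f :: "real \<Rightarrow> 'v::euclidean_space"
  assumes "continuous_on {a..b} f" "a < b" "AE x in lebesgue_on {a..b}. f x = C" "x \<in> {a..b}"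
  shows "f x = C"
proof -
  have "f x - C = 0"
    using continuous_AE_zero[of a b "\<lambda>x. f x - C" x, unfolded box_real] assms
    by (simp add: continuous_on_diff)
  then show ?thesis by simp
qed

lemma continuous_weak_derivative_zero:
  fixes f :: "real \<Rightarrow> 'v::euclidean_space"
  assumes "a < b" "continuous_on {a..b} f" "wd1 a b 1 f (\<lambda>_. 0)"
  shows "\<exists>C. \<forall>x\<in>{a..b}. f x = C"
  using weak_derivative_zero_imp_constant[OF assms(1,3)] continuous_AE_constant[OF assms(2,1)] by metis

text \<open>A function whose second weak derivative vanishes is affine, and the boundary conditions
  admit only the affine function 0, because \<open>B H\<close> is invertible.\<close>

lemma X_B_zero:
  fixes B :: "real^('n::finite + 'n + 'n + 'n)^('n + 'n)"
  assumes ab: "a < b" and inv: "invertible (B ** H_mat a b)" and u: "u \<in> X_B a b B"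
    and wd: "wd1 a b 2 u (\<lambda>_. 0)" and x: "x \<in> {a..b}"
  shows "u x = 0"
proof -
  obtain ux where ux: "continuous_on {a..b} ux" "wd1 a b 1 u ux"
    and bc: "B *v (u a on_top u b on_top ux a on_top ux b) = 0"
    using u unfolding X_B_def by blast
  have cont: "continuous_on {a..b} u" using u unfolding X_B_def H2_def by blast
  have "wd1 a b 1 ux (\<lambda>_. 0)"
    unfolding weak_deriv_def
  proof (intro conjI ballI)
    fix \<eta> assume \<eta>: "\<eta> \<in> test_fun (interior {a..b})"
    have d\<eta>: "pd 1 \<eta> \<in> test_fun (interior {a..b})" using \<eta> by (rule test_fun_pd) simp
    show "(LINT z|lebesgue_on {a..b}. (foldr pd (replicate 1 1) \<eta>) z *\<^sub>R ux z)
        = (-1) ^ length (replicate 1 (1::real)) *\<^sub>R (LINT z|lebesgue_on {a..b}. \<eta> z *\<^sub>R (0 :: real^'n))"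
      using weak_deriv_test[OF ux(2) d\<eta>] weak_deriv_test[OF wd \<eta>] by (simp add: numeral_2_eq_2)
  qed (use weak_deriv_L2[OF ux(2)] L2_zero in auto)
  then obtain c where c: "\<And>x. x \<in> {a..b} \<Longrightarrow> ux x = c"
    using continuous_weak_derivative_zero[OF ab ux(1)] by blast
  define w where "w x = indicator {a..b} x *\<^sub>R c" for x
  have w: "w \<in> B2 a b"
  proof -
    have "integrable lborel (\<lambda>x. indicator {a..b} x * (norm c)\<^sup>2)"
      by (intro integrable_mult_left integrable_real_indicator) (auto simp: emeasure_lborel_Icc_eq)
    moreover have "(norm (w x))\<^sup>2 = indicator {a..b} x * (norm c)\<^sup>2" for x by (simp add: w_def indicator_def)
    moreover have "w \<in> borel_measurable borel" unfolding w_def by measurable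
    ultimately show ?thesis by (simp add: B2_def w_def)
  qed
  have prim_w: "prim w x = (x - a) *\<^sub>R c" if "x \<in> {a..b}" for x
  proof -
    have "prim w x = (LINT y|lborel. indicator {a..x} y *\<^sub>R c)"
      unfolding prim_def w_def using that by (intro Bochner_Integration.integral_cong) (auto simp: indicator_def)
    then show ?thesis using that by (simp add: emeasure_lborel_Icc_eq)
  qed
  have lin: "wd1 a b 1 (\<lambda>x. (x - a) *\<^sub>R c) w"
    by (rule weak_derivative_prim[OF ab w, of _ 0]) (auto simp: prim_w intro!: continuous_intros)
  have "wd1 a b 1 (\<lambda>x. u x - (x - a) *\<^sub>R c) (\<lambda>x. ux x - w x)"
    by (rule weak_deriv_diff[OF ux(2) lin]) auto
  then have "wd1 a b 1 (\<lambda>x. u x - (x - a) *\<^sub>R c) (\<lambda>_. 0)"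
    by (rule weak_deriv_AE_right[OF _ L2_zero]) (auto intro!: AE_I2 simp: c w_def)
  moreover have "continuous_on {a..b} (\<lambda>x. u x - (x - a) *\<^sub>R c)" using cont by (intro continuous_intros)
  ultimately obtain d where d: "\<And>x. x \<in> {a..b} \<Longrightarrow> u x - (x - a) *\<^sub>R c = d"
    using continuous_weak_derivative_zero[OF ab] by blast
  have u_eq: "u x = d + (x - a) *\<^sub>R c" if "x \<in> {a..b}" for x using d[OF that] by (simp add: algebra_simps)
  define k where "k = d on_top c"
  have k: "upper k = d" "lower k = c" by (simp_all add: k_def upper_def lower_def on_top_def vec_eq_iff)
  have "u a on_top u b on_top ux a on_top ux b = H_mat a b *v k"
    using ab by (simp add: H_mat_mult_vec k u_eq c)
  then have "(B ** H_mat a b) *v k = 0" using bc by (simp add: matrix_vector_mul_assoc)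
  then have "k = 0"
    using inv by (metis invertible_def matrix_vector_mul_assoc matrix_vector_mul_lid matrix_vector_mult_0_right)
  then have "d = 0" "c = 0" using k by (simp_all add: upper_def lower_def vec_eq_iff)
  then show ?thesis using u_eq[OF x] by simp
qed

lemma X_B_diff:
  fixes B :: "real^('n::finite + 'n + 'n + 'n)^('n + 'n)"
  assumes u: "u \<in> X_B a b B" and w: "w \<in> X_B a b B"
  shows "(\<lambda>x. u x - w x) \<in> X_B a b B"
proof -
  have dir: "set (replicate \<beta> 1) \<subseteq> (Basis :: real set)" for \<beta> by auto
  obtain ux where ux: "continuous_on {a..b} ux" "wd1 a b 1 u ux" "B *v (u a on_top u b on_top ux a on_top ux b) = 0"
    using u unfolding X_B_def by blast
  obtain wx where wx: "continuous_on {a..b} wx" "wd1 a b 1 w wx" "B *v (w a on_top w b on_top wx a on_top wx b) = 0"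
    using w unfolding X_B_def by blast
  have "(\<lambda>x. u x - w x) \<in> H2 a b"
    unfolding H2_def
  proof (intro CollectI conjI allI impI)
    show "continuous_on {a..b} (\<lambda>x. u x - w x)"
      using u w unfolding X_B_def H2_def by (auto intro!: continuous_intros)
    fix \<beta> :: nat assume \<beta>: "\<beta> \<le> 2"
    obtain g where g: "wd1 a b \<beta> u g" using u \<beta> unfolding X_B_def H2_def by blast
    obtain g' where g': "wd1 a b \<beta> w g'" using w \<beta> unfolding X_B_def H2_def by blast
    show "\<exists>g. wd1 a b \<beta> (\<lambda>x. u x - w x) g" using weak_deriv_diff[OF g g' _ dir] by auto
  qed
  moreover have "wd1 a b 1 (\<lambda>x. u x - w x) (\<lambda>x. ux x - wx x)" using weak_deriv_diff[OF ux(2) wx(2) _ dir] by simp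
  moreover have "continuous_on {a..b} (\<lambda>x. ux x - wx x)" using ux(1) wx(1) by (intro continuous_intros)
  moreover have "B *v ((u a - w a) on_top (u b - w b) on_top (ux a - wx a) on_top (ux b - wx b)) = 0"
  proof -
    have "(u a - w a) on_top (u b - w b) on_top (ux a - wx a) on_top (ux b - wx b)
      = (u a on_top u b on_top ux a on_top ux b) - (w a on_top w b on_top wx a on_top wx b)"
      by (auto simp: on_top_def vec_eq_iff split: sum.split)
    then show ?thesis using ux(3) wx(3) by (simp add: matrix_vector_mult_diff_distrib)
  qed
  ultimately show ?thesis unfolding X_B_def by blast
qed

text \<open>Testing with products \<open>\<alpha>(s) \<beta>(x)\<close> shows that \<open>s \<mapsto> \<integral> \<beta>'' \<delta>(s,\<cdot>)\<close> has vanishing weak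
  derivative; being continuous and 0 at \<open>s = 0\<close>, it is 0 for every \<open>s\<close>.\<close>

lemma mixed_derivative_zero:
  fixes \<delta> :: "real \<times> real \<Rightarrow> 'v::euclidean_space"
  assumes ab: "a < b" and cont: "continuous_on (rect a b) \<delta>" and wd: "wd2 a b 1 2 \<delta> (\<lambda>_. 0)"
    and init: "\<And>x. x \<in> {a..b} \<Longrightarrow> \<delta> (0, x) = 0" and s: "s \<in> {0..1}"
  shows "wd1 a b 2 (\<lambda>x. \<delta> (s, x)) (\<lambda>_. 0)"
proof -
  have "bounded (\<delta> ` rect a b)"
    using cont unfolding rect_cbox by (intro compact_imp_bounded compact_continuous_image compact_cbox)
  then obtain M where M: "\<And>z. z \<in> rect a b \<Longrightarrow> norm (\<delta> z) \<le> M" unfolding bounded_iff by blast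
  have M0: "0 \<le> M" using order_trans[OF norm_ge_zero M[of "(0, a)"]] ab by simp
  define \<delta>0 where "\<delta>0 z = indicator (rect a b) z *\<^sub>R \<delta> z" for z
  have eq: "\<delta>0 (s, x) = \<delta> (s, x)" if "s \<in> {0..1}" "x \<in> {a..b}" for s x using that by (simp add: \<delta>0_def)
  have off: "\<delta>0 z = 0" if "z \<notin> rect a b" for z using that by (simp add: \<delta>0_def)
  have i1: "integrable lborel (\<lambda>s :: real. M\<^sup>2 * indicator {0..1} s)"
    by (intro integrable_mult_right integrable_real_indicator) (auto simp: emeasure_lborel_Icc_eq)
  have B22: "\<delta>0 \<in> B22 a b"
  proof (rule B22I(1)[OF _ off less_imp_le[OF ab], where P = "\<lambda>s. M\<^sup>2 * indicator {0..1} s" and Q = "\<lambda>_. 0"])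
    show "\<delta>0 \<in> borel_measurable (borel \<Otimes>\<^sub>M borel)"
      unfolding \<delta>0_def[abs_def] borel_prod by (intro borel_measurable_continuous_on_indicator rect_borel cont)
    show "(norm (\<delta>0 (s, x)))\<^sup>2 \<le> M\<^sup>2 * indicator {0..1} s + 0" if "s \<in> {0..1}" "x \<in> {a..b}" for s x
      using M[of "(s, x)"] that by (auto simp: eq intro!: power_mono)
  qed (auto intro: i1)
  \<comment> \<open>\<open>G\<close> below is the pairing of the slice \<open>\<delta>(s,\<cdot>)\<close> with \<open>\<beta>''\<close>.\<close>
  have key: "(LINT x|lebesgue_on {a..b}. pd 1 (pd 1 \<beta>) x *\<^sub>R \<delta> (s, x)) = 0" if \<beta>: "\<beta> \<in> test_fun {a<..<b}" for \<beta>
  proof -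
    note \<beta>1 = test_fun_pd[OF \<beta>, of 1, simplified] 
    note \<beta>2 = test_fun_pd[OF \<beta>1, of 1, simplified]
    let ?\<kappa> = "pd 1 (pd 1 \<beta>)"
    obtain L where L: "\<And>z. \<bar>?\<kappa> z\<bar> \<le> L" using test_fun_bounded[OF \<beta>2] by blast
    have L0: "0 \<le> L" using L[of 0] abs_ge_zero[of "?\<kappa> 0"] by linarith
    have \<kappa>m[measurable]: "?\<kappa> \<in> borel_measurable borel" by (intro borel_measurable_continuous_onI test_fun_continuous[OF \<beta>2])
    define G where "G s = moment ?\<kappa> (\<lambda>x. \<delta>0 (s, x))" for s
    have G_cont: "continuous_on {0..1} G"
      unfolding continuous_on_sequentially
    proof (intro ballI allI impI)
      fix s' u assume s': "s' \<in> {0..1::real}" and u: "(\<forall>n. u n \<in> {0..1}) \<and> u \<longlonglongrightarrow> s'"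
      have "(\<lambda>n. moment ?\<kappa> (\<lambda>x. \<delta>0 (u n, x))) \<longlonglongrightarrow> moment ?\<kappa> (\<lambda>x. \<delta>0 (s', x))"
      proof (rule moment_tendsto[OF B22D(4)[OF B22] B22D(4)[OF B22], where D = "\<lambda>y. M * indicator {a..b} y" and M = L])
        show "(\<lambda>n. \<delta>0 (u n, y)) \<longlonglongrightarrow> \<delta>0 (s', y)" for y
        proof (cases "y \<in> {a..b}")
          case True
          have "continuous_on {0..1} (\<lambda>s. \<delta> (s, y))"
            by (rule continuous_on_compose2[OF cont]) (use True in \<open>auto intro!: continuous_intros\<close>)
          then have "(\<lambda>n. \<delta> (u n, y)) \<longlonglongrightarrow> \<delta> (s', y)"
            using s' u unfolding continuous_on_sequentially by (auto simp: o_def)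
          then show ?thesis using u s' True by (simp add: eq)
        next
          case False then show ?thesis by (simp add: off)
        qed
        show "integrable lborel (\<lambda>y. M * indicator {a..b} y)"
          by (intro integrable_mult_right integrable_real_indicator) (auto simp: emeasure_lborel_Icc_eq)
        show "norm (\<delta>0 (u n, y)) \<le> M * indicator {a..b} y" for n y
          using M[of "(u n, y)"] M0 by (auto simp: \<delta>0_def indicator_def)
      qed (use L L0 in auto)
      then show "(G \<circ> u) \<longlonglongrightarrow> G s'" by (simp add: G_def o_def)
    qed
    have G_off: "G s = 0" if "s \<notin> {0..1}" for s
      using B22_section_zero[OF B22 that] by (simp add: G_def moment_def)
    have G_borel: "G \<in> borel_measurable borel"
      unfolding G_def[abs_def] using B22_pair_measurable[OF B22] by measurable
    have "wd1 0 1 1 G (\<lambda>_. 0)"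
      unfolding weak_deriv_def
    proof (intro conjI ballI)
      show "G \<in> L2 {0..1}" by (rule continuous_L2[OF G_cont])
      fix \<alpha> assume "\<alpha> \<in> test_fun (interior {0..1::real})"
      then have \<alpha>: "\<alpha> \<in> test_fun {0<..<1}" by simp
      have \<alpha>1: "pd 1 \<alpha> \<in> test_fun {0<..<1}" using \<alpha> by (rule test_fun_pd) simp
      let ?\<eta> = "\<lambda>z. \<alpha> (fst z) * \<beta> (snd z)"
      note diff = test_fun_differentiable
      have d: "foldr pd (replicate 1 (1, 0) @ replicate 2 (0, 1)) ?\<eta> = (\<lambda>z. pd 1 \<alpha> (fst z) * ?\<kappa> (snd z))"
        by (simp add: numeral_2_eq_2 pd_tensor diff[OF \<alpha>] diff[OF \<beta>] diff[OF \<beta>1] diff[OF \<beta>2])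
      have d': "(\<lambda>z. pd 1 \<alpha> (fst z) * ?\<kappa> (snd z)) \<in> test_fun (interior (rect a b))"
        by (rule test_fun_tensor[OF \<alpha>1 \<beta>2])
      have "0 = (LINT z|lebesgue_on (rect a b). (pd 1 \<alpha> (fst z) * ?\<kappa> (snd z)) *\<^sub>R \<delta> z)"
        using weak_deriv_test[OF wd test_fun_tensor[OF \<alpha> \<beta>]] unfolding d by simp
      also have "\<dots> = (LINT z|lebesgue_on (rect a b). (pd 1 \<alpha> (fst z) * ?\<kappa> (snd z)) *\<^sub>R \<delta>0 z)"
        by (intro Bochner_Integration.integral_cong) (auto simp: \<delta>0_def)
      also have "\<dots> = (LINT z|(lborel \<Otimes>\<^sub>M lborel). (pd 1 \<alpha> (fst z) * ?\<kappa> (snd z)) *\<^sub>R \<delta>0 z)"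
        unfolding test_times_B22(1)[OF B22 d'] by (simp add: lborel_prod)
      also have "\<dots> = (LINT s|lborel. LINT x|lborel. (pd 1 \<alpha> s * ?\<kappa> x) *\<^sub>R \<delta>0 (s, x))"
        using lborel_pair.integral_fst'[OF test_times_B22(2)[OF B22 d']] by simp
      also have "\<dots> = (LINT s|lborel. pd 1 \<alpha> s *\<^sub>R G s)"
        by (simp add: G_def moment_def flip: scaleR_scaleR)
      also have "\<dots> = (LINT s|lebesgue_on {0..1}. pd 1 \<alpha> s *\<^sub>R G s)"
        using G_borel borel_measurable_continuous_onI[OF test_fun_continuous[OF \<alpha>1]] G_off
        by (intro integral_lebesgue_on_eq_lborel[symmetric] borel_measurable_scaleR) auto
      finally show "(LINT z|lebesgue_on {0..1}. (foldr pd (replicate 1 1) \<alpha>) z *\<^sub>R G z)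
        = (-1) ^ length (replicate 1 (1::real)) *\<^sub>R (LINT z|lebesgue_on {0..1}. \<alpha> z *\<^sub>R (0 :: 'v))" by simp
    qed (rule L2_zero)
    then obtain C where C: "\<And>s. s \<in> {0..1} \<Longrightarrow> G s = C"
      using continuous_weak_derivative_zero[OF _ G_cont] by auto
    have "\<delta>0 (0, x) = 0" for x using init[of x] off[of "(0, x)"] eq[of 0 x] by (cases "x \<in> {a..b}") auto
    then have "G 0 = 0" by (simp add: G_def moment_def)
    then have "G s = 0" using C[of 0] C[OF s] by simp
    moreover have "(LINT x|lebesgue_on {a..b}. ?\<kappa> x *\<^sub>R \<delta> (s, x)) = G s"
    proof -
      have "(LINT x|lebesgue_on {a..b}. ?\<kappa> x *\<^sub>R \<delta> (s, x)) = (LINT x|lebesgue_on {a..b}. ?\<kappa> x *\<^sub>R \<delta>0 (s, x))"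
        using s by (intro Bochner_Integration.integral_cong) (auto simp: eq)
      also have "\<dots> = G s"
        unfolding G_def moment_def using B2D(1,2)[OF B22D(4)[OF B22, of s]]
        by (intro integral_lebesgue_on_eq_lborel borel_measurable_scaleR) auto
      finally show ?thesis .
    qed
    ultimately show ?thesis by simp
  qed
  have "continuous_on {a..b} (\<lambda>x. \<delta> (s, x))"
    by (rule continuous_on_compose2[OF cont]) (use s in \<open>auto intro!: continuous_intros\<close>)
  then show ?thesis
    unfolding weak_deriv_def using key by (auto simp: numeral_2_eq_2 L2_zero intro: continuous_L2)
qed

text \<open>The difference of both sides lies in \<open>X\<^sub>B\<close> for every \<open>s\<close>, is 0 at \<open>s = 0\<close> and has mixed derivative 0.\<close>

lemma state_eq_T12:
  fixes B :: "real^('n::finite + 'n + 'n + 'n)^('n + 'n)"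
  assumes ab: "a < b" and inv: "invertible (B ** H_mat a b)" and v: "v \<in> L2 {a..b}"
    and \<phi>: "\<phi> \<in> Y_space a b B (T1_op a b B v)" and wd: "wd2 a b 1 2 \<phi> \<psi>" and z: "z \<in> rect a b"
  shows "\<phi> z = T12_op a b B v \<psi> z"
proof -
  note \<psi> = weak_deriv_L2(2)[OF wd]
  note T = T12_in_Y[OF v \<psi> ab inv]
  define \<delta> where "\<delta> z = \<phi> z - T12_op a b B v \<psi> z" for z
  have cont: "continuous_on (rect a b) \<delta>"
    using \<phi> T unfolding \<delta>_def[abs_def] Y_space_def H12_def by (auto intro!: continuous_intros)
  have wd\<delta>: "wd2 a b 1 2 \<delta> (\<lambda>_. 0)"
    using weak_deriv_diff[OF wd T12_wd2_12[OF v \<psi> ab] rect_lmeasurable rect_directions] by (simp add: \<delta>_def[abs_def])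
  have init: "\<delta> (0, x) = 0" if "x \<in> {a..b}" for x
    using \<phi> T that unfolding \<delta>_def Y_space_def by simp
  obtain s x where sx: "z = (s, x)" "s \<in> {0..1}" "x \<in> {a..b}" using z by auto
  have "(\<lambda>x. \<delta> (s, x)) \<in> X_B a b B"
    unfolding \<delta>_def using \<phi> T sx(2) unfolding Y_space_def by (intro X_B_diff) auto
  then have "\<delta> (s, x) = 0"
    by (rule X_B_zero[OF ab inv _ mixed_derivative_zero[OF ab cont wd\<delta> init sx(2)] sx(3)])
  then show ?thesis by (simp add: \<delta>_def sx(1))
qed

section \<open>Equivalence of the two systems\<close>

text \<open>The slice at \<open>s = 1\<close> is \<open>\<T>\<^sub>1 W(1,\<cdot>)\<close>; by uniqueness its weak derivatives are the ones that occur in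
  \<open>output_rep\<close>.\<close>

lemma output_iff:
  fixes B :: "real^('n::finite + 'n + 'n + 'n)^('n + 'n)"
  assumes v: "v \<in> L2 {a..b}" and \<psi>: "\<psi> \<in> L2 (rect a b)" and ab: "a < b"
  shows "(\<exists>\<phi>x \<phi>xx. wd1 a b 1 (\<lambda>x. T12_op a b B v \<psi> (1, x)) \<phi>x \<and> wd1 a b 2 (\<lambda>x. T12_op a b B v \<psi> (1, x)) \<phi>xx \<and>
           (AE x in lebesgue_on {a..b}. p x = A_d x *v (T12_op a b B v \<psi> (1, x) on_top \<phi>x x on_top \<phi>xx x)))
     \<longleftrightarrow> (AE x in lebesgue_on {a..b}. p x = A11d_op a b B A_d v x + A12_op a b B A_d \<psi> x)"
proof -
  obtain v' g where R: "rep a b v \<psi> v' g" using ex_rep[OF v \<psi>] .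
  define w where "w y = WW a b v' g (1, y)" for y
  have w: "w \<in> B2 a b" unfolding w_def[abs_def] by (rule B22D(4)[OF WW_bounded(1)[OF repD(3,4)[OF R] ab]])
  have eq: "T12_op a b B v \<psi> (1, x) = Tk a b B w x" if "x \<in> {a..b}" for x
    using T12_op_rep[OF R ab, of "(1, x)" B] on_rect(1)[of 1 x a b B "WW a b v' g"] that by (simp add: w_def[abs_def])
  have wd_eq: "wd1 a b \<beta> (\<lambda>x. T12_op a b B v \<psi> (1, x)) = wd1 a b \<beta> (Tk a b B w)" for \<beta>
    using weak_deriv_cong[of "{a..b}" "\<lambda>x. T12_op a b B v \<psi> (1, x)" "Tk a b B w", OF eq] by blast
  have out: "AE x in lebesgue_on {a..b}. A11d_op a b B A_d v x + A12_op a b B A_d \<psi> x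
      = A_d x *v (Tk a b B w x on_top DTk a b B w x on_top w x)"
    using output_rep[OF R ab, of B A_d] by (simp add: w_def[abs_def])
  have sp: "AE x in lebesgue_on {a..b}. x \<in> {a..b}" by (rule AE_I2) simp
  show ?thesis
    unfolding wd_eq
  proof
    assume "\<exists>\<phi>x \<phi>xx. wd1 a b 1 (Tk a b B w) \<phi>x \<and> wd1 a b 2 (Tk a b B w) \<phi>xx \<and>
           (AE x in lebesgue_on {a..b}. p x = A_d x *v (T12_op a b B v \<psi> (1, x) on_top \<phi>x x on_top \<phi>xx x))"
    then obtain \<phi>x \<phi>xx where wds: "wd1 a b 1 (Tk a b B w) \<phi>x" "wd1 a b 2 (Tk a b B w) \<phi>xx"
      and p: "AE x in lebesgue_on {a..b}. p x = A_d x *v (T12_op a b B v \<psi> (1, x) on_top \<phi>x x on_top \<phi>xx x)" by blast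
    have "AE x in lebesgue_on {a..b}. \<phi>x x = DTk a b B w x" "AE x in lebesgue_on {a..b}. \<phi>xx x = w x"
      using wd1_unique[OF wds(1) wd1_Tk[OF ab w, of B]] wd1_unique[OF wds(2) wd1_2_Tk[OF ab w, of B]] by simp_all
    with p out sp show "AE x in lebesgue_on {a..b}. p x = A11d_op a b B A_d v x + A12_op a b B A_d \<psi> x"
      by eventually_elim (simp add: eq)
  next
    assume p: "AE x in lebesgue_on {a..b}. p x = A11d_op a b B A_d v x + A12_op a b B A_d \<psi> x"
    have "AE x in lebesgue_on {a..b}. p x = A_d x *v (T12_op a b B v \<psi> (1, x) on_top DTk a b B w x on_top w x)"
      using p out sp by eventually_elim (simp add: eq)
    then show "\<exists>\<phi>x \<phi>xx. wd1 a b 1 (Tk a b B w) \<phi>x \<and> wd1 a b 2 (Tk a b B w) \<phi>xx \<and>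
           (AE x in lebesgue_on {a..b}. p x = A_d x *v (T12_op a b B v \<psi> (1, x) on_top \<phi>x x on_top \<phi>xx x))"
      using wd1_Tk[OF ab w] wd1_2_Tk[OF ab w] by blast
  qed
qed

text \<open>Both sides are \<open>- \<T>\<^sub>1 \<psi> / \<tau>\<close>, since \<open>\<T>\<^sub>1 \<psi>\<close> is the weak \<open>s\<close>-derivative of the state.\<close>

lemma A22_op_eq:
  fixes B :: "real^('n::finite + 'n + 'n + 'n)^('n + 'n)"
  assumes v: "v \<in> L2 {a..b}" and \<psi>: "\<psi> \<in> L2 (rect a b)" and ab: "a < b" and wd: "wd2 a b 1 0 (T12_op a b B v \<psi>) \<phi>s"
  shows "AE z in lebesgue_on (rect a b). A22_op a b B \<tau> \<psi> z = - (1 / \<tau>) *\<^sub>R \<phi>s z"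
proof -
  obtain v' g where R: "rep a b v \<psi> v' g" using ex_rep[OF v \<psi>] .
  have "AE z in lebesgue_on (rect a b). TT a b B g z = \<phi>s z"
    using wd2_unique[OF T12_weak_derivatives[OF R ab, of 1 0 B, unfolded T12_wd_simps] wd] by simp
  then show ?thesis
    using AE_rect_T1_op_rep[OF R, of B] by eventually_elim (simp add: A22_op_def case_prod_beta')
qed

lemma PIE_iff_PDE:
  fixes B :: "real^('n::finite + 'n + 'n + 'n)^('n + 'n)"
  assumes ab: "a < b" and inv: "invertible (B ** H_mat a b)" and v: "\<forall>t\<ge>0. v t \<in> L2 {a..b}"
    and \<psi>: "\<forall>t\<ge>0. \<psi> t \<in> L2 (rect a b)" and \<psi>0: "\<psi>0 \<in> L2 (rect a b)"
  shows "PIE_solution a b B \<tau> A_d v \<psi> p \<psi>0 \<longleftrightarrow>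
    PDE_solution a b B \<tau> A_d v (\<lambda>t. T12_op a b B (v t) (\<psi> t)) p (T12_op a b B (v 0) \<psi>0)"
proof -
  have v0: "v 0 \<in> L2 {a..b}" "\<psi> 0 \<in> L2 (rect a b)" using v \<psi> by auto
  have init: "(AE z in lebesgue_on (rect a b). \<psi> 0 z = \<psi>0 z) \<longleftrightarrow>
      (\<forall>z\<in>rect a b. T12_op a b B (v 0) (\<psi> 0) z = T12_op a b B (v 0) \<psi>0 z)"
  proof
    assume "AE z in lebesgue_on (rect a b). \<psi> 0 z = \<psi>0 z"
    then have "wd2 a b 1 2 (T12_op a b B (v 0) (\<psi> 0)) \<psi>0"
      by (rule weak_deriv_AE_right[OF T12_wd2_12[OF v0 ab] \<psi>0])
    then show "\<forall>z\<in>rect a b. T12_op a b B (v 0) (\<psi> 0) z = T12_op a b B (v 0) \<psi>0 z"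
      using state_eq_T12[OF ab inv v0(1) T12_in_Y[OF v0 ab inv]] by blast
  next
    assume eq: "\<forall>z\<in>rect a b. T12_op a b B (v 0) (\<psi> 0) z = T12_op a b B (v 0) \<psi>0 z"
    show "AE z in lebesgue_on (rect a b). \<psi> 0 z = \<psi>0 z"
      by (rule wd2_unique[OF T12_wd2_12[OF v0 ab, of B] T12_wd2_12[OF v0(1) \<psi>0 ab, of B]]) (use eq in \<open>auto intro!: AE_I2\<close>)
  qed
  have dyn: "(\<exists>vt\<in>L2 {a..b}. \<exists>\<psi>t\<in>L2 (rect a b). time_deriv (L2_norm {a..b}) v vt t \<and>
           time_deriv (L2_norm (rect a b)) \<psi> \<psi>t t \<and>
           (AE z in lebesgue_on (rect a b). T12_op a b B vt \<psi>t z = A22_op a b B \<tau> (\<psi> t) z)) \<longleftrightarrow>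
      (\<exists>\<phi>t\<in>H12 a b. \<exists>\<phi>s. time_deriv (H12_norm a b) (\<lambda>t. T12_op a b B (v t) (\<psi> t)) \<phi>t t \<and>
           wd2 a b 1 0 (T12_op a b B (v t) (\<psi> t)) \<phi>s \<and>
           (AE z in lebesgue_on (rect a b). \<phi>t z = - (1 / \<tau>) *\<^sub>R \<phi>s z))" (is "?L \<longleftrightarrow> ?R") if t: "t \<ge> 0" for t
  proof
    assume ?L
    then obtain vt \<psi>t where vt: "vt \<in> L2 {a..b}" "time_deriv (L2_norm {a..b}) v vt t"
      and \<psi>t: "\<psi>t \<in> L2 (rect a b)" "time_deriv (L2_norm (rect a b)) \<psi> \<psi>t t"
      and eq: "AE z in lebesgue_on (rect a b). T12_op a b B vt \<psi>t z = A22_op a b B \<tau> (\<psi> t) z" by blast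
    have vs: "v t \<in> L2 {a..b}" "\<psi> t \<in> L2 (rect a b)" using v \<psi> t by auto
    obtain \<phi>s where \<phi>s: "wd2 a b 1 0 (T12_op a b B (v t) (\<psi> t)) \<phi>s"
      using T12_in_H12[OF vs ab, of B] unfolding H12_def by blast
    have "AE z in lebesgue_on (rect a b). T12_op a b B vt \<psi>t z = - (1 / \<tau>) *\<^sub>R \<phi>s z"
      using eq A22_op_eq[OF vs ab \<phi>s, of \<tau>] by eventually_elim simp
    then show ?R
      using T12_in_H12[OF vt(1) \<psi>t(1) ab, of B] time_deriv_T12[OF ab v \<psi> t vt \<psi>t, of B] \<phi>s by blast
  next
    assume ?R
    then obtain \<phi>t \<phi>s where \<phi>t: "\<phi>t \<in> H12 a b" "time_deriv (H12_norm a b) (\<lambda>t. T12_op a b B (v t) (\<psi> t)) \<phi>t t"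
      and \<phi>s: "wd2 a b 1 0 (T12_op a b B (v t) (\<psi> t)) \<phi>s"
      and eq: "AE z in lebesgue_on (rect a b). \<phi>t z = - (1 / \<tau>) *\<^sub>R \<phi>s z" by blast
    have vs: "v t \<in> L2 {a..b}" "\<psi> t \<in> L2 (rect a b)" using v \<psi> t by auto
    obtain vt \<psi>t where vt: "vt \<in> L2 {a..b}" "time_deriv (L2_norm {a..b}) v vt t"
      and \<psi>t: "\<psi>t \<in> L2 (rect a b)" "time_deriv (L2_norm (rect a b)) \<psi> \<psi>t t"
      using time_derivs_of_state[OF ab v \<psi> t \<phi>t] by blast
    have "AE z in lebesgue_on (rect a b). T12_op a b B vt \<psi>t z = \<phi>t z"
    proof (rule time_deriv_H12_unique[OF t _ T12_in_H12[OF vt(1) \<psi>t(1) ab] \<phi>t(1) time_deriv_T12[OF ab v \<psi> t vt \<psi>t] \<phi>t(2)])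
      show "\<forall>r\<ge>0. T12_op a b B (v r) (\<psi> r) \<in> H12 a b" using v \<psi> ab by (auto intro!: T12_in_H12)
    qed
    then have "AE z in lebesgue_on (rect a b). T12_op a b B vt \<psi>t z = A22_op a b B \<tau> (\<psi> t) z"
      using eq A22_op_eq[OF vs ab \<phi>s, of \<tau>] by eventually_elim simp
    then show ?L using vt \<psi>t by blast
  qed
  have Y: "T12_op a b B (v t) (\<psi> t) \<in> Y_space a b B (T1_op a b B (v t))" if "t \<ge> 0" for t
    using T12_in_Y[OF _ _ ab inv] v \<psi> that by blast
  have out: "(\<exists>\<phi>x \<phi>xx. wd1 a b 1 (\<lambda>x. T12_op a b B (v t) (\<psi> t) (1, x)) \<phi>x \<and> wd1 a b 2 (\<lambda>x. T12_op a b B (v t) (\<psi> t) (1, x)) \<phi>xx \<and>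
           (AE x in lebesgue_on {a..b}. p t x = A_d x *v (T12_op a b B (v t) (\<psi> t) (1, x) on_top \<phi>x x on_top \<phi>xx x)))
     \<longleftrightarrow> (AE x in lebesgue_on {a..b}. p t x = A11d_op a b B A_d (v t) x + A12_op a b B A_d (\<psi> t) x)" if "t \<ge> 0" for t
    using output_iff[OF _ _ ab, of "v t" "\<psi> t" B "p t" A_d] v \<psi> that by blast
  show ?thesis
    unfolding PIE_solution_def PDE_solution_def
    apply (rule arg_cong2[where f = "(\<and>)", OF init], rule arg_cong[where f = All], rule ext, rule imp_cong[OF refl])
    subgoal premises t for t
      by (simp only: dyn[OF t] out[OF t] Y[OF t] \<psi>[rule_format, OF t] simp_thms)
    done
qed

lemma Y_space_cong:
  fixes B :: "real^('n::finite + 'n + 'n + 'n)^('n + 'n)"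
  assumes ab: "a < b" and eq: "\<And>z. z \<in> rect a b \<Longrightarrow> \<phi> z = \<phi>' z"
  shows "\<phi> \<in> Y_space a b B u \<longleftrightarrow> \<phi>' \<in> Y_space a b B u"
proof -
  have "(\<lambda>x. \<phi> (s, x)) \<in> X_B a b B \<longleftrightarrow> (\<lambda>x. \<phi>' (s, x)) \<in> X_B a b B" if "s \<in> {0..1}" for s
    using that eq ab by (intro X_B_cong) auto
  moreover have "\<phi> (0, x) = \<phi>' (0, x)" if "x \<in> {a..b}" for x using that eq by simp
  ultimately show ?thesis unfolding Y_space_def using H12_cong[of a b \<phi> \<phi>', OF eq] by auto
qed

lemma time_deriv_H12_cong:
  assumes eq: "\<And>t z. t \<ge> 0 \<Longrightarrow> z \<in> rect a b \<Longrightarrow> \<phi> t z = \<phi>' t z" and t: "t \<ge> 0"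
  shows "time_deriv (H12_norm a b) \<phi> \<phi>t t \<longleftrightarrow> time_deriv (H12_norm a b) \<phi>' \<phi>t t"
proof -
  have "H12_norm a b (\<lambda>z. \<phi> r z - \<phi> t z - (r - t) *\<^sub>R \<phi>t z) = H12_norm a b (\<lambda>z. \<phi>' r z - \<phi>' t z - (r - t) *\<^sub>R \<phi>t z)"
    if "r \<ge> 0" for r
    using that t eq by (intro H12_norm_cong) auto
  then show ?thesis
    unfolding time_deriv_def by (intro filterlim_cong refl) (auto simp: eventually_at_filter)
qed

text \<open>Solutions depend on the state only through its values on the rectangle, where it is known to have
  the form \<open>\<T>\<^sub>1 v + \<T>\<^sub>2 \<psi>\<close>.\<close>

lemma PDE_solution_cong:
  fixes B :: "real^('n::finite + 'n + 'n + 'n)^('n + 'n)"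
  assumes ab: "a < b" and eq: "\<And>t z. t \<ge> 0 \<Longrightarrow> z \<in> rect a b \<Longrightarrow> \<phi> t z = \<phi>' t z"
    and eq0: "\<And>z. z \<in> rect a b \<Longrightarrow> \<phi>0 z = \<phi>0' z"
  shows "PDE_solution a b B \<tau> A_d v \<phi> p \<phi>0 \<longleftrightarrow> PDE_solution a b B \<tau> A_d v \<phi>' p \<phi>0'"
proof -
  have wd: "wd2 a b 1 0 (\<phi> t) = wd2 a b 1 0 (\<phi>' t)" if "t \<ge> 0" for t
    using weak_deriv_cong[of "rect a b" "\<phi> t" "\<phi>' t", OF eq[OF that]] by blast
  have e1: "\<phi> t (1, x) = \<phi>' t (1, x)" if "t \<ge> 0" "x \<in> {a..b}" for t x using eq[of t "(1, x)"] that by simp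
  have wd1: "wd1 a b \<beta> (\<lambda>x. \<phi> t (1, x)) = wd1 a b \<beta> (\<lambda>x. \<phi>' t (1, x))" if "t \<ge> 0" for t \<beta>
    using weak_deriv_cong[of "{a..b}" "\<lambda>x. \<phi> t (1, x)" "\<lambda>x. \<phi>' t (1, x)", OF e1[OF that]] by blast
  have AE: "(AE x in lebesgue_on {a..b}. p t x = A_d x *v (\<phi> t (1, x) on_top f x on_top g x))
      \<longleftrightarrow> (AE x in lebesgue_on {a..b}. p t x = A_d x *v (\<phi>' t (1, x) on_top f x on_top g x))" if "t \<ge> 0" for t f g
    using e1[OF that] by (intro AE_cong) simp
  have Y: "\<phi> t \<in> Y_space a b B u \<longleftrightarrow> \<phi>' t \<in> Y_space a b B u" if "t \<ge> 0" for t u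
    by (rule Y_space_cong[OF ab eq[OF that]])
  have init: "(\<forall>z\<in>rect a b. \<phi> 0 z = \<phi>0 z) \<longleftrightarrow> (\<forall>z\<in>rect a b. \<phi>' 0 z = \<phi>0' z)" using eq[of 0] eq0 by auto
  define P where "P f t \<longleftrightarrow> f t \<in> Y_space a b B (T1_op a b B (v t)) \<and>
      (\<exists>\<phi>t\<in>H12 a b. \<exists>\<phi>s. time_deriv (H12_norm a b) f \<phi>t t \<and> wd2 a b 1 0 (f t) \<phi>s \<and>
         (AE z in lebesgue_on (rect a b). \<phi>t z = - (1 / \<tau>) *\<^sub>R \<phi>s z)) \<and>
      (\<exists>\<phi>x \<phi>xx. wd1 a b 1 (\<lambda>x. f t (1, x)) \<phi>x \<and> wd1 a b 2 (\<lambda>x. f t (1, x)) \<phi>xx \<and>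
         (AE x in lebesgue_on {a..b}. p t x = A_d x *v (f t (1, x) on_top \<phi>x x on_top \<phi>xx x)))"
    for f :: "real \<Rightarrow> real \<times> real \<Rightarrow> real^'n" and t
  have td: "time_deriv (H12_norm a b) \<phi> \<phi>t t \<longleftrightarrow> time_deriv (H12_norm a b) \<phi>' \<phi>t t" if "t \<ge> 0" for t \<phi>t
    using eq that by (rule time_deriv_H12_cong)
  have P: "P \<phi> t \<longleftrightarrow> P \<phi>' t" if "t \<ge> 0" for t
    unfolding P_def Y[OF that] wd[OF that] wd1[OF that] AE[OF that] td[OF that] ..
  have PDE: "PDE_solution a b B \<tau> A_d v f p f0 \<longleftrightarrow> (\<forall>z\<in>rect a b. f 0 z = f0 z) \<and> (\<forall>t\<ge>0. P f t)" for f f0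
    unfolding PDE_solution_def P_def ..
  show ?thesis
    unfolding PDE init by (simp only: P cong: imp_cong)
qed

theorem lemma7:
  fixes a b \<tau> :: real
    and A_d :: "real \<Rightarrow> real^('n::finite + 'n + 'n)^'n"
    and B :: "real^('n + 'n + 'n + 'n)^('n + 'n)"
    and v :: "real \<Rightarrow> real \<Rightarrow> real^'n"
  assumes "a < b" and "\<tau> > 0"
    and "A_d \<in> Linf {a..b}"
    and "invertible (B ** H_mat a b)"
    and "\<forall>t\<ge>0. v t \<in> L2 {a..b}"
  shows
    "(\<forall>\<psi> \<psi>0 p.
        (\<forall>t\<ge>0. \<psi> t \<in> L2 (rect a b)) \<longrightarrow> \<psi>0 \<in> L2 (rect a b) \<longrightarrow>
        (PIE_solution a b B \<tau> A_d v \<psi> p \<psi>0 \<longleftrightarrow>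
         PDE_solution a b B \<tau> A_d v (\<lambda>t. T12_op a b B (v t) (\<psi> t)) p
           (T12_op a b B (v 0) \<psi>0)))
     \<and>
     (\<forall>\<phi> \<phi>0 \<psi> \<psi>0 p.
        (\<forall>t\<ge>0. \<phi> t \<in> Y_space a b B (T1_op a b B (v t))) \<longrightarrow>
        \<phi>0 \<in> Y_space a b B (T1_op a b B (v 0)) \<longrightarrow>
        (\<forall>t\<ge>0. wd2 a b 1 2 (\<phi> t) (\<psi> t)) \<longrightarrow>
        wd2 a b 1 2 \<phi>0 \<psi>0 \<longrightarrow>
        (PDE_solution a b B \<tau> A_d v \<phi> p \<phi>0 \<longleftrightarrow>
         PIE_solution a b B \<tau> A_d v \<psi> p \<psi>0))"
proof (intro conjI allI impI)
  fix \<psi> :: "real \<Rightarrow> real \<times> real \<Rightarrow> real^'n" and \<psi>0 :: "real \<times> real \<Rightarrow> real^'n" and p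
  assume "\<forall>t\<ge>0. \<psi> t \<in> L2 (rect a b)" "\<psi>0 \<in> L2 (rect a b)"
  then show "PIE_solution a b B \<tau> A_d v \<psi> p \<psi>0 \<longleftrightarrow>
         PDE_solution a b B \<tau> A_d v (\<lambda>t. T12_op a b B (v t) (\<psi> t)) p (T12_op a b B (v 0) \<psi>0)"
    by (rule PIE_iff_PDE[OF assms(1,4,5)])
next
  fix \<phi> \<psi> :: "real \<Rightarrow> real \<times> real \<Rightarrow> real^'n" and \<phi>0 \<psi>0 :: "real \<times> real \<Rightarrow> real^'n" and p
  assume \<phi>: "\<forall>t\<ge>0. \<phi> t \<in> Y_space a b B (T1_op a b B (v t))" and \<phi>0: "\<phi>0 \<in> Y_space a b B (T1_op a b B (v 0))"
    and wd: "\<forall>t\<ge>0. wd2 a b 1 2 (\<phi> t) (\<psi> t)" and wd0: "wd2 a b 1 2 \<phi>0 \<psi>0"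
  have \<psi>: "\<forall>t\<ge>0. \<psi> t \<in> L2 (rect a b)" and \<psi>0: "\<psi>0 \<in> L2 (rect a b)"
    using wd wd0 by (blast intro: weak_deriv_L2(2))+
  have v: "v t \<in> L2 {a..b}" if "t \<ge> 0" for t using assms(5) that by blast
  have "\<phi> t z = T12_op a b B (v t) (\<psi> t) z" if "t \<ge> 0" "z \<in> rect a b" for t z
    using state_eq_T12[OF assms(1,4) v[OF that(1)]] \<phi> wd that by blast
  moreover have "\<phi>0 z = T12_op a b B (v 0) \<psi>0 z" if "z \<in> rect a b" for z
    by (rule state_eq_T12[OF assms(1,4) v[OF order_refl] \<phi>0 wd0 that])
  ultimately have "PDE_solution a b B \<tau> A_d v \<phi> p \<phi>0 \<longleftrightarrow>
      PDE_solution a b B \<tau> A_d v (\<lambda>t. T12_op a b B (v t) (\<psi> t)) p (T12_op a b B (v 0) \<psi>0)"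
    by (rule PDE_solution_cong[OF assms(1)])
  then show "PDE_solution a b B \<tau> A_d v \<phi> p \<phi>0 \<longleftrightarrow> PIE_solution a b B \<tau> A_d v \<psi> p \<psi>0"
    using PIE_iff_PDE[OF assms(1,4,5) \<psi> \<psi>0] by simp
qed

end
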